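(* Let $H=-\frac{1}{4\pi}\Delta+\pi|x|^2$ on $\mathbb{R}^d$. For every $2\le r\le\infty$, with $1/r+1/r'=1$, we have the fixed-time estimates $$\|e^{itH}u_0\|_{W(\mathcal{F}L^{r'},L^r)}\lesssim|\sin t|^{-2d\left(\frac12-\frac1r\right)}\|u_0\|_{W(\mathcal{F}L^{r},L^{r'})}$$ for all $u_0\in W(\mathcal{F}L^{r},L^{r'})(\mathbb{R}^d)$ and all $t\in\mathbb{R}$ with $\sin t\neq0$, where the implied constant is independent of $t$ and $u_0$.
   Context: Fourier transform: $\hat f(\xi)=\int_{\mathbb{R}^d} f(t)e^{-2\pi i t\cdot\xi}\,dt$; $T_xg(t)=g(t-x)$; $\|h\|_{\mathcal{F}L^p}=\|\hat h\|_{L^p}$. Wiener amalgam space: fix a window $g\in C_0^\infty(\mathbb{R}^d)$ with $\|g\|_{L^2}=1$. For $1\le p,q\le\infty$, $W(\mathcal{F}L^p,L^q)$ is the space of tempered distributions $f$ on $\mathbb{R}^d$ with $\|f\|_{W(\mathcal{F}L^p,L^q)}=\bigl\|\,\|f\,T_xg\|_{\mathcal{F}L^p}\bigr\|_{L^q_x}<\infty$. Different nonzero windows give equivalent norms. $e^{itH}$ is the unitary group on $L^2(\mathbb{R}^d)$ generated by the self-adjoint operator $H$ (closure from $\mathcal{S}(\mathbb{R}^d)$); $u(t)=e^{itH}u_0$ solves $i\partial_tu+Hu=0$, $u(0)=u_0$. It is (up to sign) the metaplectic operator associated with the symplectic matrix $\begin{pmatrix}(\cos t)I&(\sin t)I\\(-\sin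 t)I&(\cos t)I\end{pmatrix}$; it preserves $\mathcal{S}(\mathbb{R}^d)$ and extends continuously to $\mathcal{S}'(\mathbb{R}^d)$. *)

theory Defs
  imports "HOL-Probability.Probability"
begin

text \<open>
  The space $\mathbb R^d$ is rendered by a type of class \<open>euclidean_space\<close>, with $d$ =
  \<open>DIM('a)\<close>. Elements of $L^2$ are represented by Borel functions, so
  identities in $L^2$ are stated almost everywhere. Exponents in $[1,\infty]$ have type
  \<open>ennreal\<close>, where \<open>1 / \<infinity> = 0\<close>.
\<close>

definition ennreal_powr :: "ennreal \<Rightarrow> real \<Rightarrow> ennreal" where
  "ennreal_powr x a = (if x = \<infinity> then \<infinity> else ennreal (enn2real x powr a))"
  \<comment> \<open>only used for positive \<open>a\<close>\<close>

text \<open>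
  The norm of a $[0,\infty]$-valued function. It has values in $[0,\infty]$, so that
  inequalities between norms need no side condition.
\<close>

definition eLp_norm :: "ennreal \<Rightarrow> ('a::euclidean_space \<Rightarrow> ennreal) \<Rightarrow> ennreal" where
  "eLp_norm p F =
     (if p = \<infinity> then esssup lborel F
      else ennreal_powr (\<integral>\<^sup>+ x. ennreal_powr (F x) (enn2real p) \<partial>lborel) (1 / enn2real p))"

definition Lp_norm :: "ennreal \<Rightarrow> ('a::euclidean_space \<Rightarrow> complex) \<Rightarrow> ennreal" where
  "Lp_norm p f = eLp_norm p (\<lambda>x. ennreal (norm (f x)))"

definition L2_space :: "('a::euclidean_space \<Rightarrow> complex) set" where
  "L2_space = {f \<in> borel_measurable lborel. Lp_norm 2 f < \<infinity>}"

primrec partial_derivs ::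
    "'a::euclidean_space list \<Rightarrow> ('a \<Rightarrow> complex) \<Rightarrow> 'a \<Rightarrow> complex" where
  "partial_derivs [] f = f"
| "partial_derivs (b # bs) f = (\<lambda>x. frechet_derivative (partial_derivs bs f) (at x) b)"

definition smooth :: "('a::euclidean_space \<Rightarrow> complex) \<Rightarrow> bool" where
  "smooth f \<longleftrightarrow>
     (\<forall>bs. set bs \<subseteq> Basis \<longrightarrow> (\<forall>x. partial_derivs bs f differentiable (at x)))"

definition test_function :: "('a::euclidean_space \<Rightarrow> complex) \<Rightarrow> bool" where
  "test_function f \<longleftrightarrow> smooth f \<and> compact (closure {x. f x \<noteq> 0})"

definition schwartz :: "('a::euclidean_space \<Rightarrow> complex) set" where
  "schwartz = {f. smooth f \<and>
     (\<forall>bs k. set bs \<subseteq> Basis \<longrightarrow>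
        bounded (range (\<lambda>x. (1 + norm x) ^ k * norm (partial_derivs bs f x))))}"

definition schwartz_norm :: "nat \<Rightarrow> ('a::euclidean_space \<Rightarrow> complex) \<Rightarrow> real" where
  "schwartz_norm N f =
     (\<Sum>bs | set bs \<subseteq> Basis \<and> length bs \<le> N.
        SUP x. (1 + norm x) ^ N * norm (partial_derivs bs f x))"

text \<open>
  A distribution is a functional of which only the values on \<^const>\<open>schwartz\<close> matter. The
  pairing is bilinear, not sesquilinear.
\<close>

type_synonym 'a distribution = "('a \<Rightarrow> complex) \<Rightarrow> complex"

definition tempered :: "'a::euclidean_space distribution \<Rightarrow> bool" where
  "tempered T \<longleftrightarrow>
     (\<forall>\<phi>\<in>schwartz. \<forall>\<psi>\<in>schwartz. \<forall>a b.
        T (\<lambda>x. a * \<phi> x + b * \<psi> x) = a * T \<phi> + b * T \<psi>) \<and>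
     (\<exists>C N. \<forall>\<phi>\<in>schwartz. norm (T \<phi>) \<le> C * schwartz_norm N \<phi>)"

definition represents ::
    "('a::euclidean_space \<Rightarrow> complex) \<Rightarrow> 'a distribution \<Rightarrow> bool" where
  "represents F T \<longleftrightarrow> F \<in> borel_measurable lborel \<and>
     (\<forall>\<phi>\<in>schwartz. integrable lborel (\<lambda>x. F x * \<phi> x) \<and>
        T \<phi> = (LINT x|lborel. F x * \<phi> x))"

definition dist_mult ::
    "'a::euclidean_space distribution \<Rightarrow> ('a \<Rightarrow> complex) \<Rightarrow> 'a distribution" where
  "dist_mult T \<psi> = (\<lambda>\<phi>. T (\<lambda>x. \<psi> x * \<phi> x))"

definition fourier :: "('a::euclidean_space \<Rightarrow> complex) \<Rightarrow> 'a \<Rightarrow> complex" where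
  "fourier f \<xi> = (LINT t|lborel. f t * cis (- 2 * pi * (t \<bullet> \<xi>)))"

definition dist_fourier :: "'a::euclidean_space distribution \<Rightarrow> 'a distribution" where
  "dist_fourier T = (\<lambda>\<phi>. T (fourier \<phi>))"

text \<open>
  Two functions representing the same distribution agree almost everywhere, so the infimum is
  over a single value; it is \<open>\<infinity>\<close> if the Fourier transform is not a function.
\<close>

definition FLp_norm :: "ennreal \<Rightarrow> 'a::euclidean_space distribution \<Rightarrow> ennreal" where
  "FLp_norm p T = (INF F \<in> {F. represents F (dist_fourier T)}. Lp_norm p F)"

definition translate ::
    "'a::euclidean_space \<Rightarrow> ('a \<Rightarrow> complex) \<Rightarrow> 'a \<Rightarrow> complex" where
  "translate x g = (\<lambda>t. g (t - x))"

definition amalgam_norm ::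
    "('a::euclidean_space \<Rightarrow> complex) \<Rightarrow> ennreal \<Rightarrow> ennreal \<Rightarrow> 'a distribution \<Rightarrow> ennreal" where
  "amalgam_norm g p q T = eLp_norm q (\<lambda>x. FLp_norm p (dist_mult T (translate x g)))"

definition amalgam ::
    "('a::euclidean_space \<Rightarrow> complex) \<Rightarrow> ennreal \<Rightarrow> ennreal \<Rightarrow> 'a distribution set" where
  "amalgam g p q = {T. tempered T \<and> amalgam_norm g p q T < \<infinity>}"

definition laplacian :: "('a::euclidean_space \<Rightarrow> complex) \<Rightarrow> 'a \<Rightarrow> complex" where
  "laplacian f x = (\<Sum>b\<in>Basis. partial_derivs [b, b] f x)"

definition harmonic_oscillator :: "('a::euclidean_space \<Rightarrow> complex) \<Rightarrow> 'a \<Rightarrow> complex" where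
  "harmonic_oscillator f x =
     - complex_of_real (1 / (4 * pi)) * laplacian f x + complex_of_real (pi * (norm x)\<^sup>2) * f x"

text \<open>
  Unbounded operators on $L^2$ are given by their graphs. The following is the closure in
  $L^2\times L^2$ of the graph of an operator defined on \<^const>\<open>schwartz\<close>.
\<close>

definition closure_from_schwartz ::
    "(('a::euclidean_space \<Rightarrow> complex) \<Rightarrow> 'a \<Rightarrow> complex) \<Rightarrow>
     (('a \<Rightarrow> complex) \<times> ('a \<Rightarrow> complex)) set" where
  "closure_from_schwartz A =
     {(f, h). f \<in> L2_space \<and> h \<in> L2_space \<and>
        (\<exists>\<phi> :: nat \<Rightarrow> 'a \<Rightarrow> complex. (\<forall>n. \<phi> n \<in> schwartz) \<and>
           (\<lambda>n. Lp_norm 2 (\<lambda>x. \<phi> n x - f x)) \<longlonglongrightarrow> 0 \<and>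
           (\<lambda>n. Lp_norm 2 (\<lambda>x. A (\<phi> n) x - h x)) \<longlonglongrightarrow> 0)}"

definition unitary_group ::
    "(real \<Rightarrow> ('a::euclidean_space \<Rightarrow> complex) \<Rightarrow> 'a \<Rightarrow> complex) \<Rightarrow> bool" where
  "unitary_group U \<longleftrightarrow>
     (\<forall>t. \<forall>f\<in>L2_space. U t f \<in> L2_space \<and> Lp_norm 2 (U t f) = Lp_norm 2 f) \<and>
     (\<forall>t. \<forall>f\<in>L2_space. \<forall>h\<in>L2_space. \<forall>a b.
        AE x in lborel. U t (\<lambda>y. a * f y + b * h y) x = a * U t f x + b * U t h x) \<and>
     (\<forall>f\<in>L2_space. AE x in lborel. U 0 f x = f x) \<and>
     (\<forall>s t. \<forall>f\<in>L2_space. AE x in lborel. U (s + t) f x = U s (U t f) x) \<and>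
     (\<forall>f\<in>L2_space. ((\<lambda>t. Lp_norm 2 (\<lambda>x. U t f x - f x)) \<longlongrightarrow> 0) (at 0))"

text \<open>
  The statement $U(t)=e^{itA}$: the derivative of $U(t)f$ at $t=0$ exists in $L^2$
  and equals $h'$ if and only if $f$ is in the domain of $A$ and $h'=iAf$. By Stone's theorem this
  determines $U$ (up to null sets), and such $U$ exists if and only if $A$ is self-adjoint.
\<close>

definition unitary_group_generated_by ::
    "(real \<Rightarrow> ('a::euclidean_space \<Rightarrow> complex) \<Rightarrow> 'a \<Rightarrow> complex) \<Rightarrow>
     (('a \<Rightarrow> complex) \<times> ('a \<Rightarrow> complex)) set \<Rightarrow> bool" where
  "unitary_group_generated_by U A \<longleftrightarrow> unitary_group U \<and>
     (\<forall>f\<in>L2_space. \<forall>h\<in>L2_space.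
        (f, h) \<in> A \<longleftrightarrow>
        ((\<lambda>t. Lp_norm 2 (\<lambda>x. (U t f x - f x) / complex_of_real t - \<i> * h x)) \<longlongrightarrow> 0) (at 0))"

definition schwartz_representative ::
    "('a::euclidean_space \<Rightarrow> complex) \<Rightarrow> 'a \<Rightarrow> complex" where
  "schwartz_representative f = (THE \<psi>. \<psi> \<in> schwartz \<and> (AE x in lborel. \<psi> x = f x))"

text \<open>
  The extension of $U(t)$ to tempered distributions. Unitarity gives
  $\int (U(t)f)\,\varphi = \int f\;\overline{U(-t)\overline{\varphi}}$ for $f\in L^2$, and the
  right-hand side makes sense for tempered $f$ once $U(-t)$ preserves the Schwartz class.
  Being a transpose, this is the weakly continuous extension. The class $U(-t)\overline\varphi$ in
  $L^2$ has to be replaced by its Schwartz representative before a distribution is applied to it.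
\<close>

definition dist_evolution ::
    "(real \<Rightarrow> ('a::euclidean_space \<Rightarrow> complex) \<Rightarrow> 'a \<Rightarrow> complex) \<Rightarrow>
     real \<Rightarrow> 'a distribution \<Rightarrow> 'a distribution" where
  "dist_evolution U t T =
     (\<lambda>\<phi>. T (\<lambda>x. cnj (schwartz_representative (U (- t) (\<lambda>y. cnj (\<phi> y))) x)))"

end

theory Submission
  imports Defs
begin

text \<open>
  No dispersive kernel and no interpolation are needed. For a tempered distribution $T$ and a
  window $g$ put $V_gT(x,\xi) = T(g(\cdot-x)e^{-2\pi i\xi\cdot})$; the norm of $W(\mathcal FL^p,L^q)$
  is the mixed norm $L^q_xL^p_\xi$ of $V_gT$. Gaussian wave packets stay Gaussian wave packets
  under $e^{itH}$ and are moved by the rotation of phase space: the explicit packets solve the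
  Schroedinger equation in $L^2$, and unitarity gives uniqueness. Every Schwartz function is a
  rapidly convergent superposition of such packets, hence the propagator preserves the Schwartz
  class. With the Gaussian window, $|V(e^{itH}T)(x,\xi)| = |VT(cx+s\xi, c\xi-sx)|$, where $c=\cos t$ and
  $s=\sin t$. After the substitutions $y = cx+s\xi$ and $\eta = (cy-x)/s$, which produce the power of
  $|s|$, the estimate is Minkowski's inequality
  $\| \|F\|_{L^{r'}_y} \|_{L^r_x} \le \| \|F\|_{L^r_x} \|_{L^{r'}_y}$ for $r'\le r$. Passing between
  $g$ and the Gaussian window costs constants independent of $t$: one window is a superposition
  of wave packets of the other with integrable coefficients.
\<close>

subsection \<open>Norms of nonnegative functions\<close>

text \<open>The propagator is given only as an abstract unitary group on L^2, so every identity for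
  \<open>U t f\<close> holds almost everywhere, whereas a tempered distribution must be applied to
  an actual Schwartz function. This is why an explicit Schwartz function, the superposition of
  evolved packets, is built independently of \<open>U\<close> and identified with
  \<open>U t \<phi>\<close> afterwards. The Schwartz space is not a Banach space, so its integrals
  are not Bochner integrals; finite quadrature sums that converge in every seminorm take their
  place, both under T and under the propagator. The Gaussian is used because it is the ground state
  of H: a quadratic exponent of exactly this width keeps its shape, and the Schroedinger equation
  becomes an identity between parameters. A further obstacle lies in the norm itself: the
  Fourier-Lebesgue norm is an infimum over representing functions, and mollification is needed to
  see that the continuous function V_g T(x, .) attains it.\<close>

lemma ennreal_powr_ennreal: "0 \<le> x \<Longrightarrow> ennreal_powr (ennreal x) a = ennreal (x powr a)"
  by (simp add: ennreal_powr_def)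

lemma ennreal_powr_top [simp]: "ennreal_powr \<infinity> a = \<infinity>" "ennreal_powr top a = top"
  by (simp_all add: ennreal_powr_def)

lemma ennreal_powr_0 [simp]: "ennreal_powr 0 a = 0"
  by (simp add: ennreal_powr_def)

lemma ennreal_powr_one [simp]: "ennreal_powr x 1 = x"
  by (cases x) (simp_all add: ennreal_powr_def)

lemma ennreal_powr_powr: "ennreal_powr (ennreal_powr x a) b = ennreal_powr x (a * b)"
  by (cases x) (simp_all add: ennreal_powr_def powr_powr)

lemma ennreal_powr_mult:
  "ennreal_powr (x * y) a = ennreal_powr x a * ennreal_powr y a"
proof (cases x; cases y)
  fix s u :: real assume "x = ennreal s" "0 \<le> s" "y = ennreal u" "0 \<le> u"
  then show ?thesis
    by (simp add: ennreal_mult'[symmetric] ennreal_powr_ennreal powr_mult)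
qed (auto simp: ennreal_mult_top ennreal_top_mult ennreal_powr_def enn2real_eq_0_iff)

lemma ennreal_powr_mono: "x \<le> y \<Longrightarrow> 0 \<le> a \<Longrightarrow> ennreal_powr x a \<le> ennreal_powr y a"
  by (cases x; cases y) (auto simp: ennreal_powr_def powr_mono2 top_unique)

lemma ennreal_powr_eq_0_iff [simp]: "ennreal_powr x a = 0 \<longleftrightarrow> x = 0"
  by (cases x) (auto simp: ennreal_powr_def)

lemma ennreal_powr_eq_top_iff [simp]: "ennreal_powr x a = top \<longleftrightarrow> x = top"
  by (cases x) (auto simp: ennreal_powr_def)

lemma borel_measurable_ennreal_powr [measurable]:
  assumes [measurable]: "f \<in> borel_measurable M"
  shows "(\<lambda>x. ennreal_powr (f x) a) \<in> borel_measurable M"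
proof -
  have [measurable]: "{x \<in> space M. f x = \<infinity>} \<in> sets M" by simp
  show ?thesis unfolding ennreal_powr_def by measurable
qed

section \<open>Jensen's inequality and Minkowski's integral inequality\<close>

lemma youngs_tangent:
  fixes p c u :: real
  assumes "1 \<le> p" "0 < c" "0 \<le> u"
  shows "p * c powr (p - 1) * u \<le> u powr p + (p - 1) * c powr p"
proof (cases "u = 0")
  case False
  \<comment> \<open>Weighted arithmetic-geometric means of \<open>u powr p\<close> and
    \<open>c powr p\<close>. The result says that the graph of u^p lies above its tangent at
    c.\<close>
  have "(u powr p) powr (1/p) * (c powr p) powr (1 - 1/p) \<le> (1/p) * u powr p + (1 - 1/p) * c powr p"
    using assms False by (intro Youngs_inequality_0) auto
  moreover have "(u powr p) powr (1/p) = u" "(c powr p) powr (1 - 1/p) = c powr (p - 1)"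
    using assms False by (auto simp: powr_powr right_diff_distrib)
  ultimately have "p * (u * c powr (p - 1)) \<le> p * ((1/p) * u powr p + (1 - 1/p) * c powr p)"
    using assms by (intro mult_left_mono) auto
  also have "\<dots> = u powr p + (p - 1) * c powr p"
    using assms by (simp add: field_simps)
  finally show ?thesis by (simp add: mult_ac)
qed (use assms in auto)

text \<open>Jensen's inequality for the measure with density n, whose mass is at most A: the tangent
  inequality is integrated with weight n while the point of contact c stays free, and c is chosen at
  the end.\<close>

lemma nn_integral_powr_jensen:
  assumes [measurable]: "n \<in> borel_measurable M" "k \<in> borel_measurable M"
    and p: "1 \<le> p" and A: "0 < A" "(\<integral>\<^sup>+w. n w \<partial>M) \<le> ennreal A"
  shows "ennreal_powr (\<integral>\<^sup>+w. n w * k w \<partial>M) p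
    \<le> ennreal (A powr (p - 1)) * (\<integral>\<^sup>+w. n w * ennreal_powr (k w) p \<partial>M)"
proof (cases "(\<integral>\<^sup>+w. n w * ennreal_powr (k w) p \<partial>M) = top")
  case True
  then show ?thesis using A by (simp add: ennreal_mult_top)
next
  case False
  then obtain j where j: "(\<integral>\<^sup>+w. n w * ennreal_powr (k w) p \<partial>M) = ennreal j" "0 \<le> j"
    by (metis ennreal_cases infinity_ennreal_def)
  have young: "ennreal (p * c powr (p - 1)) * x \<le> ennreal_powr x p + ennreal ((p - 1) * c powr p)"
    if "0 < c" for c x
  proof (cases x)
    case (real u)
    then show ?thesis
      using p that youngs_tangent[OF p that, of u]
      by (simp add: ennreal_powr_ennreal ennreal_mult'[symmetric] ennreal_plus[symmetric] del: ennreal_plus)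
  qed simp
  have int: "ennreal (p * c powr (p - 1)) * (\<integral>\<^sup>+w. n w * k w \<partial>M)
      \<le> ennreal j + ennreal ((p - 1) * c powr p) * (\<integral>\<^sup>+w. n w \<partial>M)" if c: "0 < c" for c
  proof -
    have "ennreal (p * c powr (p - 1)) * (\<integral>\<^sup>+w. n w * k w \<partial>M)
        = (\<integral>\<^sup>+w. n w * (ennreal (p * c powr (p - 1)) * k w) \<partial>M)"
      by (subst nn_integral_cmult[symmetric]) (auto simp: mult_ac)
    also have "\<dots> \<le> (\<integral>\<^sup>+w. n w * (ennreal_powr (k w) p + ennreal ((p - 1) * c powr p)) \<partial>M)"
      by (intro nn_integral_mono mult_left_mono young c) simp
    also have "\<dots> = (\<integral>\<^sup>+w. n w * ennreal_powr (k w) p + ennreal ((p - 1) * c powr p) * n w \<partial>M)"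
      by (simp add: distrib_left mult_ac)
    also have "\<dots> = ennreal j + ennreal ((p - 1) * c powr p) * (\<integral>\<^sup>+w. n w \<partial>M)"
      by (subst nn_integral_add) (auto simp: nn_integral_cmult j)
    finally show ?thesis .
  qed
  have int': "ennreal (p * c powr (p - 1)) * (\<integral>\<^sup>+w. n w * k w \<partial>M)
      \<le> ennreal (j + (p - 1) * c powr p * A)" if c: "0 < c" for c
  proof -
    have "ennreal (p * c powr (p - 1)) * (\<integral>\<^sup>+w. n w * k w \<partial>M)
      \<le> ennreal j + ennreal ((p - 1) * c powr p) * ennreal A"
      by (rule order_trans[OF int[OF c]]) (intro add_left_mono mult_left_mono A, simp)
    also have "\<dots> = ennreal (j + (p - 1) * c powr p * A)"
      using p A j by (simp add: ennreal_mult'[symmetric] ennreal_plus[symmetric] del: ennreal_plus)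
    finally show ?thesis .
  qed
  \<comment> \<open>The contact point c = 1 already bounds the integral by a real number.\<close>
  have "(\<integral>\<^sup>+w. n w * k w \<partial>M) \<noteq> top"
    using int'[of 1] p by (auto simp: ennreal_mult_top top_unique)
  then obtain i where i: "(\<integral>\<^sup>+w. n w * k w \<partial>M) = ennreal i" "0 \<le> i"
    by (metis ennreal_cases infinity_ennreal_def)
  show ?thesis
  proof (cases "i = 0")
    case False
    \<comment> \<open>The best contact point: the mean value of k when the mass equals A.\<close>
    define c where "c = i / A"
    have c: "0 < c" using False i A by (simp add: c_def)
    have "p * c powr (p - 1) * i \<le> j + (p - 1) * c powr p * A"
      using int'[OF c] i j A p c
      by (simp add: ennreal_mult'[symmetric] ennreal_plus[symmetric] ennreal_le_iff del: ennreal_plus)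
    moreover have "c powr (p - 1) * i = c powr p * A"
    proof -
      have "i = c * A" using A by (simp add: c_def)
      moreover have "c powr (p - 1) * c = c powr p"
        using c powr_add[of c "p - 1" 1] by simp
      ultimately show ?thesis by simp
    qed
    ultimately have "p * (c powr p * A) \<le> j + (p - 1) * (c powr p * A)"
      by (simp only: mult.assoc)
    then have "c powr p * A \<le> j"
      by (simp add: left_diff_distrib)
    then have "A powr (p - 1) * (c powr p * A) \<le> A powr (p - 1) * j"
      by (intro mult_left_mono) auto
    moreover have "A powr (p - 1) * (c powr p * A) = i powr p"
    proof -
      have "i = c * A" using A by (simp add: c_def)
      moreover have "A powr (p - 1) * A = A powr p"
        using A powr_add[of A "p - 1" 1] by simp
      ultimately show ?thesis using c A by (simp add: powr_mult mult_ac)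
    qed
    ultimately show ?thesis
      using i j by (simp add: ennreal_powr_ennreal ennreal_mult'[symmetric])
  qed (simp add: i)
qed

text \<open>Comparison with positive real numbers above y removes the values 0 and \<infinity> of
  the right-hand side from the proof of Minkowski's inequality.\<close>

lemma le_if_le_above:
  fixes x y :: ennreal
  assumes "\<And>A. 0 < A \<Longrightarrow> y < ennreal A \<Longrightarrow> x \<le> ennreal A"
  shows "x \<le> y"
proof (rule dense_ge)
  fix z assume z: "y < z"
  show "x \<le> z"
  proof (cases z)
    case (real r)
    with z have "0 < r" by (metis ennreal_eq_0_iff linorder_not_less not_gr_zero order_less_le zero_le)
    with z real assms[of r] show ?thesis by simp
  qed simp
qed

text \<open>Each slice is factored as its L^p norm \<open>n w\<close> times a normalised function
  \<open>k w\<close>. The inner integral is then an integral of \<open>k\<close> with weight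
  \<open>n\<close>, Jensen applies, and Fubini evaluates the bound. This takes the place of the
  usual duality argument.\<close>

lemma minkowski_powr:
  fixes f :: "'w \<Rightarrow> 'x \<Rightarrow> ennreal"
  assumes sf: "sigma_finite_measure M" "sigma_finite_measure N"
    and m[measurable]: "(\<lambda>(w, x). f w x) \<in> borel_measurable (M \<Otimes>\<^sub>M N)" and p: "1 \<le> p"
  shows "ennreal_powr (\<integral>\<^sup>+x. ennreal_powr (\<integral>\<^sup>+w. f w x \<partial>M) p \<partial>N) (1 / p)
     \<le> (\<integral>\<^sup>+w. ennreal_powr (\<integral>\<^sup>+x. ennreal_powr (f w x) p \<partial>N) (1 / p) \<partial>M)"
proof (rule le_if_le_above)
  interpret M: sigma_finite_measure M by fact
  interpret N: sigma_finite_measure N by fact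
  interpret P: pair_sigma_finite M N ..
  define n where "n w = ennreal_powr (\<integral>\<^sup>+x. ennreal_powr (f w x) p \<partial>N) (1 / p)" for w
  define k where "k w x = f w x / n w" for w x
  fix A :: real assume A: "0 < A" "(\<integral>\<^sup>+w. ennreal_powr (\<integral>\<^sup>+x. ennreal_powr (f w x) p \<partial>N) (1 / p) \<partial>M) < ennreal A"
  have n[measurable]: "n \<in> borel_measurable M"
    unfolding n_def by measurable
  have nA: "(\<integral>\<^sup>+w. n w \<partial>M) \<le> ennreal A" using A by (simp add: n_def)
  have k[measurable]: "(\<lambda>(w, x). k w x) \<in> borel_measurable (M \<Otimes>\<^sub>M N)"
    unfolding k_def by measurable
  have k2[measurable]: "w \<in> space M \<Longrightarrow> k w \<in> borel_measurable N" for w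
    by measurable
  have fin: "AE w in M. n w \<noteq> top"
    using nA by (intro nn_integral_noteq_infinite[simplified]) (auto simp: top_unique)
  have npow: "ennreal_powr (n w) p = (\<integral>\<^sup>+x. ennreal_powr (f w x) p \<partial>N)" for w
    using p by (simp add: n_def ennreal_powr_powr)
  \<comment> \<open>Where \<open>n w = 0\<close> the slice vanishes almost everywhere, so the
    factorisation survives division by zero up to null sets.\<close>
  have eq: "AE w in M. AE x in N. f w x = n w * k w x"
    using fin AE_space
  proof eventually_elim
    fix w assume w: "n w \<noteq> top" "w \<in> space M"
    have [measurable]: "f w \<in> borel_measurable N" using w by measurable
    show "AE x in N. f w x = n w * k w x"
    proof (cases "n w = 0")
      case True
      then have "(\<integral>\<^sup>+x. ennreal_powr (f w x) p \<partial>N) = 0" using npow[of w] by simp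
      then have "AE x in N. f w x = 0" by (subst (asm) nn_integral_0_iff_AE) auto
      then show ?thesis by (auto simp: True)
    next
      case False
      then show ?thesis using w by (auto simp: k_def ennreal_times_divide mult.commute[of "n w"] ennreal_mult_divide_eq)
    qed
  qed
  have eq': "AE x in N. AE w in M. f w x = n w * k w x"
    using eq by (subst P.AE_commute[symmetric]) measurable
  \<comment> \<open>For \<open>n w\<close> neither 0 nor \<infinity>, the function
    \<open>k w\<close> has L^p norm exactly 1, by homogeneity.\<close>
  have kint: "n w * (\<integral>\<^sup>+x. ennreal_powr (k w x) p \<partial>N) \<le> n w" if w: "w \<in> space M" "n w \<noteq> top" for w
  proof (cases "n w = 0")
    case False
    have [measurable]: "f w \<in> borel_measurable N" using w by measurable
    have "ennreal_powr (n w) p * (\<integral>\<^sup>+x. ennreal_powr (k w x) p \<partial>N) = (\<integral>\<^sup>+x. ennreal_powr (n w * k w x) p \<partial>N)"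
      using w by (simp add: ennreal_powr_mult nn_integral_cmult)
    also have "\<dots> = ennreal_powr (n w) p"
      using w False by (simp add: npow k_def ennreal_times_divide mult.commute[of "n w"] ennreal_mult_divide_eq)
    finally have "ennreal_powr (n w) p * (\<integral>\<^sup>+x. ennreal_powr (k w x) p \<partial>N) = ennreal_powr (n w) p * 1" by simp
    then have "(\<integral>\<^sup>+x. ennreal_powr (k w x) p \<partial>N) = 1"
      using False w by (subst (asm) ennreal_mult_cancel_left) auto
    then show ?thesis by simp
  qed simp
  have "(\<integral>\<^sup>+x. ennreal_powr (\<integral>\<^sup>+w. f w x \<partial>M) p \<partial>N) = (\<integral>\<^sup>+x. ennreal_powr (\<integral>\<^sup>+w. n w * k w x \<partial>M) p \<partial>N)"
    using eq' by (intro nn_integral_cong_AE) (auto elim!: eventually_mono intro!: arg_cong[where f="\<lambda>a. ennreal_powr a p"] nn_integral_cong_AE)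
  also have "\<dots> \<le> (\<integral>\<^sup>+x. ennreal (A powr (p - 1)) * (\<integral>\<^sup>+w. n w * ennreal_powr (k w x) p \<partial>M) \<partial>N)"
    by (intro nn_integral_mono nn_integral_powr_jensen p A nA) auto
  also have "\<dots> = ennreal (A powr (p - 1)) * (\<integral>\<^sup>+x. (\<integral>\<^sup>+w. n w * ennreal_powr (k w x) p \<partial>M) \<partial>N)"
    by (intro nn_integral_cmult) measurable
  also have "(\<integral>\<^sup>+x. (\<integral>\<^sup>+w. n w * ennreal_powr (k w x) p \<partial>M) \<partial>N) = (\<integral>\<^sup>+w. (\<integral>\<^sup>+x. n w * ennreal_powr (k w x) p \<partial>N) \<partial>M)"
    by (rule P.Fubini') measurable
  also have "\<dots> = (\<integral>\<^sup>+w. n w * (\<integral>\<^sup>+x. ennreal_powr (k w x) p \<partial>N) \<partial>M)"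
    by (intro nn_integral_cong nn_integral_cmult) measurable
  also have "\<dots> \<le> (\<integral>\<^sup>+w. n w \<partial>M)"
  proof (rule nn_integral_mono_AE)
    show "AE w in M. n w * (\<integral>\<^sup>+x. ennreal_powr (k w x) p \<partial>N) \<le> n w"
      using fin AE_space by eventually_elim (rule kint)
  qed
  also have "\<dots> \<le> ennreal A" by (rule nA)
  also have "ennreal (A powr (p - 1)) * ennreal A = ennreal (A powr p)"
    using A powr_add[of A "p - 1" 1] by (simp add: ennreal_mult'[symmetric])
  finally have "(\<integral>\<^sup>+x. ennreal_powr (\<integral>\<^sup>+w. f w x \<partial>M) p \<partial>N) \<le> ennreal (A powr p)"
    by (simp add: mult_left_mono)
  then have "ennreal_powr (\<integral>\<^sup>+x. ennreal_powr (\<integral>\<^sup>+w. f w x \<partial>M) p \<partial>N) (1 / p) \<le> ennreal_powr (ennreal (A powr p)) (1 / p)"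
    using p by (intro ennreal_powr_mono) auto
  then show "ennreal_powr (\<integral>\<^sup>+x. ennreal_powr (\<integral>\<^sup>+w. f w x \<partial>M) p \<partial>N) (1 / p) \<le> ennreal A"
    using p A by (simp add: ennreal_powr_ennreal powr_powr)
qed

section \<open>Affine substitutions and mixed norms\<close>

lemma nn_integral_lborel_affine:
  fixes f :: "'a::euclidean_space \<Rightarrow> ennreal"
  assumes [measurable]: "f \<in> borel_measurable borel" and c: "c \<noteq> 0"
  shows "(\<integral>\<^sup>+x. f (t + c *\<^sub>R x) \<partial>lborel) = ennreal (1 / \<bar>c\<bar> ^ DIM('a)) * (\<integral>\<^sup>+x. f x \<partial>lborel)"
proof -
  have "(\<integral>\<^sup>+x. f x \<partial>lborel) = ennreal (\<bar>c\<bar> ^ DIM('a)) * (\<integral>\<^sup>+x. f (t + c *\<^sub>R x) \<partial>lborel)"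
    by (subst lborel_affine[OF c, of t])
       (simp add: nn_integral_density nn_integral_distr nn_integral_cmult)
  then have "ennreal (1 / \<bar>c\<bar> ^ DIM('a)) * (\<integral>\<^sup>+x. f x \<partial>lborel)
     = ennreal (1 / \<bar>c\<bar> ^ DIM('a) * \<bar>c\<bar> ^ DIM('a)) * (\<integral>\<^sup>+x. f (t + c *\<^sub>R x) \<partial>lborel)"
    by (subst ennreal_mult') (auto simp: mult.assoc)
  then show ?thesis using c by simp
qed

lemma AE_lborel_affine:
  fixes P :: "'a::euclidean_space \<Rightarrow> bool"
  assumes [measurable]: "Measurable.pred borel P" and "AE x in lborel. P x" and c: "c \<noteq> 0"
  shows "AE x in lborel. P (t + c *\<^sub>R x)"
proof -
  have "AE x in density (distr lborel borel (\<lambda>x. t + c *\<^sub>R x)) (\<lambda>_. \<bar>c\<bar> ^ DIM('a)). P x"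
    using assms(2) by (subst (asm) lborel_affine[OF c, of t])
  then show ?thesis using c by (simp add: AE_density AE_distr_iff)
qed

text \<open>For p = \<infinity> the essential supremum exceeds a exactly when the slice exceeds a on
  a set of positive measure; that measure is a parameter integral, hence measurable in w.\<close>

lemma borel_measurable_eLp_norm:
  fixes f :: "'w \<Rightarrow> 'a::euclidean_space \<Rightarrow> ennreal"
  assumes [measurable]: "(\<lambda>(w, x). f w x) \<in> borel_measurable (M \<Otimes>\<^sub>M lborel)"
  shows "(\<lambda>w. eLp_norm p (f w)) \<in> borel_measurable M"
proof (cases "p = \<infinity>")
  case True
  have "{w \<in> space M. a < esssup lborel (f w)} \<in> sets M" for a
  proof -
    have "a < esssup lborel (f w) \<longleftrightarrow> 0 < emeasure lborel {x. a < f w x}" if "w \<in> space M" for w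
    proof
      have [measurable]: "f w \<in> borel_measurable lborel" using that by measurable
      show "a < esssup lborel (f w)" if "0 < emeasure lborel {x. a < f w x}"
      proof (rule ccontr)
        assume "\<not> a < esssup lborel (f w)"
        then have "AE x in lborel. f w x \<le> a"
          using esssup_AE[of "f w" lborel] by (auto elim!: eventually_mono)
        then have "emeasure lborel {x. a < f w x} = 0"
          by (subst (asm) AE_iff_measurable[OF _ refl]) (auto simp: not_le)
        with that show False by simp
      qed
      show "0 < emeasure lborel {x. a < f w x}" if "a < esssup lborel (f w)"
        using esssup_pos_measure[of "f w" lborel a] that by simp
    qed
    then have "{w \<in> space M. a < esssup lborel (f w)}
      = {w \<in> space M. 0 < (\<integral>\<^sup>+x. indicator {a<..} (f w x) \<partial>lborel)}"
    proof (intro Collect_cong conj_cong refl)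
      fix w assume *: "\<And>w. w \<in> space M \<Longrightarrow> (a < esssup lborel (f w)) = (0 < emeasure lborel {x. a < f w x})" "w \<in> space M"
      have [measurable]: "f w \<in> borel_measurable lborel" using *(2) by measurable
      have "emeasure lborel {x. a < f w x} = (\<integral>\<^sup>+x. indicator {x. a < f w x} x \<partial>lborel)"
        by simp
      also have "\<dots> = (\<integral>\<^sup>+x. indicator {a<..} (f w x) \<partial>lborel)"
        by (intro nn_integral_cong) (auto simp: indicator_def)
      finally show "(a < esssup lborel (f w)) = (0 < (\<integral>\<^sup>+x. indicator {a<..} (f w x) \<partial>lborel))"
        using * by simp
    qed
    also have "\<dots> \<in> sets M" by measurable
    finally show ?thesis .
  qed
  then show ?thesis
    using True by (intro borel_measurableI_greater) (auto simp: eLp_norm_def)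
next
  case False
  then show ?thesis unfolding eLp_norm_def by simp
qed

lemma eLp_norm_mono_AE:
  assumes "AE x in lborel. F x \<le> G x" "F \<in> borel_measurable lborel"
  shows "eLp_norm p F \<le> eLp_norm p G"
proof (cases "p = \<infinity>")
  case True
  then show ?thesis using assms by (auto simp: eLp_norm_def intro!: esssup_AE_mono)
next
  case False
  then show ?thesis using assms
    by (auto simp: eLp_norm_def intro!: ennreal_powr_mono nn_integral_mono_AE elim!: eventually_mono)
qed

lemma eLp_norm_cong_AE:
  assumes "AE x in lborel. F x = G x" "F \<in> borel_measurable lborel" "G \<in> borel_measurable lborel"
  shows "eLp_norm p F = eLp_norm p G"
  using assms by (intro antisym eLp_norm_mono_AE) (auto elim!: eventually_mono)

lemma eLp_norm_cmult_le:
  assumes [measurable]: "F \<in> borel_measurable lborel" and p: "1 \<le> p"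
  shows "eLp_norm p (\<lambda>x. c * F x) \<le> c * eLp_norm p F"
proof (cases "p = \<infinity>")
  case True
  then show ?thesis using esssup_AE[of F lborel]
    by (auto simp: eLp_norm_def intro!: esssup_I mult_left_mono elim!: eventually_mono)
next
  case False
  then have "1 \<le> enn2real p" using p by (cases p) (auto simp flip: ennreal_1 simp: ennreal_le_iff2)
  then show ?thesis using False
    by (simp add: eLp_norm_def ennreal_powr_mult nn_integral_cmult ennreal_powr_powr)
qed

text \<open>The convention 1/\<infinity> = 0 lets the single factor |c|^(-d/p) cover the essential
  supremum, which is invariant under affine maps.\<close>

lemma eLp_norm_affine_le:
  fixes F :: "'a::euclidean_space \<Rightarrow> ennreal"
  assumes [measurable]: "F \<in> borel_measurable lborel" and c: "c \<noteq> 0" and p: "1 \<le> p"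
  shows "eLp_norm p (\<lambda>x. F (t + c *\<^sub>R x)) \<le> ennreal (\<bar>c\<bar> powr (- real DIM('a) * enn2real (1 / p))) * eLp_norm p F"
proof (cases "p = \<infinity>")
  case True
  have "AE x in lborel. F (t + c *\<^sub>R x) \<le> esssup lborel F"
    by (rule AE_lborel_affine[OF _ _ c]) (use esssup_AE[of F lborel] in auto)
  then show ?thesis using True c
    by (auto simp: eLp_norm_def intro!: esssup_I)
next
  case False
  then obtain r where r: "p = ennreal r" "1 \<le> r"
    using p by (cases p) (auto simp: ennreal_le_iff2 simp flip: ennreal_1)
  then have e: "enn2real (1 / p) = 1 / r"
    by (auto simp: ennreal_1[symmetric] divide_ennreal simp del: ennreal_1)
  have "(\<bar>c\<bar> ^ DIM('a)) powr (- (1 / r)) = \<bar>c\<bar> powr (- real DIM('a) * (1 / r))"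
    using c by (simp add: powr_realpow[symmetric] powr_powr)
  then have "(1 / \<bar>c\<bar> ^ DIM('a)) powr (1 / r) = \<bar>c\<bar> powr (- real DIM('a) * (1 / r))"
    using c by (simp add: powr_divide powr_minus field_simps)
  then show ?thesis using r c unfolding e
    by (simp add: eLp_norm_def nn_integral_lborel_affine[where f="\<lambda>x. ennreal_powr (F x) r"] ennreal_powr_mult ennreal_powr_ennreal)
qed

lemma eLp_norm_translate_le:
  fixes F :: "'a::euclidean_space \<Rightarrow> ennreal"
  assumes "F \<in> borel_measurable lborel" "1 \<le> p"
  shows "eLp_norm p (\<lambda>x. F (x + t)) \<le> eLp_norm p F"
  using eLp_norm_affine_le[OF assms(1) _ assms(2), of 1 t] by (simp add: add.commute)

text \<open>For p = \<infinity> the bound by the slice suprema holds almost everywhere in both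
  orders of the variables, because null sets of the product measure can be sliced either
  way.\<close>

lemma eLp_norm_minkowski:
  fixes f :: "'w \<Rightarrow> 'a::euclidean_space \<Rightarrow> ennreal"
  assumes sf: "sigma_finite_measure M"
    and m[measurable]: "(\<lambda>(w, x). f w x) \<in> borel_measurable (M \<Otimes>\<^sub>M lborel)" and p: "1 \<le> p"
  shows "eLp_norm p (\<lambda>x. \<integral>\<^sup>+w. f w x \<partial>M) \<le> (\<integral>\<^sup>+w. eLp_norm p (f w) \<partial>M)"
proof (cases "p = \<infinity>")
  case True
  interpret M: sigma_finite_measure M by fact
  interpret P: pair_sigma_finite M "lborel :: 'a measure" ..
  have [measurable]: "(\<lambda>w. esssup lborel (f w)) \<in> borel_measurable M"
    using borel_measurable_eLp_norm[OF m, of \<infinity>] by (simp add: eLp_norm_def)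
  have "AE w in M. AE x in lborel. f w x \<le> esssup lborel (f w)"
    by (intro AE_I2 esssup_AE)
  then have "AE x in lborel. AE w in M. f w x \<le> esssup lborel (f w)"
    by (subst P.AE_commute[symmetric]) measurable
  then have "AE x in lborel. (\<integral>\<^sup>+w. f w x \<partial>M) \<le> (\<integral>\<^sup>+w. esssup lborel (f w) \<partial>M)"
    by (auto elim!: eventually_mono intro!: nn_integral_mono_AE)
  then have "esssup lborel (\<lambda>x. \<integral>\<^sup>+w. f w x \<partial>M) \<le> (\<integral>\<^sup>+w. esssup lborel (f w) \<partial>M)"
    by (intro esssup_I) measurable
  then show ?thesis using True by (simp add: eLp_norm_def)
next
  case False
  then have "1 \<le> enn2real p" using p by (cases p) (auto simp flip: ennreal_1 simp: ennreal_le_iff2)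
  then show ?thesis using False minkowski_powr[OF sf lborel.sigma_finite_measure_axioms m]
    by (simp add: eLp_norm_def)
qed

text \<open>The triangle inequality is Minkowski's inequality for the counting measure on two
  points.\<close>

lemma eLp_norm_add_le:
  assumes [measurable]: "F \<in> borel_measurable lborel" "G \<in> borel_measurable lborel" and p: "1 \<le> p"
  shows "eLp_norm p (\<lambda>x. F x + G x) \<le> eLp_norm p F + eLp_norm p G"
proof -
  have "eLp_norm p (\<lambda>x. \<integral>\<^sup>+b. (if b then F x else G x) \<partial>count_space (UNIV :: bool set))
     \<le> (\<integral>\<^sup>+b. eLp_norm p (if b then F else G) \<partial>count_space (UNIV :: bool set))"
  proof -
    have "(\<lambda>(b, x). if b then F x else G x) \<in> borel_measurable (count_space (UNIV :: bool set) \<Otimes>\<^sub>M lborel)"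
      by measurable
    from eLp_norm_minkowski[OF _ this p] show ?thesis
      by (simp add: sigma_finite_measure_count_space_finite if_distrib[of "eLp_norm p"] cong: if_cong)
        (simp add: nn_integral_count_space_finite UNIV_bool)
  qed
  then show ?thesis
    by (simp add: nn_integral_count_space_finite UNIV_bool add.commute)
qed

text \<open>For finite q this is Minkowski's inequality with exponent q/p for the function f^p,
  raised to the power 1/p. For q = \<infinity> the inner norm is an integral and Minkowski applies
  directly.\<close>

lemma eLp_norm_swap:
  fixes f :: "'a::euclidean_space \<Rightarrow> 'b::euclidean_space \<Rightarrow> ennreal"
  assumes m[measurable]: "(\<lambda>(y, x). f y x) \<in> borel_measurable (lborel \<Otimes>\<^sub>M lborel)"
    and pq: "1 \<le> p" "p \<le> q" and inf: "q = \<infinity> \<Longrightarrow> p = 1"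
  shows "eLp_norm q (\<lambda>x. eLp_norm p (\<lambda>y. f y x)) \<le> eLp_norm p (\<lambda>y. eLp_norm q (f y))"
proof (cases "q = \<infinity>")
  case True
  with inf have "p = 1" by simp
  moreover have "eLp_norm 1 F = (\<integral>\<^sup>+x. F x \<partial>lborel)" for F :: "'a \<Rightarrow> ennreal"
    by (simp add: eLp_norm_def)
  ultimately show ?thesis using eLp_norm_minkowski[OF lborel.sigma_finite_measure_axioms m, of q] True
    by simp
next
  case False
  then obtain u v where uv: "p = ennreal u" "q = ennreal v" "1 \<le> u" "u \<le> v"
    using pq by (cases p; cases q) (auto simp: ennreal_le_iff2 top_unique simp flip: ennreal_1)
  define g where "g y x = ennreal_powr (f y x) u" for y x
  have g: "(\<lambda>(y, x). g y x) \<in> borel_measurable (lborel \<Otimes>\<^sub>M lborel)"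
    unfolding g_def by measurable
  have "ennreal_powr (\<integral>\<^sup>+x. ennreal_powr (\<integral>\<^sup>+y. g y x \<partial>lborel) (v / u) \<partial>lborel) (1 / (v / u))
     \<le> (\<integral>\<^sup>+y. ennreal_powr (\<integral>\<^sup>+x. ennreal_powr (g y x) (v / u) \<partial>lborel) (1 / (v / u)) \<partial>lborel)"
    using uv by (intro minkowski_powr[OF lborel.sigma_finite_measure_axioms lborel.sigma_finite_measure_axioms g]) (auto simp: field_simps)
  from ennreal_powr_mono[OF this, of "1 / u"] show ?thesis
    using uv by (simp add: eLp_norm_def ennreal_powr_powr g_def)
qed

section \<open>Conjugate exponents and the rotated mixed norm\<close>

lemma conjugate_exponents_cases:
  assumes "2 \<le> r" "1 / r + 1 / r' = (1::ennreal)"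
  obtains "r = \<infinity>" "r' = 1" | \<rho> where "r = ennreal \<rho>" "r' = ennreal (\<rho> / (\<rho> - 1))" "2 \<le> \<rho>"
proof (cases r)
  case (real \<rho>)
  have 2: "2 \<le> \<rho>" using assms(1) real by (metis ennreal_le_iff2 ennreal_numeral numeral_le_real_of_nat_iff linorder_not_le zero_le_numeral order_less_le_trans not_numeral_le_zero)
  then have inv: "1 / r = ennreal (1 / \<rho>)"
    using real by (simp add: ennreal_1[symmetric] divide_ennreal del: ennreal_1)
  have "r' \<noteq> top" using assms(2) inv 2 by (auto simp: divide_ennreal_def)
  moreover have "r' \<noteq> 0" using assms(2) inv 2 by (auto simp: divide_ennreal_def)
  ultimately obtain \<sigma> where s: "r' = ennreal \<sigma>" "0 < \<sigma>"
    by (cases r') (auto simp: less_le)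
  then have "1 / r' = ennreal (1 / \<sigma>)" by (simp add: ennreal_1[symmetric] divide_ennreal del: ennreal_1)
  with assms(2) inv 2 s have "1 / \<rho> + 1 / \<sigma> = 1"
    by (simp flip: ennreal_plus add: ennreal_eq_1)
  then have "\<sigma> = \<rho> / (\<rho> - 1)" using 2 s by (simp add: field_simps)
  with that(2) 2 s real show thesis by simp
next
  case top
  then have "1 / r' = 1" using assms by simp
  then have "r' = 1"
    by (cases r'; cases "r' = 0") (auto simp: divide_ennreal ennreal_eq_1 less_le split: if_splits simp flip: ennreal_1)
  with that(1) top show thesis by simp
qed

lemma conjugate_exponents:
  assumes "2 \<le> r" "1 / r + 1 / r' = (1::ennreal)"
  shows "1 \<le> r'" "r' \<le> r" "r = \<infinity> \<Longrightarrow> r' = 1" "enn2real (1 / r') = 1 - enn2real (1 / r)"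
proof -
  have *: "1 \<le> r' \<and> r' \<le> r \<and> (r = \<infinity> \<longrightarrow> r' = 1) \<and> enn2real (1 / r') = 1 - enn2real (1 / r)"
  proof (cases rule: conjugate_exponents_cases[OF assms])
    case (2 \<rho>)
    have "1 \<le> \<rho> / (\<rho> - 1)" "\<rho> / (\<rho> - 1) \<le> \<rho>"
      using 2(3) by (auto simp: field_simps intro!: mult_left_mono)
    moreover have "enn2real (1 / r) = 1 / \<rho>" "enn2real (1 / r') = 1 / (\<rho> / (\<rho> - 1))"
      unfolding 2 using 2(3) by (auto simp: divide_ennreal simp flip: ennreal_1)
    moreover have "1 / (\<rho> / (\<rho> - 1)) = 1 - 1 / \<rho>"
      using 2(3) by (simp add: field_simps)
    moreover have "1 \<le> r'" "r' \<le> r"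
      using calculation 2 by (auto simp: ennreal_leI simp flip: ennreal_1)
    ultimately show ?thesis
      using 2 by simp
  qed simp
  from * show "1 \<le> r'" "r' \<le> r" "r = \<infinity> \<Longrightarrow> r' = 1" "enn2real (1 / r') = 1 - enn2real (1 / r)"
    by auto
qed

text \<open>The origin of the power of |s|: replacing \<xi> by y dilates by s and gives |s|^(-d/r').
  After the exchange of norms x enters only through (c y - x)/s, a dilation by 1/s, which gives
  |s|^(d/r). As 1/r' = 1 - 1/r, the exponents add up to -d (1 - 2/r).\<close>

lemma eLp_norm_rotation_le:
  fixes F :: "'a::euclidean_space \<Rightarrow> 'a \<Rightarrow> ennreal"
  assumes F[measurable]: "(\<lambda>(y, x). F y x) \<in> borel_measurable (lborel \<Otimes>\<^sub>M lborel)"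
    and cs: "c\<^sup>2 + s\<^sup>2 = (1::real)" "s \<noteq> 0" and r: "2 \<le> r" "1 / r + 1 / r' = 1"
  shows "eLp_norm r (\<lambda>x. eLp_norm r' (\<lambda>\<xi>. F (c *\<^sub>R x + s *\<^sub>R \<xi>) (c *\<^sub>R \<xi> - s *\<^sub>R x)))
    \<le> ennreal (\<bar>s\<bar> powr (- 2 * real DIM('a) * (1 / 2 - enn2real (1 / r)))) * eLp_norm r' (\<lambda>y. eLp_norm r (F y))"
proof -
  note r' = conjugate_exponents(1-3)[OF r] and e = conjugate_exponents(4)[OF r]
  have r1: "1 \<le> r" using r' by simp
  define k where "k = ennreal (\<bar>s\<bar> powr (- real DIM('a) * enn2real (1 / r')))"
  define l where "l = ennreal (\<bar>- 1 / s\<bar> powr (- real DIM('a) * enn2real (1 / r)))"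
  have [measurable]: "(\<lambda>(y, x). F y ((c / s) *\<^sub>R y + (- 1 / s) *\<^sub>R x)) \<in> borel_measurable (lborel \<Otimes>\<^sub>M lborel)"
    by measurable
  have inner: "eLp_norm r' (\<lambda>\<xi>. F (c *\<^sub>R x + s *\<^sub>R \<xi>) (c *\<^sub>R \<xi> - s *\<^sub>R x))
     \<le> k * eLp_norm r' (\<lambda>y. F y ((c / s) *\<^sub>R y + (- 1 / s) *\<^sub>R x))" for x
  proof -
    \<comment> \<open>With y = c x + s \<xi> the second argument equals (c y - x)/s, because c^2 - 1
      = -s^2.\<close>
    have "(c / s) *\<^sub>R (c *\<^sub>R x + s *\<^sub>R \<xi>) + (- 1 / s) *\<^sub>R x = c *\<^sub>R \<xi> - s *\<^sub>R x" for \<xi>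
    proof -
      have "(c / s) * c - 1 / s = - s" using cs by (simp add: field_simps power2_eq_square)
      then have "((c / s) * c) *\<^sub>R x - (1 / s) *\<^sub>R x = (- s) *\<^sub>R x" by (metis scaleR_left_diff_distrib)
      then show ?thesis using cs by (simp add: scaleR_right_distrib algebra_simps)
    qed
    then show ?thesis
      using eLp_norm_affine_le[of "\<lambda>y. F y ((c / s) *\<^sub>R y + (- 1 / s) *\<^sub>R x)" s r' "c *\<^sub>R x"] cs r'
      by (simp add: k_def)
  qed
  have "eLp_norm r (\<lambda>x. eLp_norm r' (\<lambda>\<xi>. F (c *\<^sub>R x + s *\<^sub>R \<xi>) (c *\<^sub>R \<xi> - s *\<^sub>R x)))
     \<le> eLp_norm r (\<lambda>x. k * eLp_norm r' (\<lambda>y. F y ((c / s) *\<^sub>R y + (- 1 / s) *\<^sub>R x)))"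
    by (intro eLp_norm_mono_AE AE_I2 inner borel_measurable_eLp_norm) measurable
  also have "\<dots> \<le> k * eLp_norm r (\<lambda>x. eLp_norm r' (\<lambda>y. F y ((c / s) *\<^sub>R y + (- 1 / s) *\<^sub>R x)))"
    by (intro eLp_norm_cmult_le r1 borel_measurable_eLp_norm) measurable
  also have "\<dots> \<le> k * eLp_norm r' (\<lambda>y. eLp_norm r (\<lambda>x. F y ((c / s) *\<^sub>R y + (- 1 / s) *\<^sub>R x)))"
    by (intro mult_left_mono eLp_norm_swap r') auto
  also have "\<dots> \<le> k * eLp_norm r' (\<lambda>y. l * eLp_norm r (F y))"
    using cs r1 unfolding l_def
    by (intro mult_left_mono eLp_norm_mono_AE AE_I2 eLp_norm_affine_le borel_measurable_eLp_norm) auto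
  also have "\<dots> \<le> k * (l * eLp_norm r' (\<lambda>y. eLp_norm r (F y)))"
    by (intro mult_left_mono eLp_norm_cmult_le r' borel_measurable_eLp_norm) auto
  also have "\<dots> = ennreal (\<bar>s\<bar> powr (- 2 * real DIM('a) * (1 / 2 - enn2real (1 / r)))) * eLp_norm r' (\<lambda>y. eLp_norm r (F y))"
  proof -
    have "\<bar>- 1 / s\<bar> powr (- real DIM('a) * enn2real (1 / r)) = \<bar>s\<bar> powr (real DIM('a) * enn2real (1 / r))"
      using cs by (simp add: powr_divide powr_minus)
    then have "k * l = ennreal (\<bar>s\<bar> powr (- 2 * real DIM('a) * (1 / 2 - enn2real (1 / r))))"
      unfolding k_def l_def e using cs by (simp add: ennreal_mult'[symmetric] powr_add[symmetric] algebra_simps)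
    then show ?thesis by (simp add: mult.assoc[symmetric])
  qed
  finally show ?thesis .
qed

subsection \<open>Calculus of Schwartz functions\<close>

lemma partial_derivs_append: "partial_derivs (as @ bs) f = partial_derivs as (partial_derivs bs f)"
  by (induction as) simp_all

lemma smoothD: "smooth f \<Longrightarrow> set bs \<subseteq> Basis \<Longrightarrow> partial_derivs bs f differentiable (at x)"
  by (auto simp: smooth_def)

lemma smooth_has_derivative:
  "smooth f \<Longrightarrow> set bs \<subseteq> Basis \<Longrightarrow>
    (partial_derivs bs f has_derivative frechet_derivative (partial_derivs bs f) (at x)) (at x)"
  using smoothD frechet_derivative_works by blast

lemma smooth_continuous: "smooth f \<Longrightarrow> set bs \<subseteq> Basis \<Longrightarrow> continuous_on A (partial_derivs bs f)"
  by (intro continuous_at_imp_continuous_on ballI differentiable_imp_continuous_within smoothD)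

lemma smooth_partial_derivs: "smooth f \<Longrightarrow> set bs \<subseteq> Basis \<Longrightarrow> smooth (partial_derivs bs f)"
  by (auto simp: smooth_def partial_derivs_append[symmetric])

lemma partial_derivs_Cons_eqI:
  assumes "\<And>x. (partial_derivs bs f has_derivative D x) (at x)"
  shows "partial_derivs (b # bs) f = (\<lambda>x. D x b)"
  using frechet_derivative_at[OF assms] by (auto simp: fun_eq_iff)

lemma has_derivative_sum_list:
  assumes "\<And>p. p \<in> set L \<Longrightarrow> (F p has_derivative F' p) (at x)"
  shows "((\<lambda>y. \<Sum>p\<leftarrow>L. F p y) has_derivative (\<lambda>h. \<Sum>p\<leftarrow>L. F' p h)) (at x)"
  using assms by (induction L) (auto intro!: has_derivative_add)

lemma partial_derivs_sum:
  assumes "finite I" "\<And>i. i \<in> I \<Longrightarrow> smooth (f i)" "set bs \<subseteq> Basis"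
  shows "partial_derivs bs (\<lambda>x. \<Sum>i\<in>I. c i * f i x) = (\<lambda>x. \<Sum>i\<in>I. c i * partial_derivs bs (f i) x)"
  using assms(3)
proof (induction bs)
  case (Cons b bs)
  have "partial_derivs (b # bs) (\<lambda>x. \<Sum>i\<in>I. c i * f i x)
    = (\<lambda>x. \<Sum>i\<in>I. c i * frechet_derivative (partial_derivs bs (f i)) (at x) b)"
    using Cons assms
    by (intro partial_derivs_Cons_eqI[where D="\<lambda>x h. \<Sum>i\<in>I. c i * frechet_derivative (partial_derivs bs (f i)) (at x) h"])
      (auto intro!: has_derivative_sum has_derivative_mult_right smooth_has_derivative)
  then show ?case by simp
qed simp

lemma smooth_sum:
  assumes "finite I" "\<And>i. i \<in> I \<Longrightarrow> smooth (f i)"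
  shows "smooth (\<lambda>x. \<Sum>i\<in>I. c i * f i x)"
  unfolding smooth_def
  using assms by (auto simp: partial_derivs_sum intro!: differentiable_sum differentiable_mult smoothD)

lemma lincomb_as_sum:
  fixes f h :: "'a \<Rightarrow> complex"
  shows "(\<lambda>x. a * f x + c * h x) = (\<lambda>x. \<Sum>i\<in>(UNIV :: bool set). (if i then a else c) * (if i then f else h) x)"
  by (auto simp: UNIV_bool)

lemma partial_derivs_lincomb:
  assumes "smooth f" "smooth h" "set bs \<subseteq> Basis"
  shows "partial_derivs bs (\<lambda>x. a * f x + c * h x) = (\<lambda>x. a * partial_derivs bs f x + c * partial_derivs bs h x)"
  unfolding lincomb_as_sum using assms by (subst partial_derivs_sum) (auto simp: UNIV_bool)

lemma smooth_lincomb: "smooth f \<Longrightarrow> smooth h \<Longrightarrow> smooth (\<lambda>x. a * f x + c * h x)"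
  unfolding lincomb_as_sum by (rule smooth_sum) auto

text \<open>All ways to distribute a list of derivatives over two factors, listed with repetitions.
  The Leibniz rule becomes a plain sum over this list, without binomial coefficients, and the number
  of terms is 2^n.\<close>

primrec splits :: "'b list \<Rightarrow> ('b list \<times> 'b list) list" where
  "splits [] = [([], [])]"
| "splits (b # bs) = map (\<lambda>(as, cs). (b # as, cs)) (splits bs) @ map (\<lambda>(as, cs). (as, b # cs)) (splits bs)"

lemma splits_subset:
  "(as, cs) \<in> set (splits bs) \<Longrightarrow> set as \<subseteq> set bs \<and> set cs \<subseteq> set bs \<and> length as + length cs = length bs"
proof (induction bs arbitrary: as cs)
  case (Cons b bs)
  then show ?case by (fastforce dest: Cons.IH)
qed simp

lemma length_splits: "length (splits bs) = 2 ^ length bs"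
  by (induction bs) simp_all

lemma partial_derivs_mult:
  assumes "smooth f" "smooth h" "set bs \<subseteq> Basis"
  shows "partial_derivs bs (\<lambda>x. f x * h x)
    = (\<lambda>x. \<Sum>(as, cs)\<leftarrow>splits bs. partial_derivs as f x * partial_derivs cs h x)"
  using assms(3)
proof (induction bs)
  case (Cons b bs)
  have sub: "set (fst p) \<subseteq> Basis" "set (snd p) \<subseteq> Basis" if "p \<in> set (splits bs)" for p
    using splits_subset[of "fst p" "snd p" bs] that Cons by auto
  have "partial_derivs (b # bs) (\<lambda>x. f x * h x)
    = (\<lambda>x. \<Sum>p\<leftarrow>splits bs. partial_derivs (fst p) f x * frechet_derivative (partial_derivs (snd p) h) (at x) b
        + frechet_derivative (partial_derivs (fst p) f) (at x) b * partial_derivs (snd p) h x)"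
  proof (rule partial_derivs_Cons_eqI[where D="\<lambda>x k. \<Sum>p\<leftarrow>splits bs. partial_derivs (fst p) f x * frechet_derivative (partial_derivs (snd p) h) (at x) k
        + frechet_derivative (partial_derivs (fst p) f) (at x) k * partial_derivs (snd p) h x"])
    have "set bs \<subseteq> Basis" using Cons.prems by simp
    note IH = Cons.IH[OF this]
    show "(partial_derivs bs (\<lambda>x. f x * h x) has_derivative
      (\<lambda>k. \<Sum>p\<leftarrow>splits bs. partial_derivs (fst p) f x * frechet_derivative (partial_derivs (snd p) h) (at x) k
        + frechet_derivative (partial_derivs (fst p) f) (at x) k * partial_derivs (snd p) h x)) (at x)" for x
      unfolding IH case_prod_beta
      by (intro has_derivative_sum_list has_derivative_mult smooth_has_derivative assms sub)
  qed
  then show ?case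
    by (simp add: fun_eq_iff comp_def split_def sum_list_addf add.commute)
qed simp

lemma differentiable_sum_list:
  "(\<And>p. p \<in> set L \<Longrightarrow> F p differentiable (at x)) \<Longrightarrow> (\<lambda>y. \<Sum>p\<leftarrow>L. F p y) differentiable (at x)"
  by (induction L) auto

lemma smooth_mult:
  assumes "smooth f" "smooth h"
  shows "smooth (\<lambda>x. f x * h x)"
  unfolding smooth_def
proof (intro allI impI)
  fix bs :: "'a list" and x assume bs: "set bs \<subseteq> Basis"
  show "partial_derivs bs (\<lambda>x. f x * h x) differentiable at x"
    unfolding partial_derivs_mult[OF assms bs] case_prod_beta
  proof (intro differentiable_sum_list differentiable_mult smoothD assms)
    fix p assume "p \<in> set (splits bs)"
    then have "set (fst p) \<subseteq> set bs \<and> set (snd p) \<subseteq> set bs"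
      using splits_subset[of "fst p" "snd p" bs] by simp
    then show "set (fst p) \<subseteq> Basis" "set (snd p) \<subseteq> Basis" using bs by auto
  qed
qed

lemma partial_derivs_translate:
  assumes "smooth f" "set bs \<subseteq> Basis"
  shows "partial_derivs bs (\<lambda>y. f (y - a)) = (\<lambda>y. partial_derivs bs f (y - a))"
  using assms(2)
proof (induction bs)
  case (Cons b bs)
  have "((\<lambda>y. partial_derivs bs f (y - a)) has_derivative frechet_derivative (partial_derivs bs f) (at (x - a))) (at x)" for x
  proof -
    have "((\<lambda>y. y - a) has_derivative (\<lambda>h. h)) (at x)" by (auto intro!: derivative_eq_intros)
    from has_derivative_compose[OF this smooth_has_derivative[OF assms(1), of bs "x - a"]] Cons show ?thesis by simp
  qed
  then have "partial_derivs (b # bs) (\<lambda>y. f (y - a)) = (\<lambda>y. frechet_derivative (partial_derivs bs f) (at (y - a)) b)"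
    using Cons by (intro partial_derivs_Cons_eqI) auto
  then show ?case by simp
qed simp

lemma smooth_translate: "smooth f \<Longrightarrow> smooth (\<lambda>y. f (y - a))"
  unfolding smooth_def
proof (intro allI impI)
  fix bs :: "'a list" and x assume *: "\<forall>bs. set bs \<subseteq> Basis \<longrightarrow> (\<forall>x. partial_derivs bs f differentiable at x)" "set bs \<subseteq> Basis"
  then have "partial_derivs bs f differentiable (at (x - a))" by auto
  then have "(\<lambda>y. partial_derivs bs f (y - a)) differentiable at x"
    by (intro differentiable_compose[of "partial_derivs bs f" "\<lambda>y. y - a"]) auto
  then show "partial_derivs bs (\<lambda>y. f (y - a)) differentiable at x"
    using * by (subst partial_derivs_translate) (auto simp: smooth_def)
qed

lemma partial_derivs_cnj:
  assumes "smooth f" "set bs \<subseteq> Basis"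
  shows "partial_derivs bs (\<lambda>y. cnj (f y)) = (\<lambda>y. cnj (partial_derivs bs f y))"
  using assms(2)
proof (induction bs)
  case (Cons b bs)
  have "partial_derivs (b # bs) (\<lambda>y. cnj (f y)) = (\<lambda>y. cnj (frechet_derivative (partial_derivs bs f) (at y) b))"
    using Cons assms by (intro partial_derivs_Cons_eqI) (auto intro!: has_derivative_cnj smooth_has_derivative)
  then show ?case by simp
qed simp

lemma smooth_cnj: "smooth f \<Longrightarrow> smooth (\<lambda>y. cnj (f y))"
  unfolding smooth_def[of "\<lambda>y. cnj (f y)"]
  by (auto simp: partial_derivs_cnj differentiable_def intro!: exI has_derivative_cnj smooth_has_derivative)

section \<open>Modulations and wave packets\<close>

definition modulation :: "'a::euclidean_space \<Rightarrow> 'a \<Rightarrow> complex" where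
  "modulation \<xi> y = cis (- 2 * pi * (y \<bullet> \<xi>))"

lemma norm_modulation [simp]: "norm (modulation \<xi> y) = 1"
  by (simp add: modulation_def)

lemma has_derivative_modulation:
  "(modulation \<xi> has_derivative (\<lambda>h. \<i> * of_real (- 2 * pi * (h \<bullet> \<xi>)) * modulation \<xi> y)) (at y)"
proof -
  have "((\<lambda>y. \<i> * complex_of_real (- 2 * pi * (y \<bullet> \<xi>))) has_derivative
     (\<lambda>h. \<i> * complex_of_real (- 2 * pi * (h \<bullet> \<xi>)))) (at y)"
    by (intro has_derivative_mult_right has_derivative_of_real has_derivative_inner_left has_derivative_ident)
  from has_derivative_compose[OF this DERIV_exp[unfolded has_field_derivative_def]] show ?thesis
    unfolding modulation_def[abs_def] cis_conv_exp by (simp add: mult_ac)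
qed

lemma partial_derivs_modulation:
  "partial_derivs bs (modulation \<xi>) = (\<lambda>y. (\<Prod>b\<leftarrow>bs. \<i> * of_real (- 2 * pi * (b \<bullet> \<xi>))) * modulation \<xi> y)"
proof (induction bs)
  case (Cons b bs)
  have "partial_derivs (b # bs) (modulation \<xi>)
    = (\<lambda>y. (\<Prod>b\<leftarrow>bs. \<i> * of_real (- 2 * pi * (b \<bullet> \<xi>))) * (\<i> * of_real (- 2 * pi * (b \<bullet> \<xi>)) * modulation \<xi> y))"
    by (rule partial_derivs_Cons_eqI) (unfold Cons.IH, intro has_derivative_mult_right has_derivative_modulation)
  then show ?case by (simp add: mult_ac)
qed simp

lemma smooth_modulation: "smooth (modulation \<xi>)"
  by (auto simp: smooth_def partial_derivs_modulation differentiable_def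
      intro!: exI has_derivative_mult_right has_derivative_modulation)

text \<open>The modulation has the sign of the Fourier kernel, so that a distribution applied to the
  packet is the Fourier transform at \<xi> of the distribution localised by the window at x.\<close>

definition wave_packet :: "('a::euclidean_space \<Rightarrow> complex) \<Rightarrow> 'a \<Rightarrow> 'a \<Rightarrow> 'a \<Rightarrow> complex" where
  "wave_packet f x \<xi> y = f (y - x) * modulation \<xi> y"

lemma smooth_wave_packet: "smooth f \<Longrightarrow> smooth (wave_packet f x \<xi>)"
  unfolding wave_packet_def[abs_def] by (intro smooth_mult smooth_translate smooth_modulation)

lemma partial_derivs_wave_packet:
  assumes "smooth f" "set bs \<subseteq> Basis"
  shows "partial_derivs bs (wave_packet f x \<xi>)
    = (\<lambda>y. \<Sum>(as, cs)\<leftarrow>splits bs. partial_derivs as f (y - x) *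
        ((\<Prod>b\<leftarrow>cs. \<i> * of_real (- 2 * pi * (b \<bullet> \<xi>))) * modulation \<xi> y))"
proof -
  have "partial_derivs (fst p) (\<lambda>y. f (y - x)) = (\<lambda>y. partial_derivs (fst p) f (y - x))"
    if "p \<in> set (splits bs)" for p
    using splits_subset[of "fst p" "snd p" bs] that assms by (intro partial_derivs_translate) auto
  note * = fun_cong[OF this]
  show ?thesis
    unfolding wave_packet_def[abs_def]
      partial_derivs_mult[OF smooth_translate[OF assms(1)] smooth_modulation assms(2)]
      partial_derivs_modulation split_def
    by (intro ext arg_cong[where f=sum_list] map_cong refl) (simp only: *)
qed

subsection \<open>Schwartz seminorms\<close>

text \<open>An explicit number in place of the suprema in \<open>schwartz_norm\<close>. The two
  agree up to the number of multi-indices, and a numerical bound passes through sums, products and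
  integrals without any discussion of suprema.\<close>

definition seminorm_bound :: "nat \<Rightarrow> ('a::euclidean_space \<Rightarrow> complex) \<Rightarrow> real \<Rightarrow> bool" where
  "seminorm_bound N f B \<longleftrightarrow> (\<forall>bs x. set bs \<subseteq> Basis \<longrightarrow> length bs \<le> N \<longrightarrow>
     (1 + norm x) ^ N * norm (partial_derivs bs f x) \<le> B)"

lemma seminorm_boundD:
  "seminorm_bound N f B \<Longrightarrow> set bs \<subseteq> Basis \<Longrightarrow> length bs \<le> N \<Longrightarrow> (1 + norm x) ^ N * norm (partial_derivs bs f x) \<le> B"
  by (auto simp: seminorm_bound_def)

lemma seminorm_bound_nonneg: "seminorm_bound N f B \<Longrightarrow> 0 \<le> B"
  using seminorm_boundD[of N f B "[]" 0] order_trans[OF norm_ge_zero[of "f 0"]] by simp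

lemma seminorm_bound_mono:
  assumes "seminorm_bound N f B" "M \<le> N" "B \<le> C"
  shows "seminorm_bound M f C"
  unfolding seminorm_bound_def
proof (intro allI impI)
  fix bs :: "'a list" and x assume bs: "set bs \<subseteq> Basis" "length bs \<le> M"
  have "(1 + norm x) ^ M * norm (partial_derivs bs f x) \<le> (1 + norm x) ^ N * norm (partial_derivs bs f x)"
    using assms by (intro mult_right_mono power_increasing) auto
  also have "\<dots> \<le> B" using bs assms by (intro seminorm_boundD) auto
  finally show "(1 + norm x) ^ M * norm (partial_derivs bs f x) \<le> C" using assms by simp
qed

lemma seminorm_bound_le:
  assumes "seminorm_bound N f B" "set bs \<subseteq> Basis" "length bs \<le> N"
  shows "norm (partial_derivs bs f x) \<le> B / (1 + norm x) ^ N"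
proof -
  have "0 < (1 + norm x) ^ N" by (intro zero_less_power) (simp add: add_pos_nonneg)
  then show ?thesis using seminorm_boundD[OF assms, of x] by (simp add: field_simps)
qed

lemma seminorm_bound_le_const:
  assumes "seminorm_bound N f B" "set bs \<subseteq> Basis" "length bs \<le> N"
  shows "norm (partial_derivs bs f x) \<le> B"
proof -
  have "1 * norm (partial_derivs bs f x) \<le> (1 + norm x) ^ N * norm (partial_derivs bs f x)"
    by (intro mult_right_mono one_le_power) auto
  then show ?thesis using seminorm_boundD[OF assms, of x] by simp
qed

lemma finite_multiindices: "finite {bs. set bs \<subseteq> (Basis :: 'a::euclidean_space set) \<and> length bs \<le> N}"
  by (rule finite_lists_length_le) simp

lemma schwartz_bdd_above:
  assumes "f \<in> schwartz" "set bs \<subseteq> Basis"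
  shows "bdd_above (range (\<lambda>x. (1 + norm x) ^ k * norm (partial_derivs bs f x)))"
  using assms by (auto simp: schwartz_def intro!: bounded_imp_bdd_above)

lemma seminorm_bound_schwartz_norm:
  assumes "f \<in> schwartz"
  shows "seminorm_bound N f (schwartz_norm N f)"
  unfolding seminorm_bound_def
proof (intro allI impI)
  fix bs :: "'a list" and x assume bs: "set bs \<subseteq> Basis" "length bs \<le> N"
  let ?S = "\<lambda>bs. SUP x. (1 + norm x) ^ N * norm (partial_derivs bs f x)"
  have "(1 + norm x) ^ N * norm (partial_derivs bs f x) \<le> ?S bs"
    using schwartz_bdd_above[OF assms bs(1)] by (intro cSUP_upper) auto
  also have "\<dots> \<le> schwartz_norm N f"
    unfolding schwartz_norm_def
  proof (rule member_le_sum[where f="?S"])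
    fix cs assume "cs \<in> {bs. set bs \<subseteq> Basis \<and> length bs \<le> N} - {bs}"
    then have "(1 + norm x) ^ N * norm (partial_derivs cs f x) \<le> ?S cs"
      using schwartz_bdd_above[OF assms] by (intro cSUP_upper) auto
    moreover have "0 \<le> (1 + norm x) ^ N * norm (partial_derivs cs f x)"
      by auto
    ultimately show "0 \<le> ?S cs" by linarith
  qed (use bs finite_multiindices in auto)
  finally show "(1 + norm x) ^ N * norm (partial_derivs bs f x) \<le> schwartz_norm N f" .
qed

lemma schwartz_norm_le:
  fixes f :: "'a::euclidean_space \<Rightarrow> complex" and B :: real
  assumes "seminorm_bound N f B"
  shows "schwartz_norm N f \<le> real (card {bs. set bs \<subseteq> (Basis :: 'a set) \<and> length bs \<le> N}) * B"
  unfolding schwartz_norm_def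
  using assms by (intro sum_bounded_above cSUP_least) (auto intro: seminorm_boundD)

lemma schwartz_smooth: "f \<in> schwartz \<Longrightarrow> smooth f"
  by (simp add: schwartz_def)

lemma schwartzI:
  assumes "smooth f" "\<And>N. \<exists>B. seminorm_bound N f B"
  shows "f \<in> schwartz"
  unfolding schwartz_def
proof (intro CollectI conjI assms allI impI)
  fix bs :: "'a list" and k assume bs: "set bs \<subseteq> Basis"
  obtain B where "seminorm_bound (max k (length bs)) f B" using assms by blast
  then have B: "(1 + norm x) ^ max k (length bs) * norm (partial_derivs bs f x) \<le> B" for x
    using bs by (intro seminorm_boundD) auto
  have "(1 + norm x) ^ k * norm (partial_derivs bs f x) \<le> B" for x
    by (rule order_trans[OF mult_right_mono B]) (auto intro: power_increasing)
  then show "bounded (range (\<lambda>x. (1 + norm x) ^ k * norm (partial_derivs bs f x)))"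
    by (intro boundedI[where B=B]) (auto simp: abs_mult)
qed

lemma tempered_bound:
  assumes "tempered T"
  obtains C N where "0 \<le> C" "\<And>\<phi> B. \<phi> \<in> schwartz \<Longrightarrow> seminorm_bound N \<phi> B \<Longrightarrow> norm (T \<phi>) \<le> C * B"
proof -
  from assms obtain C N where *: "\<And>\<phi>. \<phi> \<in> schwartz \<Longrightarrow> norm (T \<phi>) \<le> C * schwartz_norm N \<phi>"
    unfolding tempered_def by blast
  let ?K = "real (card {bs. set bs \<subseteq> (Basis :: 'a set) \<and> length bs \<le> N})"
  show thesis
  proof (rule that[of "\<bar>C\<bar> * ?K" N])
    fix \<phi> :: "'a \<Rightarrow> complex" and B assume \<phi>: "\<phi> \<in> schwartz" "seminorm_bound N \<phi> B"
    have "0 \<le> schwartz_norm N \<phi>"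
      using seminorm_bound_nonneg seminorm_bound_schwartz_norm \<phi> by blast
    then have "C * schwartz_norm N \<phi> \<le> \<bar>C\<bar> * schwartz_norm N \<phi>" by (intro mult_right_mono) auto
    also have "\<dots> \<le> \<bar>C\<bar> * (?K * B)" by (intro mult_left_mono schwartz_norm_le \<phi>) auto
    finally show "norm (T \<phi>) \<le> \<bar>C\<bar> * ?K * B" using *[OF \<phi>(1)] by (simp add: mult.assoc)
  qed simp
qed

lemma seminorm_bound_cmult:
  assumes "seminorm_bound N f B" "smooth f" "norm c * B \<le> D"
  shows "seminorm_bound N (\<lambda>x. c * f x) D"
  unfolding seminorm_bound_def
proof (intro allI impI)
  fix bs :: "'a list" and x assume bs: "set bs \<subseteq> Basis" "length bs \<le> N"
  have "partial_derivs bs (\<lambda>x. c * f x) = (\<lambda>x. c * partial_derivs bs f x)"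
    using partial_derivs_lincomb[OF assms(2,2) bs(1), of c 0] by simp
  moreover have "norm c * ((1 + norm x) ^ N * norm (partial_derivs bs f x)) \<le> norm c * B"
    by (intro mult_left_mono seminorm_boundD[OF assms(1) bs]) auto
  ultimately show "(1 + norm x) ^ N * norm (partial_derivs bs (\<lambda>x. c * f x) x) \<le> D"
    using assms(3) by (simp add: norm_mult mult_ac)
qed

lemma seminorm_bound_add:
  assumes "seminorm_bound N f B" "seminorm_bound N h C" "smooth f" "smooth h"
  shows "seminorm_bound N (\<lambda>x. f x + h x) (B + C)"
  unfolding seminorm_bound_def
proof (intro allI impI)
  fix bs :: "'a list" and x assume bs: "set bs \<subseteq> Basis" "length bs \<le> N"
  have "partial_derivs bs (\<lambda>x. f x + h x) = (\<lambda>x. partial_derivs bs f x + partial_derivs bs h x)"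
    using partial_derivs_lincomb[OF assms(3,4) bs(1), of 1 1] by simp
  then have "(1 + norm x) ^ N * norm (partial_derivs bs (\<lambda>x. f x + h x) x)
    \<le> (1 + norm x) ^ N * (norm (partial_derivs bs f x) + norm (partial_derivs bs h x))"
    by (intro mult_left_mono) (auto intro: norm_triangle_ineq)
  then show "(1 + norm x) ^ N * norm (partial_derivs bs (\<lambda>x. f x + h x) x) \<le> B + C"
    using seminorm_boundD[OF assms(1) bs, of x] seminorm_boundD[OF assms(2) bs, of x]
    by (simp add: distrib_left)
qed

lemma schwartz_bound_ex: "f \<in> schwartz \<Longrightarrow> \<exists>B. seminorm_bound N f B"
  using seminorm_bound_schwartz_norm by blast

lemma schwartz_cmult: "f \<in> schwartz \<Longrightarrow> (\<lambda>x. c * f x) \<in> schwartz"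
proof (rule schwartzI)
  assume f: "f \<in> schwartz"
  then show "smooth (\<lambda>x. c * f x)" using smooth_lincomb[of f f c 0] by (simp add: schwartz_smooth)
  show "\<exists>B. seminorm_bound N (\<lambda>x. c * f x) B" for N
    using schwartz_bound_ex[OF f, of N] seminorm_bound_cmult schwartz_smooth[OF f] by blast
qed

lemma schwartz_add: "f \<in> schwartz \<Longrightarrow> h \<in> schwartz \<Longrightarrow> (\<lambda>x. f x + h x) \<in> schwartz"
proof (rule schwartzI)
  assume f: "f \<in> schwartz" "h \<in> schwartz"
  then show "smooth (\<lambda>x. f x + h x)" using smooth_lincomb[of f h 1 1] by (simp add: schwartz_smooth)
  show "\<exists>B. seminorm_bound N (\<lambda>x. f x + h x) B" for N
    using schwartz_bound_ex[OF f(1), of N] schwartz_bound_ex[OF f(2), of N] seminorm_bound_add schwartz_smooth f by blast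
qed

lemma schwartz_diff: "f \<in> schwartz \<Longrightarrow> h \<in> schwartz \<Longrightarrow> (\<lambda>x. f x - h x) \<in> schwartz"
  using schwartz_add[of f "\<lambda>x. (-1) * h x"] schwartz_cmult[of h "-1"] by simp

lemma schwartz_zero: "(\<lambda>x. 0) \<in> schwartz"
proof -
  have "partial_derivs bs (\<lambda>x. 0) = (\<lambda>x :: 'a. 0)" for bs
    by (induction bs) auto
  then show ?thesis by (auto simp: schwartz_def smooth_def)
qed

lemma schwartz_sum: "finite I \<Longrightarrow> (\<And>i. i \<in> I \<Longrightarrow> f i \<in> schwartz) \<Longrightarrow> (\<lambda>x. \<Sum>i\<in>I. c i * f i x) \<in> schwartz"
  by (induction I rule: finite_induct) (auto intro!: schwartz_zero schwartz_add schwartz_cmult)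

lemma schwartz_cnj: "f \<in> schwartz \<Longrightarrow> (\<lambda>x. cnj (f x)) \<in> schwartz"
  unfolding schwartz_def by (auto simp: smooth_cnj partial_derivs_cnj)

lemma seminorm_bound_cnj: "smooth f \<Longrightarrow> seminorm_bound N f B \<Longrightarrow> seminorm_bound N (\<lambda>x. cnj (f x)) B"
  unfolding seminorm_bound_def by (auto simp: partial_derivs_cnj)

lemma tempered_lincomb:
  assumes "tempered T" "\<phi> \<in> schwartz" "\<psi> \<in> schwartz"
  shows "T (\<lambda>x. a * \<phi> x + b * \<psi> x) = a * T \<phi> + b * T \<psi>"
  using conjunct1[OF assms(1)[unfolded tempered_def]] assms(2,3) by (simp only:)

lemma tempered_sum:
  assumes T: "tempered T" and "finite I" "\<And>i. i \<in> I \<Longrightarrow> f i \<in> schwartz"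
  shows "T (\<lambda>x. \<Sum>i\<in>I. c i * f i x) = (\<Sum>i\<in>I. c i * T (f i))"
  using assms(2,3)
proof (induction I rule: finite_induct)
  case empty
  show ?case using tempered_lincomb[OF T schwartz_zero schwartz_zero, of 0 0] by simp
next
  case (insert i I)
  have "T (\<lambda>x. c i * f i x + 1 * (\<Sum>i\<in>I. c i * f i x)) = c i * T (f i) + 1 * T (\<lambda>x. \<Sum>i\<in>I. c i * f i x)"
    using insert by (intro tempered_lincomb T schwartz_sum) auto
  then show ?case using insert by simp
qed

lemma tempered_cmult: "tempered T \<Longrightarrow> f \<in> schwartz \<Longrightarrow> T (\<lambda>x. c * f x) = c * T f"
  using tempered_sum[of T "{()}" "\<lambda>_. f" "\<lambda>_. c"] by simp

lemma tempered_diff: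
  assumes "tempered T" "f \<in> schwartz" "h \<in> schwartz"
  shows "T (\<lambda>x. f x - h x) = T f - T h"
  using tempered_lincomb[OF assms, of 1 "-1"] by simp

text \<open>Peetre's inequality: a polynomial weight moves from y to y - x at the price of a weight
  in x.\<close>

lemma one_plus_norm_le: "1 + norm (y :: 'a::real_normed_vector) \<le> (1 + norm (y - x)) * (1 + norm x)"
proof -
  have "norm y \<le> norm (y - x) + norm x" using norm_triangle_ineq[of "y - x" x] by simp
  moreover have "0 \<le> norm (y - x) * norm x" by simp
  ultimately have "1 + norm y \<le> 1 + norm (y - x) + norm x + norm (y - x) * norm x" by linarith
  then show ?thesis by (simp add: algebra_simps)
qed

lemma norm_modulation_factor_le:
  fixes \<xi> :: "'a::euclidean_space"
  assumes "set cs \<subseteq> Basis" "length cs \<le> N"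
  shows "norm (\<Prod>b\<leftarrow>cs. \<i> * complex_of_real (- 2 * pi * (b \<bullet> \<xi>))) \<le> (2 * pi * (1 + norm \<xi>)) ^ N"
proof -
  have "norm (\<Prod>b\<leftarrow>cs. \<i> * complex_of_real (- 2 * pi * (b \<bullet> \<xi>))) \<le> (2 * pi * (1 + norm \<xi>)) ^ length cs"
    using assms(1)
  proof (induction cs)
    case (Cons b cs)
    have "\<bar>b \<bullet> \<xi>\<bar> \<le> norm \<xi>" using Cons Basis_le_norm[of b \<xi>] by (simp add: inner_commute)
    then have "norm (\<i> * complex_of_real (- 2 * pi * (b \<bullet> \<xi>))) \<le> 2 * pi * (1 + norm \<xi>)"
      by (simp add: norm_mult abs_mult)
    then show ?case using Cons by (simp add: norm_mult mult_mono)
  qed simp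
  also have "\<dots> \<le> (2 * pi * (1 + norm \<xi>)) ^ N"
  proof (rule power_increasing[OF assms(2)])
    have "1 * 1 \<le> 2 * pi * (1 + norm \<xi>)" using pi_gt3 by (intro mult_mono) auto
    then show "1 \<le> 2 * pi * (1 + norm \<xi>)" by simp
  qed
  finally show ?thesis .
qed

lemma norm_sum_list_le:
  fixes K :: real
  shows "(\<And>p. p \<in> set L \<Longrightarrow> norm (F p) \<le> K) \<Longrightarrow> norm (\<Sum>p\<leftarrow>L. F p) \<le> real (length L) * K"
proof (induction L)
  case (Cons a L)
  then have "norm (F a) \<le> K" "norm (\<Sum>p\<leftarrow>L. F p) \<le> real (length L) * K" by auto
  then show ?case using norm_triangle_ineq[of "F a" "\<Sum>p\<leftarrow>L. F p"] by (simp add: algebra_simps)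
qed simp

text \<open>Seminorms of packets grow only polynomially in the phase space point, so rapidly
  decaying coefficients can absorb them. The constant collects the 2^N Leibniz terms and a factor 2
  \<pi> for each derivative of the modulation.\<close>

lemma seminorm_bound_wave_packet:
  assumes "smooth f" "seminorm_bound N f B"
  shows "seminorm_bound N (wave_packet f x \<xi>) ((4 * pi) ^ N * ((1 + norm x) * (1 + norm \<xi>)) ^ N * B)"
  unfolding seminorm_bound_def
proof (intro allI impI)
  fix bs :: "'a list" and y assume bs: "set bs \<subseteq> Basis" "length bs \<le> N"
  define K where "K = (2 * pi * (1 + norm \<xi>)) ^ N * (1 + norm x) ^ N * B"
  have B: "0 \<le> B" using assms seminorm_bound_nonneg by blast
  have "norm ((1 + norm y) ^ N *\<^sub>R (partial_derivs as f (y - x) *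
        ((\<Prod>b\<leftarrow>cs. \<i> * of_real (- 2 * pi * (b \<bullet> \<xi>))) * modulation \<xi> y))) \<le> K"
    if "(as, cs) \<in> set (splits bs)" for as cs
  proof -
    have s: "set as \<subseteq> Basis" "set cs \<subseteq> Basis" "length as \<le> N" "length cs \<le> N"
      using splits_subset[OF that] bs by auto
    have "(1 + norm y) ^ N * norm (partial_derivs as f (y - x))
      \<le> ((1 + norm (y - x)) * (1 + norm x)) ^ N * norm (partial_derivs as f (y - x))"
      by (intro mult_right_mono power_mono one_plus_norm_le) auto
    also have "\<dots> = (1 + norm x) ^ N * ((1 + norm (y - x)) ^ N * norm (partial_derivs as f (y - x)))"
      by (simp add: power_mult_distrib mult_ac)
    also have "\<dots> \<le> (1 + norm x) ^ N * B"
      by (intro mult_left_mono seminorm_boundD[OF assms(2)] s) auto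
    finally have 1: "(1 + norm y) ^ N * norm (partial_derivs as f (y - x)) \<le> (1 + norm x) ^ N * B" .
    have "norm ((1 + norm y) ^ N *\<^sub>R (partial_derivs as f (y - x) *
        ((\<Prod>b\<leftarrow>cs. \<i> * of_real (- 2 * pi * (b \<bullet> \<xi>))) * modulation \<xi> y)))
      = ((1 + norm y) ^ N * norm (partial_derivs as f (y - x))) * norm (\<Prod>b\<leftarrow>cs. \<i> * complex_of_real (- 2 * pi * (b \<bullet> \<xi>)))"
      by (simp add: norm_mult abs_mult)
    also have "\<dots> \<le> ((1 + norm x) ^ N * B) * (2 * pi * (1 + norm \<xi>)) ^ N"
      using B by (intro mult_mono 1 norm_modulation_factor_le s) auto
    finally show ?thesis by (simp add: K_def mult_ac)
  qed
  then have "norm (\<Sum>p\<leftarrow>splits bs. (1 + norm y) ^ N *\<^sub>R (partial_derivs (fst p) f (y - x) *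
        ((\<Prod>b\<leftarrow>snd p. \<i> * of_real (- 2 * pi * (b \<bullet> \<xi>))) * modulation \<xi> y))) \<le> length (splits bs) * K"
    by (intro norm_sum_list_le) auto
  moreover have "(\<Sum>p\<leftarrow>splits bs. (1 + norm y) ^ N *\<^sub>R (partial_derivs (fst p) f (y - x) *
        ((\<Prod>b\<leftarrow>snd p. \<i> * of_real (- 2 * pi * (b \<bullet> \<xi>))) * modulation \<xi> y)))
      = (1 + norm y) ^ N *\<^sub>R partial_derivs bs (wave_packet f x \<xi>) y"
    unfolding partial_derivs_wave_packet[OF assms(1) bs(1)] scaleR_conv_of_real
    by (simp only: sum_list_const_mult split_def)
  ultimately have "(1 + norm y) ^ N * norm (partial_derivs bs (wave_packet f x \<xi>) y) \<le> 2 ^ length bs * K"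
    by (simp add: length_splits)
  also have "\<dots> \<le> 2 ^ N * K"
    using B bs by (intro mult_right_mono power_increasing) (auto simp: K_def)
  also have "\<dots> = (4 * pi) ^ N * ((1 + norm x) * (1 + norm \<xi>)) ^ N * B"
  proof -
    have "4 * pi = 2 * (2 * pi)" by simp
    then show ?thesis unfolding K_def by (simp only: power_mult_distrib mult_ac)
  qed
  finally show "(1 + norm y) ^ N * norm (partial_derivs bs (wave_packet f x \<xi>) y)
    \<le> (4 * pi) ^ N * ((1 + norm x) * (1 + norm \<xi>)) ^ N * B" .
qed

lemma schwartz_wave_packet: "f \<in> schwartz \<Longrightarrow> wave_packet f x \<xi> \<in> schwartz"
proof (rule schwartzI)
  assume f: "f \<in> schwartz"
  then show "smooth (wave_packet f x \<xi>)" by (intro smooth_wave_packet schwartz_smooth)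
  show "\<exists>B. seminorm_bound N (wave_packet f x \<xi>) B" for N
    using seminorm_bound_wave_packet[OF schwartz_smooth[OF f] seminorm_bound_schwartz_norm[OF f]] by blast
qed

lemma continuous_on_modulation [continuous_intros]:
  "continuous_on A f \<Longrightarrow> continuous_on A g \<Longrightarrow> continuous_on A (\<lambda>z. modulation (f z) (g z))"
  unfolding modulation_def by (intro continuous_intros)

lemma continuous_on_sum_list:
  fixes F :: "'i \<Rightarrow> 'b::topological_space \<Rightarrow> complex"
  shows "(\<And>p. p \<in> set L \<Longrightarrow> continuous_on A (F p)) \<Longrightarrow> continuous_on A (\<lambda>y. \<Sum>p\<leftarrow>L. F p y)"
  by (induction L) (auto intro!: continuous_intros)

lemma continuous_on_prod_list:
  fixes F :: "'i \<Rightarrow> 'b::topological_space \<Rightarrow> complex"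
  shows "(\<And>p. p \<in> set L \<Longrightarrow> continuous_on A (F p)) \<Longrightarrow> continuous_on A (\<lambda>y. \<Prod>p\<leftarrow>L. F p y)"
  by (induction L) (auto intro!: continuous_intros)

lemma continuous_on_partial_derivs_wave_packet:
  fixes \<alpha> \<beta> \<gamma> :: "'b::topological_space \<Rightarrow> 'a::euclidean_space"
  assumes "smooth f" "set bs \<subseteq> Basis" "continuous_on A \<alpha>" "continuous_on A \<beta>" "continuous_on A \<gamma>"
  shows "continuous_on A (\<lambda>z. partial_derivs bs (wave_packet f (\<alpha> z) (\<beta> z)) (\<gamma> z))"
proof -
  have *: "continuous_on A (\<lambda>z. partial_derivs as f (\<gamma> z - \<alpha> z))" if "(as, cs) \<in> set (splits bs)" for as cs
  proof -
    have "set as \<subseteq> Basis" using splits_subset[OF that] assms by auto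
    then show ?thesis
      by (intro continuous_on_compose2[OF smooth_continuous[OF assms(1), of as UNIV]] continuous_intros assms) auto
  qed
  show ?thesis
    unfolding partial_derivs_wave_packet[OF assms(1,2)] split_def
    by (intro continuous_on_sum_list continuous_on_mult continuous_on_prod_list continuous_on_modulation
        continuous_on_of_real continuous_on_inner continuous_on_const assms *[of "fst p" "snd p" for p]) auto
qed

lemma partial_derivs_eq_0:
  assumes "open S" "\<And>y. y \<in> S \<Longrightarrow> f y = 0" "y \<in> S"
  shows "partial_derivs bs f y = 0"
  using assms(3)
proof (induction bs arbitrary: y)
  case (Cons b bs)
  have "(partial_derivs bs f has_derivative (\<lambda>h. 0)) (at y)"
    using Cons by (intro has_derivative_transform_within_open[OF has_derivative_const[of 0] assms(1)]) auto
  from frechet_derivative_at[OF this] show ?case by (simp add: fun_eq_iff)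
qed (use assms in simp)

lemma test_function_schwartz:
  assumes "test_function f"
  shows "f \<in> schwartz"
  unfolding schwartz_def
proof (intro CollectI conjI allI impI)
  define K where "K = closure {x. f x \<noteq> 0}"
  have f: "smooth f" and K: "compact K" using assms by (auto simp: test_function_def K_def)
  then show "smooth f" by simp
  fix bs :: "'a list" and k :: nat assume bs: "set bs \<subseteq> Basis"
  let ?F = "\<lambda>x. (1 + norm x) ^ k * norm (partial_derivs bs f x)"
  have 0: "?F x = 0" if xK: "x \<notin> K" for x
  proof -
    have xK': "x \<in> - K" using xK by simp
    have z: "f y = 0" if "y \<in> - K" for y
    proof (rule ccontr)
      assume "f y \<noteq> 0"
      then have "y \<in> K" unfolding K_def by (intro subsetD[OF closure_subset] CollectI)
      with that show False by simp
    qed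
    have "open (- K)" using K by (intro open_Compl compact_imp_closed)
    from partial_derivs_eq_0[OF this z xK'] show ?thesis by simp
  qed
  have "continuous_on K ?F"
    by (intro continuous_intros smooth_continuous f bs)
  then have "bounded (?F ` K)" using K compact_continuous_image compact_imp_bounded by blast
  then have "bounded (insert 0 (?F ` K))" by simp
  moreover have "range ?F \<subseteq> insert 0 (?F ` K)" using 0 by blast
  ultimately show "bounded (range ?F)" by (rule bounded_subset)
qed

section \<open>Gaussians are Schwartz functions\<close>

lemma real_polynomial_function_has_derivative:
  assumes "real_polynomial_function p"
  shows "\<exists>p'. (\<forall>h. real_polynomial_function (\<lambda>y. p' y h)) \<and> (\<forall>y. (p has_derivative p' y) (at y))"
  using assms
proof (induction p)
  case (linear f)
  then show ?case by (intro exI[of _ "\<lambda>y. f"]) (auto intro: bounded_linear_imp_has_derivative)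
next
  case (const c)
  then show ?case by (intro exI[of _ "\<lambda>y h. 0"]) auto
next
  case (add f g)
  then obtain f' g' where "\<forall>h. real_polynomial_function (\<lambda>y. f' y h)" "\<forall>y. (f has_derivative f' y) (at y)"
    "\<forall>h. real_polynomial_function (\<lambda>y. g' y h)" "\<forall>y. (g has_derivative g' y) (at y)" by blast
  then show ?case by (intro exI[of _ "\<lambda>y h. f' y h + g' y h"]) (auto intro!: derivative_intros)
next
  case (mult f g)
  then obtain f' g' where d: "\<And>h. real_polynomial_function (\<lambda>y. f' y h)" "\<And>y. (f has_derivative f' y) (at y)"
    "\<And>h. real_polynomial_function (\<lambda>y. g' y h)" "\<And>y. (g has_derivative g' y) (at y)" by blast
  show ?case
  proof (intro exI[of _ "\<lambda>y h. f y * g' y h + f' y h * g y"] conjI allI)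
    show "real_polynomial_function (\<lambda>y. f y * g' y h + f' y h * g y)" for h
      by (intro real_polynomial_function.intros(3)[OF real_polynomial_function.intros(4) real_polynomial_function.intros(4)] mult.hyps d)
    show "((\<lambda>y. f y * g y) has_derivative (\<lambda>h. f y * g' y h + f' y h * g y)) (at y)" for y
      by (intro has_derivative_mult d)
  qed
qed

lemma real_polynomial_function_growth:
  assumes "real_polynomial_function p"
  shows "\<exists>C k. \<forall>y. \<bar>p y\<bar> \<le> C * (1 + norm y) ^ k"
  using assms
proof (induction p)
  case (linear f)
  from bounded_linear.bounded[OF this] obtain K where K: "\<And>x. norm (f x) \<le> norm x * K" by blast
  have "\<bar>f y\<bar> \<le> \<bar>K\<bar> * (1 + norm y) ^ 1" for y
  proof -
    have "norm y * K \<le> norm y * \<bar>K\<bar>" by (intro mult_left_mono) auto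
    then show ?thesis using K[of y] by (simp add: algebra_simps)
  qed
  then show ?case by blast
next
  case (const c)
  have "\<bar>c\<bar> \<le> \<bar>c\<bar> * (1 + norm y) ^ 0" for y :: 'a by simp
  then show ?case by blast
next
  case (add f g)
  then obtain C k D l where *: "\<And>y. \<bar>f y\<bar> \<le> C * (1 + norm y) ^ k" "\<And>y. \<bar>g y\<bar> \<le> D * (1 + norm y) ^ l" by blast
  have CD: "0 \<le> C" "0 \<le> D" using *[of 0] by auto
  have "\<bar>f y + g y\<bar> \<le> (C + D) * (1 + norm y) ^ (k + l)" for y
  proof -
    have "C * (1 + norm y) ^ k \<le> C * (1 + norm y) ^ (k + l)" "D * (1 + norm y) ^ l \<le> D * (1 + norm y) ^ (k + l)"
      using CD by (auto intro!: mult_left_mono power_increasing)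
    then show ?thesis using *[of y] by (simp add: distrib_right)
  qed
  then show ?case by blast
next
  case (mult f g)
  then obtain C k D l where *: "\<And>y. \<bar>f y\<bar> \<le> C * (1 + norm y) ^ k" "\<And>y. \<bar>g y\<bar> \<le> D * (1 + norm y) ^ l" by blast
  have CD: "0 \<le> C" using *[of 0] by auto
  have "\<bar>f y * g y\<bar> \<le> (C * D) * (1 + norm y) ^ (k + l)" for y
    using mult_mono[OF *(1)[of y] *(2)[of y]] CD by (simp add: abs_mult power_add mult_ac)
  then show ?case by blast
qed

text \<open>With v = 1 + u >= 1, the exponential of c v^2 / 2 dominates (1 + c v^2 / (2 m))^m and
  hence a multiple of v^m. The return from v to u uses v^2 / 2 <= 1 + u^2 and costs the factor exp
  c.\<close>

lemma gaussian_decay: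
  fixes c :: real
  assumes "0 < c"
  shows "\<exists>B. \<forall>u\<ge>0. (1 + u) ^ m * exp (- c * u\<^sup>2) \<le> B"
proof (cases "m = 0")
  case False
  have "(1 + u) ^ m * exp (- c * u\<^sup>2) \<le> exp c * (2 * m / c) ^ m" if u: "0 \<le> u" for u :: real
  proof -
    define v where "v = 1 + u"
    have v: "1 \<le> v" using u by (simp add: v_def)
    have "(1 + c * v\<^sup>2 / 2 / m) ^ m \<le> exp (c * v\<^sup>2 / 2)"
      using assms False by (intro exp_ge_one_plus_x_over_n_power_n) (auto intro: order_trans[of _ 0])
    moreover have "(c / (2 * m)) ^ m * v ^ m \<le> (1 + c * v\<^sup>2 / 2 / m) ^ m"
    proof -
      have "v * 1 \<le> v * v" using v by (intro mult_left_mono) auto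
      then have "c / (2 * m) * v \<le> c / (2 * m) * v\<^sup>2"
        using assms by (intro mult_left_mono) (auto simp: power2_eq_square)
      then have "c / (2 * m) * v \<le> 1 + c * v\<^sup>2 / 2 / m" by simp
      then show ?thesis using assms v by (subst power_mult_distrib[symmetric]) (intro power_mono, auto)
    qed
    ultimately have "(c / (2 * m)) ^ m * v ^ m \<le> exp (c * v\<^sup>2 / 2)" by linarith
    then have "(2 * m / c) ^ m * ((c / (2 * m)) ^ m * v ^ m) \<le> (2 * m / c) ^ m * exp (c * v\<^sup>2 / 2)"
      using assms by (intro mult_left_mono) auto
    moreover have "(2 * m / c) ^ m * (c / (2 * m)) ^ m = 1"
      using assms False by (subst power_mult_distrib[symmetric]) simp
    ultimately have 1: "v ^ m \<le> (2 * m / c) ^ m * exp (c * v\<^sup>2 / 2)"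
      by (simp add: mult.assoc[symmetric])
    have "v\<^sup>2 / 2 \<le> 1 + u\<^sup>2"
      using sum_squares_bound[of 1 u] by (simp add: v_def power2_sum)
    then have "c * (v\<^sup>2 / 2) \<le> c * (1 + u\<^sup>2)" using assms by (intro mult_left_mono) auto
    then have "c * v\<^sup>2 / 2 + - c * u\<^sup>2 \<le> c" by (simp add: algebra_simps)
    then have 2: "exp (c * v\<^sup>2 / 2) * exp (- c * u\<^sup>2) \<le> exp c" by (simp add: exp_add[symmetric])
    have "v ^ m * exp (- c * u\<^sup>2) \<le> (2 * m / c) ^ m * exp (c * v\<^sup>2 / 2) * exp (- c * u\<^sup>2)"
      by (intro mult_right_mono 1) auto
    also have "\<dots> = (2 * m / c) ^ m * (exp (c * v\<^sup>2 / 2) * exp (- c * u\<^sup>2))" by (simp add: mult_ac)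
    also have "\<dots> \<le> (2 * m / c) ^ m * exp c" using assms by (intro mult_left_mono 2) auto
    finally show ?thesis by (simp add: v_def mult.commute)
  qed
  then show ?thesis by blast
next
  case True
  then show ?thesis using assms by (intro exI[of _ 1]) auto
qed

definition gaussian :: "real \<Rightarrow> 'a::euclidean_space \<Rightarrow> complex" where
  "gaussian c y = of_real (exp (- c * (norm y)\<^sup>2))"

lemma has_derivative_gaussian_factor:
  "((\<lambda>y. exp (- c * (norm y)\<^sup>2)) has_derivative (\<lambda>h. exp (- c * (norm y)\<^sup>2) * (- c * (2 * (y \<bullet> h))))) (at (y :: 'a::euclidean_space))"
  unfolding power2_norm_eq_inner
  by (auto intro!: derivative_eq_intros simp: inner_commute)

text \<open>The decay estimate asks only for some polynomial factor. Its existence follows since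
  polynomials are closed under differentiation and under multiplication by coordinates.\<close>

lemma partial_derivs_gaussian:
  assumes "set bs \<subseteq> Basis"
  shows "\<exists>p. real_polynomial_function p \<and>
    partial_derivs bs (gaussian c) = (\<lambda>y. complex_of_real (p y * exp (- c * (norm y)\<^sup>2)))"
  using assms
proof (induction bs)
  case Nil
  show ?case by (intro exI[of _ "\<lambda>y. 1"]) (auto simp: gaussian_def[abs_def] intro: real_polynomial_function.intros(2))
next
  case (Cons b bs)
  then obtain p where p: "real_polynomial_function p"
    and eq: "partial_derivs bs (gaussian c) = (\<lambda>y. complex_of_real (p y * exp (- c * (norm y)\<^sup>2)))" by auto
  obtain p' where p': "\<And>h. real_polynomial_function (\<lambda>y. p' y h)" "\<And>y. (p has_derivative p' y) (at y)"
    using real_polynomial_function_has_derivative[OF p] by blast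
  have "partial_derivs (b # bs) (gaussian c)
    = (\<lambda>y. complex_of_real (p y * (exp (- c * (norm y)\<^sup>2) * (- c * (2 * (y \<bullet> b)))) + p' y b * exp (- c * (norm y)\<^sup>2)))"
    by (rule partial_derivs_Cons_eqI) (unfold eq, intro has_derivative_of_real has_derivative_mult p' has_derivative_gaussian_factor)
  also have "\<dots> = (\<lambda>y. complex_of_real ((p y * (- 2 * c * (y \<bullet> b)) + p' y b) * exp (- c * (norm y)\<^sup>2)))"
    by (intro ext arg_cong[where f=complex_of_real]) (simp add: algebra_simps)
  finally have eq': "partial_derivs (b # bs) (gaussian c) = \<dots>" .
  have "real_polynomial_function (\<lambda>y. p y * (- 2 * c * (y \<bullet> b)) + p' y b)"
    by (rule real_polynomial_function.intros(3), rule real_polynomial_function.intros(4), rule p,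
        rule real_polynomial_function.intros(4), rule real_polynomial_function.intros(2),
        rule real_polynomial_function.intros(1), rule bounded_linear_inner_left, rule p')
  from conjI[OF this eq'] show ?case
    by (rule exI[of _ "\<lambda>y. p y * (- 2 * c * (y \<bullet> b)) + p' y b"])
qed

lemma schwartz_gaussian:
  assumes "0 < c"
  shows "gaussian c \<in> schwartz"
  unfolding schwartz_def smooth_def
proof (intro CollectI conjI allI impI)
  fix bs :: "'a list" assume bs: "set bs \<subseteq> Basis"
  from partial_derivs_gaussian[OF bs, of c] obtain p where p: "real_polynomial_function p"
    and eq: "partial_derivs bs (gaussian c) = (\<lambda>y. complex_of_real (p y * exp (- c * (norm y)\<^sup>2)))" by blast
  obtain p' where p': "\<And>y. (p has_derivative p' y) (at y)"
    using real_polynomial_function_has_derivative[OF p] by blast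
  have "(partial_derivs bs (gaussian c) has_derivative
     (\<lambda>h. complex_of_real (p x * (exp (- c * (norm x)\<^sup>2) * (- c * (2 * (x \<bullet> h)))) + p' x h * exp (- c * (norm x)\<^sup>2)))) (at x)" for x
    unfolding eq by (intro has_derivative_of_real has_derivative_mult p' has_derivative_gaussian_factor)
  then show "partial_derivs bs (gaussian c) differentiable at x" for x
    unfolding differentiable_def by blast
  fix k
  obtain C l where C: "\<And>y. \<bar>p y\<bar> \<le> C * (1 + norm y) ^ l"
    using real_polynomial_function_growth[OF p] by blast
  have C0: "0 \<le> C" using C[of 0] by simp
  obtain B where B: "\<And>u. 0 \<le> u \<Longrightarrow> (1 + u) ^ (k + l) * exp (- c * u\<^sup>2) \<le> B"
    using gaussian_decay[OF assms] by blast
  have "(1 + norm x) ^ k * norm (partial_derivs bs (gaussian c) x) \<le> C * B" for x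
  proof -
    have "(1 + norm x) ^ k * norm (partial_derivs bs (gaussian c) x)
      = (1 + norm x) ^ k * exp (- c * (norm x)\<^sup>2) * \<bar>p x\<bar>" by (simp add: eq norm_mult abs_mult)
    also have "\<dots> \<le> (1 + norm x) ^ k * exp (- c * (norm x)\<^sup>2) * (C * (1 + norm x) ^ l)"
      by (intro mult_left_mono C) auto
    also have "\<dots> = C * ((1 + norm x) ^ (k + l) * exp (- c * (norm x)\<^sup>2))"
      by (simp add: power_add mult_ac)
    also have "\<dots> \<le> C * B" by (intro mult_left_mono B C0) simp
    finally show ?thesis .
  qed
  then show "bounded (range (\<lambda>x. (1 + norm x) ^ k * norm (partial_derivs bs (gaussian c) x)))"
    by (intro boundedI[where B="C * B"]) (auto simp: abs_mult)
qed

subsection \<open>Integration of Schwartz functions\<close>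

lemma norm_integral_le:
  fixes f :: "'w \<Rightarrow> 'b::{banach, second_countable_topology}"
  assumes "integrable M f" "integrable M g" "\<And>x. norm (f x) \<le> g x"
  shows "norm (\<integral>x. f x \<partial>M) \<le> (\<integral>x. g x \<partial>M)"
  by (rule order_trans[OF integral_norm_bound]) (intro integral_mono integrable_norm assms)

lemma linear_norm_le:
  fixes L :: "'a::euclidean_space \<Rightarrow> 'b::real_normed_vector"
  assumes "linear L" "\<And>b. b \<in> Basis \<Longrightarrow> norm (L b) \<le> K"
  shows "norm (L h) \<le> real DIM('a) * K * norm h"
proof -
  have "L h = L (\<Sum>b\<in>Basis. (h \<bullet> b) *\<^sub>R b)" by (simp add: euclidean_representation)
  also have "\<dots> = (\<Sum>b\<in>Basis. (h \<bullet> b) *\<^sub>R L b)"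
    using assms(1) by (simp add: linear_sum linear_scale)
  finally have "norm (L h) \<le> (\<Sum>b\<in>Basis. norm ((h \<bullet> b) *\<^sub>R L b))" by (simp only: norm_sum)
  also have "\<dots> \<le> (\<Sum>b\<in>(Basis :: 'a set). norm h * K)"
    using assms(2) by (intro sum_mono) (auto intro!: mult_mono Basis_le_norm)
  finally show ?thesis by (simp add: mult_ac)
qed

text \<open>The bound on the derivatives in the basis directions controls the operator norm up to
  the factor \<open>DIM('a)\<close>. The mean value inequality then dominates all difference
  quotients, and dominated convergence runs along arbitrary sequences tending to 0.\<close>

lemma has_derivative_lebesgue_integral:
  fixes f :: "'w \<Rightarrow> 'a::euclidean_space \<Rightarrow> complex"
  assumes int: "\<And>y. integrable M (\<lambda>w. f w y)"
    and der: "\<And>w y. (f w has_derivative f' w y) (at y)"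
    and bnd: "\<And>w y b. b \<in> Basis \<Longrightarrow> norm (f' w y b) \<le> g w" and g: "integrable M g"
    and meas: "\<And>y b. b \<in> Basis \<Longrightarrow> (\<lambda>w. f' w y b) \<in> borel_measurable M"
  shows "((\<lambda>y. \<integral>w. f w y \<partial>M) has_derivative (\<lambda>h. \<integral>w. f' w y h \<partial>M)) (at y)"
proof -
  let ?d = "real DIM('a)"
  have lin: "linear (f' w y)" for w y
    using der has_derivative_linear by blast
  have meas': "(\<lambda>w. f' w y h) \<in> borel_measurable M" for y h
  proof -
    have "f' w y h = (\<Sum>b\<in>Basis. (h \<bullet> b) *\<^sub>R f' w y b)" for w
      using arg_cong[OF euclidean_representation[of h, symmetric], of "f' w y"] lin
      by (simp only: linear_sum linear_scale)
    then show ?thesis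
      by (simp only:) (intro borel_measurable_sum borel_measurable_scaleR meas borel_measurable_const)
  qed
  have bnd': "norm (f' w y h) \<le> ?d * g w * norm h" for w y h
    by (rule linear_norm_le[OF lin bnd])
  have g0: "0 \<le> g w" for w
    using bnd[OF SOME_Basis, of w 0] norm_ge_zero[of "f' w 0 (SOME i. i \<in> Basis)"] by linarith
  have int': "integrable M (\<lambda>w. f' w y h)" for y h
  proof (rule Bochner_Integration.integrable_bound[of M "\<lambda>w. ?d * g w * norm h"])
    show "AE w in M. norm (f' w y h) \<le> norm (?d * g w * norm h)"
      by (intro AE_I2 order_trans[OF bnd']) simp
  qed (use g meas' in auto)
  have lip: "norm (f w (y + h) - f w y) \<le> ?d * g w * norm h" for w h
  proof -
    have "norm (f w (y + h) - f w y) \<le> ?d * g w * norm (y + h - y)"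
    proof (rule differentiable_bound[where S=UNIV and f'="f' w"])
      show "(f w has_derivative f' w x) (at x within UNIV)" for x by (rule der)
      show "onorm (f' w x) \<le> ?d * g w" for x by (rule onorm_le) (rule bnd')
    qed auto
    then show ?thesis by simp
  qed
  show ?thesis
    unfolding has_derivative_at
  proof
    show "bounded_linear (\<lambda>h. \<integral>w. f' w y h \<partial>M)"
    proof (rule bounded_linear_intro[where K="\<integral>w. ?d * g w \<partial>M"])
      show "(\<integral>w. f' w y (h + k) \<partial>M) = (\<integral>w. f' w y h \<partial>M) + (\<integral>w. f' w y k \<partial>M)" for h k
        using int' lin by (simp add: linear_add)
      show "(\<integral>w. f' w y (c *\<^sub>R h) \<partial>M) = c *\<^sub>R (\<integral>w. f' w y h \<partial>M)" for c h
        using lin by (simp add: linear_scale)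
      have "norm (\<integral>w. f' w y h \<partial>M) \<le> (\<integral>w. ?d * g w * norm h \<partial>M)" for h
        by (intro norm_integral_le int' bnd') (use g in auto)
      then show "norm (\<integral>w. f' w y h \<partial>M) \<le> norm h * (\<integral>w. ?d * g w \<partial>M)" for h
        using g by (simp add: mult_ac)
    qed
    show "(\<lambda>h. norm ((\<integral>w. f w (y + h) \<partial>M) - (\<integral>w. f w y \<partial>M) - (\<integral>w. f' w y h \<partial>M)) / norm h) \<midarrow>0\<rightarrow> 0"
      unfolding tendsto_at_iff_sequentially
    proof (intro allI impI)
      fix X :: "nat \<Rightarrow> 'a" assume X: "\<forall>i. X i \<in> UNIV - {0}" "X \<longlonglongrightarrow> 0"
      define q where "q n w = (f w (y + X n) - f w y - f' w y (X n)) /\<^sub>R norm (X n)" for n w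
      have "(\<lambda>n. \<integral>w. q n w \<partial>M) \<longlonglongrightarrow> (\<integral>w. 0 \<partial>M)"
      proof (rule integral_dominated_convergence[where w="\<lambda>w. 2 * ?d * g w"])
        show "AE w in M. (\<lambda>n. q n w) \<longlonglongrightarrow> 0"
        proof (intro AE_I2)
          fix w
          have "(\<lambda>h. norm (f w (y + h) - f w y - f' w y h) / norm h) \<midarrow>0\<rightarrow> 0"
            using der unfolding has_derivative_at by blast
          then have "(\<lambda>n. norm (q n w)) \<longlonglongrightarrow> 0"
            using X unfolding tendsto_at_iff_sequentially
            by (auto simp: comp_def q_def divide_inverse mult.commute)
          then show "(\<lambda>n. q n w) \<longlonglongrightarrow> 0" by (rule tendsto_norm_zero_cancel)
        qed
        show "AE w in M. norm (q n w) \<le> 2 * ?d * g w" for n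
        proof (intro AE_I2)
          fix w
          have "norm (f w (y + X n) - f w y - f' w y (X n)) \<le> 2 * ?d * g w * norm (X n)"
            using norm_triangle_ineq4[of "f w (y + X n) - f w y" "f' w y (X n)"] lip[of w "X n"] bnd'[of w y "X n"]
            by simp
          moreover have "0 < norm (X n)" using X by simp
          moreover have "norm (q n w) = norm (f w (y + X n) - f w y - f' w y (X n)) / norm (X n)"
            by (simp add: q_def divide_inverse mult.commute)
          ultimately show "norm (q n w) \<le> 2 * ?d * g w"
            by (simp only: pos_divide_le_eq)
        qed
        show "q n \<in> borel_measurable M" for n
          unfolding q_def using int int' by (intro borel_measurable_scaleR borel_measurable_diff) (auto dest: borel_measurable_integrable)
      qed (use g in auto)
      moreover have "(\<integral>w. q n w \<partial>M) = ((\<integral>w. f w (y + X n) \<partial>M) - (\<integral>w. f w y \<partial>M) - (\<integral>w. f' w y (X n) \<partial>M)) /\<^sub>R norm (X n)" for n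
        unfolding q_def using int int' by simp
      ultimately have "(\<lambda>n. ((\<integral>w. f w (y + X n) \<partial>M) - (\<integral>w. f w y \<partial>M) - (\<integral>w. f' w y (X n) \<partial>M)) /\<^sub>R norm (X n)) \<longlonglongrightarrow> 0"
        by simp
      from tendsto_norm_zero[OF this]
      have "(\<lambda>n. norm (((\<integral>w. f w (y + X n) \<partial>M) - (\<integral>w. f w y \<partial>M) - (\<integral>w. f' w y (X n) \<partial>M)) /\<^sub>R norm (X n))) \<longlonglongrightarrow> 0" .
      then show "((\<lambda>h. norm ((\<integral>w. f w (y + h) \<partial>M) - (\<integral>w. f w y \<partial>M) - (\<integral>w. f' w y h \<partial>M)) / norm h) \<circ> X) \<longlonglongrightarrow> 0"
        by (simp add: comp_def divide_inverse mult.commute)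
    qed
  qed
qed

text \<open>The exponent 2 d, used throughout as the threshold of integrability, arises by giving
  each of the d coordinates a factor (1 + |x|)^2 >= 1 + x_b^2; the integral is then at most a
  product of one-dimensional integrals of 1/(1 + u^2).\<close>

lemma integrable_inverse_power_norm:
  "integrable lborel (\<lambda>x :: 'a::euclidean_space. 1 / (1 + norm x) ^ (2 * DIM('a)))"
proof (rule integrableI_bounded)
  have le: "ennreal (norm (1 / (1 + norm x) ^ (2 * DIM('a)))) \<le> (\<Prod>b\<in>Basis. ennreal (1 / (1 + (x \<bullet> b)\<^sup>2)))" for x :: 'a
  proof -
    have "(\<Prod>b\<in>(Basis :: 'a set). 1 + (x \<bullet> b)\<^sup>2) \<le> (\<Prod>b\<in>(Basis :: 'a set). (1 + norm x)\<^sup>2)"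
    proof (rule prod_mono)
      fix b :: 'a assume "b \<in> Basis"
      then have "\<bar>x \<bullet> b\<bar>\<^sup>2 \<le> (norm x)\<^sup>2" by (intro power_mono Basis_le_norm) auto
      then show "0 \<le> 1 + (x \<bullet> b)\<^sup>2 \<and> 1 + (x \<bullet> b)\<^sup>2 \<le> (1 + norm x)\<^sup>2"
        using norm_ge_zero[of x] by (simp add: power2_sum add_increasing2)
    qed
    also have "\<dots> = (1 + norm x) ^ (2 * DIM('a))" by (simp add: power_mult[symmetric])
    finally have "1 / (1 + norm x) ^ (2 * DIM('a)) \<le> 1 / (\<Prod>b\<in>Basis. 1 + (x \<bullet> b)\<^sup>2)"
      by (intro divide_left_mono mult_pos_pos prod_pos) (auto simp: add_pos_nonneg)
    also have "\<dots> = (\<Prod>b\<in>Basis. 1 / (1 + (x \<bullet> b)\<^sup>2))" by (simp add: prod_dividef)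
    finally show ?thesis by (subst prod_ennreal) (auto intro!: ennreal_leI)
  qed
  have fin: "(\<integral>\<^sup>+u. ennreal (1 / (1 + u\<^sup>2)) \<partial>lborel) < \<infinity>"
  proof -
    have "integrable lborel (\<lambda>u :: real. inverse (1 + u\<^sup>2))"
      using integrable_inverse_1_plus_square by (simp add: set_integrable_def)
    then show ?thesis by (simp add: integrable_iff_bounded inverse_eq_divide abs_of_nonneg add_nonneg_nonneg)
  qed
  have "(\<integral>\<^sup>+x. ennreal (norm (1 / (1 + norm (x :: 'a)) ^ (2 * DIM('a)))) \<partial>lborel)
    \<le> (\<integral>\<^sup>+x. (\<Prod>b\<in>Basis. ennreal (1 / (1 + ((x :: 'a) \<bullet> b)\<^sup>2))) \<partial>lborel)"
    by (intro nn_integral_mono le)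
  also have "\<dots> = (\<Prod>b\<in>(Basis :: 'a set). (\<integral>\<^sup>+u. ennreal (1 / (1 + u\<^sup>2)) \<partial>lborel))"
    by (rule nn_integral_lborel_prod) auto
  also have "\<dots> < \<infinity>" using fin by (simp add: power_less_top_ennreal)
  finally show "(\<integral>\<^sup>+x. ennreal (norm (1 / (1 + norm (x :: 'a)) ^ (2 * DIM('a)))) \<partial>lborel) < \<infinity>" .
qed simp

lemma integrable_decay:
  fixes f :: "'a::euclidean_space \<Rightarrow> 'b::{banach, second_countable_topology}"
  assumes "f \<in> borel_measurable lborel" "\<And>x. norm (f x) \<le> B / (1 + norm x) ^ (2 * DIM('a))"
  shows "integrable lborel f"
proof (rule Bochner_Integration.integrable_bound[OF _ assms(1)])
  show "integrable lborel (\<lambda>x :: 'a. B * (1 / (1 + norm x) ^ (2 * DIM('a))))"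
    by (intro integrable_mult_right integrable_inverse_power_norm)
  show "AE x in lborel. norm (f x) \<le> norm (B * (1 / (1 + norm x) ^ (2 * DIM('a))))"
    using assms(2) by (intro AE_I2) (auto intro!: order_trans[OF assms(2)] divide_right_mono)
qed

lemma smooth_borel_measurable:
  "smooth f \<Longrightarrow> set bs \<subseteq> Basis \<Longrightarrow> partial_derivs bs f \<in> borel_measurable borel"
  by (intro borel_measurable_continuous_onI smooth_continuous)

lemma schwartz_borel_measurable [measurable_dest]: "f \<in> schwartz \<Longrightarrow> f \<in> borel_measurable borel"
  using smooth_borel_measurable[of f "[]"] schwartz_smooth by auto

lemma schwartz_partial_derivs: "f \<in> schwartz \<Longrightarrow> set bs \<subseteq> Basis \<Longrightarrow> partial_derivs bs f \<in> schwartz"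
  unfolding schwartz_def by (auto simp: smooth_partial_derivs partial_derivs_append[symmetric])

lemma integrable_schwartz: "f \<in> schwartz \<Longrightarrow> integrable lborel f"
  using seminorm_bound_le[OF seminorm_bound_schwartz_norm[of f "2 * DIM('a)"], of "[]"] schwartz_borel_measurable[of f]
  by (intro integrable_decay) auto

subsection \<open>Families of Schwartz functions\<close>

lemma schwartz_norm_nonneg: "f \<in> schwartz \<Longrightarrow> 0 \<le> schwartz_norm N f"
  using seminorm_bound_nonneg seminorm_bound_schwartz_norm by blast

lemma schwartz_norm_triangle:
  assumes "f \<in> schwartz" "h \<in> schwartz"
  shows "schwartz_norm N (\<lambda>x. f x + h x) \<le> schwartz_norm N f + schwartz_norm N h"
  unfolding schwartz_norm_def sum.distrib[symmetric]
proof (intro sum_mono cSUP_least)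
  fix bs :: "'a list" and x assume "bs \<in> {bs. set bs \<subseteq> Basis \<and> length bs \<le> N}"
  then have bs: "set bs \<subseteq> Basis" by simp
  have "partial_derivs bs (\<lambda>x. f x + h x) = (\<lambda>x. partial_derivs bs f x + partial_derivs bs h x)"
    using partial_derivs_lincomb[OF assms[THEN schwartz_smooth] bs, of 1 1] by simp
  then have "(1 + norm x) ^ N * norm (partial_derivs bs (\<lambda>x. f x + h x) x)
     \<le> (1 + norm x) ^ N * norm (partial_derivs bs f x) + (1 + norm x) ^ N * norm (partial_derivs bs h x)"
    unfolding distrib_left[symmetric] by (auto intro!: mult_left_mono norm_triangle_ineq)
  also have "\<dots> \<le> (SUP x. (1 + norm x) ^ N * norm (partial_derivs bs f x)) + (SUP x. (1 + norm x) ^ N * norm (partial_derivs bs h x))"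
    by (intro add_mono cSUP_upper schwartz_bdd_above assms bs) auto
  finally show "(1 + norm x) ^ N * norm (partial_derivs bs (\<lambda>x. f x + h x) x)
     \<le> (SUP x. (1 + norm x) ^ N * norm (partial_derivs bs f x)) + (SUP x. (1 + norm x) ^ N * norm (partial_derivs bs h x))" .
qed simp

text \<open>Pointwise joint continuity becomes continuity in every seminorm: on a large ball in y by
  uniform continuity on a compact set, outside it by one spare power of decay, for which the bound
  on the seminorm of order N + 1 is used.\<close>

lemma seminorm_bound_family_continuous:
  fixes K :: "'b::euclidean_space \<Rightarrow> 'a::euclidean_space \<Rightarrow> complex"
  assumes K: "\<And>z. K z \<in> schwartz"
    and cont: "\<And>bs. set bs \<subseteq> Basis \<Longrightarrow> continuous_on UNIV (\<lambda>(z, y). partial_derivs bs (K z) y)"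
    and bdd: "\<And>N r. \<exists>C. \<forall>z. norm z \<le> r \<longrightarrow> seminorm_bound N (K z) C" and e: "0 < e"
  shows "\<forall>\<^sub>F z in nhds z0. seminorm_bound N (\<lambda>y. K z y - K z0 y) e"
proof -
  obtain C where C: "\<And>z. norm z \<le> norm z0 + 1 \<Longrightarrow> seminorm_bound (Suc N) (K z) C"
    using bdd by blast
  \<comment> \<open>Chosen so that 2 C <= e (1 + |y|) for |y| > R.\<close>
  define R where "R = 2 * C / e"
  have C0: "0 \<le> C" using C[of 0] seminorm_bound_nonneg by (simp add: add_nonneg_nonneg)
  have R0: "0 \<le> R" using C0 e by (simp add: R_def)
  define Bs where "Bs = {bs. set bs \<subseteq> (Basis :: 'a set) \<and> length bs \<le> N}"
  have fin: "finite Bs" unfolding Bs_def by (rule finite_multiindices)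
  have "\<forall>\<^sub>F z in nhds z0. \<forall>y\<in>cball 0 R. dist (partial_derivs bs (K z) y) (partial_derivs bs (K z0) y) < e / (1 + R) ^ N"
    if "bs \<in> Bs" for bs
  proof -
    have bs: "set bs \<subseteq> Basis" using that by (simp add: Bs_def)
    have "compact (cball z0 1 \<times> cball (0 :: 'a) R)" by (intro compact_Times compact_cball)
    from compact_uniformly_continuous[OF continuous_on_subset[OF cont[OF bs] subset_UNIV] this]
    have "uniformly_continuous_on (cball z0 1 \<times> cball 0 R) (\<lambda>(z, y). partial_derivs bs (K z) y)" .
    moreover have "0 < e / (1 + R) ^ N" using e R0 by simp
    ultimately obtain d where d: "0 < d" "\<And>p q. p \<in> cball z0 1 \<times> cball 0 R \<Longrightarrow> q \<in> cball z0 1 \<times> cball 0 R \<Longrightarrow>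
      dist q p < d \<Longrightarrow> dist (case q of (z, y) \<Rightarrow> partial_derivs bs (K z) y) (case p of (z, y) \<Rightarrow> partial_derivs bs (K z) y) < e / (1 + R) ^ N"
      unfolding uniformly_continuous_on_def by metis
    have "\<forall>\<^sub>F z in nhds z0. dist z z0 < min d 1"
      using d(1) by (auto simp: eventually_nhds_metric intro!: exI[of _ "min d 1"])
    then show ?thesis
    proof eventually_elim
      case (elim z)
      show ?case
      proof
        fix y :: 'a assume "y \<in> cball 0 R"
        with elim show "dist (partial_derivs bs (K z) y) (partial_derivs bs (K z0) y) < e / (1 + R) ^ N"
          using d(2)[of "(z0, y)" "(z, y)"] by (simp add: dist_Pair_Pair dist_commute)
      qed
    qed
  qed
  then have "\<forall>\<^sub>F z in nhds z0. \<forall>bs\<in>Bs. \<forall>y\<in>cball 0 R. dist (partial_derivs bs (K z) y) (partial_derivs bs (K z0) y) < e / (1 + R) ^ N"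
    using fin by (simp add: eventually_ball_finite)
  moreover have "\<forall>\<^sub>F z in nhds z0. dist z z0 < 1"
    by (auto simp: eventually_nhds_metric intro!: exI[of _ 1])
  ultimately show ?thesis
  proof eventually_elim
    case (elim z)
    have zn: "norm z \<le> norm z0 + 1"
      using elim(2) norm_triangle_ineq2[of z z0] by (simp add: dist_norm)
    show ?case unfolding seminorm_bound_def
    proof (intro allI impI)
      fix bs :: "'a list" and y :: 'a assume bs: "set bs \<subseteq> Basis" "length bs \<le> N"
      have eq: "partial_derivs bs (\<lambda>y. K z y - K z0 y) = (\<lambda>y. partial_derivs bs (K z) y - partial_derivs bs (K z0) y)"
        using partial_derivs_lincomb[OF K[of z, THEN schwartz_smooth] K[of z0, THEN schwartz_smooth] bs(1), of 1 "-1"] by simp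
      show "(1 + norm y) ^ N * norm (partial_derivs bs (\<lambda>y. K z y - K z0 y) y) \<le> e"
      proof (cases "norm y \<le> R")
        case True
        then have "norm (partial_derivs bs (K z) y - partial_derivs bs (K z0) y) \<le> e / (1 + R) ^ N"
          using elim(1) bs by (auto simp: Bs_def dist_norm less_imp_le)
        then have "(1 + norm y) ^ N * norm (partial_derivs bs (K z) y - partial_derivs bs (K z0) y) \<le> (1 + R) ^ N * (e / (1 + R) ^ N)"
          using True R0 by (intro mult_mono power_mono) auto
        then show ?thesis using R0 unfolding eq by simp
      next
        case False
        have "(1 + norm y) ^ Suc N * norm (partial_derivs bs (K z) y) \<le> C"
             "(1 + norm y) ^ Suc N * norm (partial_derivs bs (K z0) y) \<le> C"
          using bs by (intro seminorm_boundD[OF C] zn; simp)+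
        then have "(1 + norm y) ^ Suc N * (norm (partial_derivs bs (K z) y) + norm (partial_derivs bs (K z0) y)) \<le> 2 * C"
          by (simp only: distrib_left)
        moreover have "(1 + norm y) ^ Suc N * norm (partial_derivs bs (K z) y - partial_derivs bs (K z0) y)
           \<le> (1 + norm y) ^ Suc N * (norm (partial_derivs bs (K z) y) + norm (partial_derivs bs (K z0) y))"
          by (intro mult_left_mono norm_triangle_ineq4) auto
        ultimately have "(1 + norm y) * ((1 + norm y) ^ N * norm (partial_derivs bs (K z) y - partial_derivs bs (K z0) y)) \<le> 2 * C"
          by (simp add: mult.assoc)
        also have "2 * C = e * R" using e by (simp add: R_def)
        also have "\<dots> \<le> e * (1 + norm y)" using False e by (intro mult_left_mono) auto
        finally have "(1 + norm y) * ((1 + norm y) ^ N * norm (partial_derivs bs (K z) y - partial_derivs bs (K z0) y)) \<le> (1 + norm y) * e"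
          by (simp add: mult.commute)
        then show ?thesis unfolding eq by (subst (asm) mult_le_cancel_left_pos) (auto simp: add_pos_nonneg)
      qed
    qed
  qed
qed

text \<open>A tempered distribution and the Schwartz norm itself are both Lipschitz with respect to
  one seminorm; this is the common argument for their continuity along a family.\<close>

lemma functional_family_continuous:
  fixes K :: "'b::euclidean_space \<Rightarrow> 'a::euclidean_space \<Rightarrow> complex" and P :: "('a \<Rightarrow> complex) \<Rightarrow> 'c::metric_space"
  assumes K: "\<And>z. K z \<in> schwartz"
    and cont: "\<And>bs. set bs \<subseteq> Basis \<Longrightarrow> continuous_on UNIV (\<lambda>(z, y). partial_derivs bs (K z) y)"
    and bdd: "\<And>N r. \<exists>C. \<forall>z. norm z \<le> r \<longrightarrow> seminorm_bound N (K z) C"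
    and C: "0 \<le> C"
    and P: "\<And>f h B. f \<in> schwartz \<Longrightarrow> h \<in> schwartz \<Longrightarrow> seminorm_bound N (\<lambda>y. f y - h y) B \<Longrightarrow> dist (P f) (P h) \<le> C * B"
  shows "continuous_on UNIV (\<lambda>z. P (K z))"
  unfolding continuous_on_def
proof
  fix z0 :: 'b
  have "((\<lambda>z. P (K z)) \<longlongrightarrow> P (K z0)) (nhds z0)"
  proof (rule tendstoI)
    fix e :: real assume e: "0 < e"
    \<comment> \<open>The denominator \<open>C + 1\<close> allows C = 0 and makes the final
      inequality strict.\<close>
    then have e': "0 < e / (C + 1)" using C by simp
    have "\<forall>\<^sub>F z in nhds z0. seminorm_bound N (\<lambda>y. K z y - K z0 y) (e / (C + 1))"
      by (rule seminorm_bound_family_continuous[OF K _ bdd e']) (rule cont)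
    then show "\<forall>\<^sub>F z in nhds z0. dist (P (K z)) (P (K z0)) < e"
    proof eventually_elim
      case (elim z)
      have "dist (P (K z)) (P (K z0)) \<le> C * (e / (C + 1))" by (rule P[OF K K elim])
      also have "\<dots> < e" using C e by (simp add: field_simps)
      finally show ?case .
    qed
  qed
  then show "((\<lambda>z. P (K z)) \<longlongrightarrow> P (K z0)) (at z0 within UNIV)"
    by (rule tendsto_mono[rotated]) (simp add: at_within_def)
qed

lemma tempered_family_continuous:
  fixes K :: "'b::euclidean_space \<Rightarrow> 'a::euclidean_space \<Rightarrow> complex"
  assumes K: "\<And>z. K z \<in> schwartz"
    and cont: "\<And>bs. set bs \<subseteq> Basis \<Longrightarrow> continuous_on UNIV (\<lambda>(z, y). partial_derivs bs (K z) y)"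
    and bdd: "\<And>N r. \<exists>C. \<forall>z. norm z \<le> r \<longrightarrow> seminorm_bound N (K z) C" and T: "tempered T"
  shows "continuous_on UNIV (\<lambda>z. T (K z))"
proof -
  from tempered_bound[OF T] obtain C N where C: "0 \<le> C"
    "\<And>\<phi> B. \<phi> \<in> schwartz \<Longrightarrow> seminorm_bound N \<phi> B \<Longrightarrow> norm (T \<phi>) \<le> C * B" by metis
  show ?thesis
  proof (rule functional_family_continuous[OF K _ bdd C(1)])
    show "dist (T f) (T h) \<le> C * B" if "f \<in> schwartz" "h \<in> schwartz" "seminorm_bound N (\<lambda>y. f y - h y) B" for f h B
      using C(2)[OF schwartz_diff that(3)] that by (simp add: dist_norm tempered_diff[OF T])
  qed (rule cont)
qed

lemma schwartz_norm_family_continuous: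
  fixes K :: "'b::euclidean_space \<Rightarrow> 'a::euclidean_space \<Rightarrow> complex"
  assumes K: "\<And>z. K z \<in> schwartz"
    and cont: "\<And>bs. set bs \<subseteq> Basis \<Longrightarrow> continuous_on UNIV (\<lambda>(z, y). partial_derivs bs (K z) y)"
    and bdd: "\<And>N r. \<exists>C. \<forall>z. norm z \<le> r \<longrightarrow> seminorm_bound N (K z) C"
  shows "continuous_on UNIV (\<lambda>z. schwartz_norm N (K z))"
proof -
  define C where "C = real (card {bs. set bs \<subseteq> (Basis :: 'a set) \<and> length bs \<le> N})"
  have le: "schwartz_norm N f \<le> schwartz_norm N h + C * B"
    if "f \<in> schwartz" "h \<in> schwartz" "seminorm_bound N (\<lambda>y. f y - h y) B" for f h :: "'a \<Rightarrow> complex" and B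
    using schwartz_norm_triangle[OF schwartz_diff[OF that(1,2)] that(2), of N] schwartz_norm_le[OF that(3), folded C_def] by simp
  show ?thesis
  proof (rule functional_family_continuous[OF K _ bdd])
    show "0 \<le> C" by (simp add: C_def)
    fix f h :: "'a \<Rightarrow> complex" and B assume *: "f \<in> schwartz" "h \<in> schwartz" "seminorm_bound N (\<lambda>y. f y - h y) B"
    have "seminorm_bound N (\<lambda>y. (-1) * (f y - h y)) B"
      by (rule seminorm_bound_cmult[OF *(3) schwartz_smooth[OF schwartz_diff[OF *(1,2)]]]) simp
    then show "dist (schwartz_norm N f) (schwartz_norm N h) \<le> C * B"
      using le[OF *] le[OF *(2,1), of B] by (simp add: dist_real_def abs_le_iff)
  qed (rule cont)
qed

text \<open>The substitute for integrability with values in the Schwartz space: every seminorm of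
  \<open>K z\<close> decays faster than any power of the parameter, and joint continuity of all
  derivatives supplies measurability.\<close>

definition schwartz_family :: "('b::euclidean_space \<Rightarrow> 'a::euclidean_space \<Rightarrow> complex) \<Rightarrow> bool" where
  "schwartz_family K \<longleftrightarrow> (\<forall>z. K z \<in> schwartz) \<and>
     (\<forall>bs. set bs \<subseteq> Basis \<longrightarrow> continuous_on UNIV (\<lambda>(z, y). partial_derivs bs (K z) y)) \<and>
     (\<forall>N M. \<exists>C. \<forall>z. seminorm_bound N (K z) (C / (1 + norm z) ^ M))"

lemma schwartz_familyD:
  assumes "schwartz_family K"
  shows "K z \<in> schwartz" "set bs \<subseteq> Basis \<Longrightarrow> continuous_on UNIV (\<lambda>(z, y). partial_derivs bs (K z) y)"
    "\<exists>C\<ge>0. \<forall>z. seminorm_bound N (K z) (C / (1 + norm z) ^ M)"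
    "\<exists>C. \<forall>z. norm z \<le> r \<longrightarrow> seminorm_bound N (K z) C"
proof -
  show "K z \<in> schwartz" "set bs \<subseteq> Basis \<Longrightarrow> continuous_on UNIV (\<lambda>(z, y). partial_derivs bs (K z) y)"
    using assms by (auto simp: schwartz_family_def)
  obtain C where C: "\<And>z. seminorm_bound N (K z) (C / (1 + norm z) ^ M)"
    using assms unfolding schwartz_family_def by blast
  have "0 \<le> C" using seminorm_bound_nonneg[OF C[of 0]] by simp
  with C show "\<exists>C\<ge>0. \<forall>z. seminorm_bound N (K z) (C / (1 + norm z) ^ M)" by blast
  obtain C where "\<And>z. seminorm_bound N (K z) (C / (1 + norm z) ^ 0)"
    using assms unfolding schwartz_family_def by blast
  then show "\<exists>C. \<forall>z. norm z \<le> r \<longrightarrow> seminorm_bound N (K z) C" by auto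
qed

lemma schwartz_family_continuous:
  fixes K :: "'b::euclidean_space \<Rightarrow> 'a::euclidean_space \<Rightarrow> complex"
  assumes "schwartz_family K" "set bs \<subseteq> Basis" "continuous_on A \<alpha>" "continuous_on A \<gamma>"
  shows "continuous_on A (\<lambda>q. partial_derivs bs (K (\<alpha> q)) (\<gamma> q))"
  using continuous_on_compose2[OF schwartz_familyD(2)[OF assms(1,2)] continuous_on_Pair[OF assms(3,4)]] by simp

lemma schwartz_family_integrable:
  fixes K :: "'b::euclidean_space \<Rightarrow> 'a::euclidean_space \<Rightarrow> complex"
  assumes "schwartz_family K" "set bs \<subseteq> Basis"
  shows "integrable lborel (\<lambda>z. partial_derivs bs (K z) y)"
proof -
  obtain C where C: "\<And>z. seminorm_bound (length bs) (K z) (C / (1 + norm z) ^ (2 * DIM('b)))"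
    using schwartz_familyD(3)[OF assms(1)] by blast
  show ?thesis
  proof (rule integrable_decay)
    show "(\<lambda>z. partial_derivs bs (K z) y) \<in> borel_measurable lborel"
      using schwartz_family_continuous[OF assms continuous_on_id continuous_on_const] by (simp add: borel_measurable_continuous_onI)
    show "norm (partial_derivs bs (K z) y) \<le> C / (1 + norm z) ^ (2 * DIM('b))" for z
      by (rule seminorm_bound_le_const[OF C assms(2)]) simp
  qed
qed

lemma partial_derivs_integral_family:
  fixes K :: "'b::euclidean_space \<Rightarrow> 'a::euclidean_space \<Rightarrow> complex"
  assumes K: "schwartz_family K"
  shows "set bs \<subseteq> Basis \<Longrightarrow> partial_derivs bs (\<lambda>y. \<integral>z. K z y \<partial>lborel) = (\<lambda>y. \<integral>z. partial_derivs bs (K z) y \<partial>lborel)"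
    and "smooth (\<lambda>y. \<integral>z. K z y \<partial>lborel)"
proof -
  have der: "((\<lambda>y. \<integral>z. partial_derivs bs (K z) y \<partial>lborel) has_derivative
    (\<lambda>h. \<integral>z. frechet_derivative (partial_derivs bs (K z)) (at y) h \<partial>lborel)) (at y)"
    if bs: "set bs \<subseteq> Basis" for bs y
  proof -
    obtain C where C: "\<And>z. seminorm_bound (Suc (length bs)) (K z) (C / (1 + norm z) ^ (2 * DIM('b)))"
      using schwartz_familyD(3)[OF K] by blast
    show ?thesis
    proof (rule has_derivative_lebesgue_integral[where g="\<lambda>z. C * (1 / (1 + norm z) ^ (2 * DIM('b)))"])
      show "integrable lborel (\<lambda>z. partial_derivs bs (K z) y)" for y
        by (rule schwartz_family_integrable[OF K bs])
      show "(partial_derivs bs (K w) has_derivative frechet_derivative (partial_derivs bs (K w)) (at y)) (at y)" for w y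
        by (intro smooth_has_derivative schwartz_smooth schwartz_familyD(1)[OF K] bs)
      fix y b :: 'a assume b: "b \<in> Basis"
      then have bbs: "set (b # bs) \<subseteq> Basis" using bs by simp
      show "norm (frechet_derivative (partial_derivs bs (K w)) (at y) b) \<le> C * (1 / (1 + norm w) ^ (2 * DIM('b)))" for w
        using seminorm_bound_le_const[OF C bbs, of w y] by simp
      show "(\<lambda>w. frechet_derivative (partial_derivs bs (K w)) (at y) b) \<in> borel_measurable lborel"
        using borel_measurable_integrable[OF schwartz_family_integrable[OF K bbs, of y]] by simp
    qed (intro integrable_mult_right integrable_inverse_power_norm)
  qed
  show *: "partial_derivs bs (\<lambda>y. \<integral>z. K z y \<partial>lborel) = (\<lambda>y. \<integral>z. partial_derivs bs (K z) y \<partial>lborel)"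
    if "set bs \<subseteq> Basis" for bs
    using that
  proof (induction bs)
    case (Cons b bs)
    then have IH: "partial_derivs bs (\<lambda>y. \<integral>z. K z y \<partial>lborel) = (\<lambda>y. \<integral>z. partial_derivs bs (K z) y \<partial>lborel)" and bs: "set bs \<subseteq> Basis" by auto
    have "partial_derivs (b # bs) (\<lambda>y. \<integral>z. K z y \<partial>lborel) = (\<lambda>y. \<integral>z. frechet_derivative (partial_derivs bs (K z)) (at y) b \<partial>lborel)"
      by (rule partial_derivs_Cons_eqI) (unfold IH, rule der[OF bs])
    then show ?case by simp
  qed simp
  show "smooth (\<lambda>y. \<integral>z. K z y \<partial>lborel)"
    unfolding smooth_def
  proof (intro allI impI)
    fix bs :: "'a list" and x assume bs: "set bs \<subseteq> Basis"
    show "partial_derivs bs (\<lambda>y. \<integral>z. K z y \<partial>lborel) differentiable at x"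
      unfolding *[OF bs] using der[OF bs] differentiable_def by blast
  qed
qed

lemma seminorm_bound_integral_family:
  fixes K :: "'b::euclidean_space \<Rightarrow> 'a::euclidean_space \<Rightarrow> complex"
  assumes K: "schwartz_family K" and w: "\<And>z. seminorm_bound N (K z) (w z)" "integrable lborel w"
  shows "seminorm_bound N (\<lambda>y. \<integral>z. K z y \<partial>lborel) (\<integral>z. w z \<partial>lborel)"
  unfolding seminorm_bound_def
proof (intro allI impI)
  fix bs :: "'a list" and y assume bs: "set bs \<subseteq> Basis" "length bs \<le> N"
  have "(1 + norm y) ^ N * norm (\<integral>z. partial_derivs bs (K z) y \<partial>lborel)
    = norm (\<integral>z. (1 + norm y) ^ N *\<^sub>R partial_derivs bs (K z) y \<partial>lborel)" by simp
  also have "\<dots> \<le> (\<integral>z. w z \<partial>lborel)"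
  proof (rule norm_integral_le)
    show "norm ((1 + norm y) ^ N *\<^sub>R partial_derivs bs (K z) y) \<le> w z" for z
      using seminorm_boundD[OF w(1)[of z] bs, of y] by simp
  qed (auto intro!: integrable_scaleR_right schwartz_family_integrable[OF K bs(1)] w(2))
  finally show "(1 + norm y) ^ N * norm (partial_derivs bs (\<lambda>y. \<integral>z. K z y \<partial>lborel) y) \<le> (\<integral>z. w z \<partial>lborel)"
    unfolding partial_derivs_integral_family(1)[OF K bs(1)] .
qed

lemma schwartz_integral_family:
  fixes K :: "'b::euclidean_space \<Rightarrow> 'a::euclidean_space \<Rightarrow> complex"
  assumes K: "schwartz_family K"
  shows "(\<lambda>y. \<integral>z. K z y \<partial>lborel) \<in> schwartz"
proof (rule schwartzI)
  show "smooth (\<lambda>y. \<integral>z. K z y \<partial>lborel)" by (rule partial_derivs_integral_family(2)[OF K])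
  fix N
  obtain C where "\<And>z. seminorm_bound N (K z) (C / (1 + norm z) ^ (2 * DIM('b)))"
    using schwartz_familyD(3)[OF K] by blast
  then have "\<And>z. seminorm_bound N (K z) (C * (1 / (1 + norm z) ^ (2 * DIM('b))))" by simp
  from seminorm_bound_integral_family[OF K this]
  show "\<exists>B. seminorm_bound N (\<lambda>y. \<integral>z. K z y \<partial>lborel) B"
    using integrable_mult_right[OF integrable_inverse_power_norm] by blast
qed

subsection \<open>Quadrature\<close>

text \<open>A displacement of length at most 1 changes a weight of order M by at most the factor
  2^M. It controls rounding errors in the quadrature and the difference quotients of Schwartz
  functions.\<close>

lemma inverse_power_norm_shift:
  fixes x y :: "'a::real_normed_vector"
  assumes "norm (x - y) \<le> 1"
  shows "1 / (1 + norm x) ^ M \<le> 2 ^ M / (1 + norm y) ^ M"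
proof -
  have "norm y \<le> norm x + norm (x - y)" using norm_triangle_ineq4[of x "x - y"] by simp
  moreover have "u \<le> v + d \<Longrightarrow> d \<le> 1 \<Longrightarrow> 0 \<le> v \<Longrightarrow> 1 + u \<le> 2 * (1 + v)" for u v d :: real by simp
  ultimately have "1 + norm y \<le> 2 * (1 + norm x)" using assms norm_ge_zero by blast
  then have "(1 + norm y) ^ M \<le> 2 ^ M * (1 + norm x) ^ M"
    by (subst power_mult_distrib[symmetric]) (rule power_mono, auto)
  then show ?thesis by (simp add: field_simps add_pos_nonneg)
qed

text \<open>One sequence of finite weighted point sets approximates the integrals of all families at
  once, in every Schwartz seminorm; continuous linear maps therefore commute with these integrals.\<close>

lemma quadrature:
  "\<exists>(S :: nat \<Rightarrow> 'b::euclidean_space set) (m :: nat \<Rightarrow> 'b \<Rightarrow> real). (\<forall>n. finite (S n)) \<and>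
     (\<forall>(K :: 'b \<Rightarrow> 'a::euclidean_space \<Rightarrow> complex) N. schwartz_family K \<longrightarrow>
       (\<lambda>n. schwartz_norm N (\<lambda>y. (\<Sum>c\<in>S n. of_real (m n c) * K c y) - (\<integral>z. K z y \<partial>lborel))) \<longlonglongrightarrow> 0) \<and>
     (\<forall>(h :: 'b \<Rightarrow> complex) C. continuous_on UNIV h \<longrightarrow> (\<forall>z. norm (h z) \<le> C / (1 + norm z) ^ (2 * DIM('b))) \<longrightarrow>
       (\<lambda>n. \<Sum>c\<in>S n. of_real (m n c) * h c) \<longlonglongrightarrow> (\<integral>z. h z \<partial>lborel))"
proof -
  \<comment> \<open>Simple functions converging to the identity: \<open>F n\<close> rounds every
    point to one of finitely many nodes.\<close>
  obtain F :: "nat \<Rightarrow> 'b \<Rightarrow> 'b" where F: "\<And>n. simple_function lborel (F n)" "\<And>z. (\<lambda>n. F n z) \<longlonglongrightarrow> z"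
    using borel_measurable_implies_sequence_metric[of "\<lambda>x. x" "lborel :: 'b measure" 0] by auto
  have Fm[measurable]: "F n \<in> borel_measurable borel" for n
    using borel_measurable_simple_function[OF F(1)[of n]] by simp
  \<comment> \<open>Points that are moved by more than 1 are discarded. Each remaining cell lies in
    a unit ball, so its measure is a finite weight, and decay at the node is comparable with decay
    at z, which provides the dominating functions.\<close>
  define A where "A n = {z. dist (F n z) z \<le> 1}" for n
  define S where "S n = range (F n)" for n
  define m where "m n c = measure lborel {z \<in> A n. F n z = c}" for n c
  have A[measurable]: "A n \<in> sets borel" for n unfolding A_def by measurable
  have S: "finite (S n)" for n using F(1)[of n] by (simp add: S_def simple_function_def)
  have evA: "\<forall>\<^sub>F n in sequentially. z \<in> A n" for z
    using tendstoD[OF F(2)[of z], of 1] by (auto simp: A_def elim!: eventually_mono)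
  have FA: "1 / (1 + norm (F n z)) ^ M \<le> 2 ^ M / (1 + norm z) ^ M" if "z \<in> A n" for n z M
    using that by (intro inverse_power_norm_shift) (simp add: A_def dist_norm)
  have fin: "emeasure lborel {z \<in> A n. F n z = c} < \<infinity>" for n c
  proof -
    have "emeasure lborel {z \<in> A n. F n z = c} \<le> emeasure lborel (cball c 1)"
      by (intro emeasure_mono) (auto simp: A_def)
    also have "\<dots> < \<infinity>" by (rule emeasure_bounded_finite) simp
    finally show ?thesis .
  qed
  have sum_eq: "(\<Sum>c\<in>S n. of_real (m n c) * h c) = (\<integral>z. indicator (A n) z *\<^sub>R h (F n z) \<partial>lborel)"
    and int: "integrable lborel (\<lambda>z. indicator (A n) z *\<^sub>R h (F n z))" for h :: "'b \<Rightarrow> complex" and n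
  proof -
    have eq: "indicator (A n) z *\<^sub>R h (F n z) = (\<Sum>c\<in>S n. indicator {z \<in> A n. F n z = c} z *\<^sub>R h c)" for z
    proof -
      have "(\<Sum>c\<in>S n. indicator {z \<in> A n. F n z = c} z *\<^sub>R h c) = (\<Sum>c\<in>S n. if c = F n z then indicator (A n) z *\<^sub>R h c else 0)"
        by (intro sum.cong) (auto simp: indicator_def)
      then show ?thesis using S by (simp add: S_def)
    qed
    have i: "integrable lborel (\<lambda>z. indicator {z \<in> A n. F n z = c} z *\<^sub>R h c)" for c
      by (intro integrable_scaleR_left integrable_real_indicator) (use fin[of n c] in auto)
    show "integrable lborel (\<lambda>z. indicator (A n) z *\<^sub>R h (F n z))"
      unfolding eq using i by (intro Bochner_Integration.integrable_sum)
    have "(\<integral>z. indicator (A n) z *\<^sub>R h (F n z) \<partial>lborel) = (\<Sum>c\<in>S n. \<integral>z. indicator {z \<in> A n. F n z = c} z *\<^sub>R h c \<partial>lborel)"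
      unfolding eq using i by (intro Bochner_Integration.integral_sum)
    also have "\<dots> = (\<Sum>c\<in>S n. of_real (m n c) * h c)"
      using fin[of n] by (intro sum.cong refl) (subst integral_scaleR_left, auto simp: m_def scaleR_conv_of_real intro: integrable_real_indicator)
    finally show "(\<Sum>c\<in>S n. of_real (m n c) * h c) = (\<integral>z. indicator (A n) z *\<^sub>R h (F n z) \<partial>lborel)" by simp
  qed
  show ?thesis
  proof (intro exI[of _ S] exI[of _ m] conjI allI impI)
    show "finite (S n)" for n by (rule S)
    fix h :: "'b \<Rightarrow> complex" and C
    assume h: "continuous_on UNIV h" "\<forall>z. norm (h z) \<le> C / (1 + norm z) ^ (2 * DIM('b))"
    have hm[measurable]: "h \<in> borel_measurable borel" using h by (simp add: borel_measurable_continuous_onI)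
    have C: "0 \<le> C" using h(2)[rule_format, of 0] order_trans[OF norm_ge_zero] by simp
    show "(\<lambda>n. \<Sum>c\<in>S n. of_real (m n c) * h c) \<longlonglongrightarrow> (\<integral>z. h z \<partial>lborel)"
      unfolding sum_eq
    proof (rule integral_dominated_convergence[where w="\<lambda>z. C * 2 ^ (2 * DIM('b)) * (1 / (1 + norm z) ^ (2 * DIM('b)))"])
      show "AE z in lborel. (\<lambda>n. indicator (A n) z *\<^sub>R h (F n z)) \<longlonglongrightarrow> h z"
      proof (intro AE_I2)
        fix z
        have "(\<lambda>n. h (F n z)) \<longlonglongrightarrow> h z"
          by (rule continuous_on_tendsto_compose[OF h(1) F(2)]) auto
        moreover have "\<forall>\<^sub>F n in sequentially. h (F n z) = indicator (A n) z *\<^sub>R h (F n z)"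
          using evA[of z] by eventually_elim simp
        ultimately show "(\<lambda>n. indicator (A n) z *\<^sub>R h (F n z)) \<longlonglongrightarrow> h z"
          by (rule Lim_transform_eventually)
      qed
      show "AE z in lborel. norm (indicator (A n) z *\<^sub>R h (F n z)) \<le> C * 2 ^ (2 * DIM('b)) * (1 / (1 + norm z) ^ (2 * DIM('b)))" for n
      proof (intro AE_I2)
        fix z
        show "norm (indicator (A n) z *\<^sub>R h (F n z)) \<le> C * 2 ^ (2 * DIM('b)) * (1 / (1 + norm z) ^ (2 * DIM('b)))"
        proof (cases "z \<in> A n")
          case True
          have "norm (h (F n z)) \<le> C * (1 / (1 + norm (F n z)) ^ (2 * DIM('b)))" using h(2) by simp
          also have "\<dots> \<le> C * (2 ^ (2 * DIM('b)) / (1 + norm z) ^ (2 * DIM('b)))"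
            using C FA[OF True] by (intro mult_left_mono)
          finally show ?thesis using True by simp
        qed (use C in simp)
      qed
      show "(\<lambda>z. indicator (A n) z *\<^sub>R h (F n z)) \<in> borel_measurable lborel" for n by measurable
      show "integrable lborel (\<lambda>z :: 'b. C * 2 ^ (2 * DIM('b)) * (1 / (1 + norm z) ^ (2 * DIM('b))))"
        by (intro integrable_mult_right integrable_inverse_power_norm)
    qed simp
  next
    fix K :: "'b \<Rightarrow> 'a \<Rightarrow> complex" and N
    assume K: "schwartz_family K"
    note Ks = schwartz_familyD(1)[OF K]
    let ?D = "\<lambda>n z y. indicator (A n) z * K (F n z) y - K z y"
    define w where "w n z = schwartz_norm N (?D n z)" for n z
    have Ds: "?D n z \<in> schwartz" for n z by (intro schwartz_diff schwartz_cmult Ks)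
    define cc where "cc = real (card {bs. set bs \<subseteq> (Basis :: 'a set) \<and> length bs \<le> N})"
    define M where "M = 2 * DIM('b)"
    obtain C where C: "0 \<le> C" "\<And>z. seminorm_bound N (K z) (C / (1 + norm z) ^ M)"
      using schwartz_familyD(3)[OF K] by blast
    define W where "W z = cc * (C * 2 ^ M + C) * (1 / (1 + norm z) ^ M)" for z :: 'b
    have Wint: "integrable lborel W" unfolding W_def M_def by (intro integrable_mult_right integrable_inverse_power_norm)
    have wW: "w n z \<le> W z" for n z
    proof -
      have 1: "seminorm_bound N (\<lambda>y. indicator (A n) z * K (F n z) y) (C * 2 ^ M / (1 + norm z) ^ M)"
      proof (rule seminorm_bound_cmult[OF C(2)])
        show "norm (indicator (A n) z :: complex) * (C / (1 + norm (F n z)) ^ M) \<le> C * 2 ^ M / (1 + norm z) ^ M"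
        proof (cases "z \<in> A n")
          case True
          have "C * (1 / (1 + norm (F n z)) ^ M) \<le> C * (2 ^ M / (1 + norm z) ^ M)"
            using C FA[OF True] by (intro mult_left_mono)
          then show ?thesis using True by simp
        qed (use C in simp)
      qed (intro schwartz_smooth Ks)
      have 2: "seminorm_bound N (\<lambda>y. (-1) * K z y) (C / (1 + norm z) ^ M)"
        by (rule seminorm_bound_cmult[OF C(2)]) (auto intro: schwartz_smooth Ks)
      have "seminorm_bound N (\<lambda>y. indicator (A n) z * K (F n z) y + (-1) * K z y) (C * 2 ^ M / (1 + norm z) ^ M + C / (1 + norm z) ^ M)"
        by (rule seminorm_bound_add[OF 1 2]) (intro schwartz_smooth schwartz_cmult Ks)+
      from schwartz_norm_le[OF this] show ?thesis
        unfolding w_def W_def cc_def by (simp add: add_divide_distrib distrib_left)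
    qed
    have w0: "0 \<le> w n z" for n z unfolding w_def by (rule schwartz_norm_nonneg[OF Ds])
    \<comment> \<open>Continuity of the seminorm of \<open>K a - K b\<close> in the pair (a, b)
      serves twice: for the measurability of \<open>w n\<close> and for its pointwise limit
      0.\<close>
    let ?K2 = "\<lambda>p y. K (fst p) y - K (snd p) y"
    have P: "continuous_on UNIV (\<lambda>p :: 'b \<times> 'b. schwartz_norm N (?K2 p))"
    proof (rule schwartz_norm_family_continuous)
      show "?K2 p \<in> schwartz" for p by (intro schwartz_diff Ks)
      fix bs :: "'a list" assume bs: "set bs \<subseteq> Basis"
      have "partial_derivs bs (?K2 p) = (\<lambda>y. partial_derivs bs (K (fst p)) y - partial_derivs bs (K (snd p)) y)" for p
        using partial_derivs_lincomb[OF Ks[THEN schwartz_smooth] Ks[THEN schwartz_smooth] bs, of 1 "fst p" "-1" "snd p"] by simp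
      moreover have "continuous_on UNIV (\<lambda>q. partial_derivs bs (K (fst (fst q))) (snd q) - partial_derivs bs (K (snd (fst q))) (snd q))"
        by (intro continuous_on_diff schwartz_family_continuous[OF K bs] continuous_on_fst continuous_on_snd continuous_on_id)
      ultimately show "continuous_on UNIV (\<lambda>(p, y). partial_derivs bs (?K2 p) y)" by (simp add: case_prod_beta)
    next
      fix N :: nat and r :: real
      obtain C where C: "\<And>z. norm z \<le> r \<Longrightarrow> seminorm_bound N (K z) C" using schwartz_familyD(4)[OF K] by blast
      have "seminorm_bound N (\<lambda>y. K (fst p) y + (-1) * K (snd p) y) (C + C)" if p: "norm p \<le> r" for p
      proof (rule seminorm_bound_add)
        show "seminorm_bound N (K (fst p)) C" using p norm_fst_le[of "fst p" "snd p"] by (intro C) auto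
        show "seminorm_bound N (\<lambda>y. (-1) * K (snd p) y) C"
        proof (rule seminorm_bound_cmult)
          show "seminorm_bound N (K (snd p)) C" using p norm_snd_le[of "snd p" "fst p"] by (intro C) auto
        qed (auto intro: schwartz_smooth Ks)
      qed (intro schwartz_smooth schwartz_cmult Ks)+
      then show "\<exists>C. \<forall>p. norm p \<le> r \<longrightarrow> seminorm_bound N (?K2 p) C"
        by (intro exI[of _ "C + C"] allI impI) simp
    qed
    \<comment> \<open>Off \<open>A n\<close> the rounded term is 0 and the error is the family
      itself up to sign.\<close>
    have P0: "continuous_on UNIV (\<lambda>z. schwartz_norm N (\<lambda>y. - K z y))"
    proof (rule schwartz_norm_family_continuous)
      show "(\<lambda>y. - K z y) \<in> schwartz" for z using schwartz_cmult[OF Ks, of "-1" z] by simp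
      fix bs :: "'a list" assume bs: "set bs \<subseteq> Basis"
      have "partial_derivs bs (\<lambda>y. - K z y) = (\<lambda>y. - partial_derivs bs (K z) y)" for z
        using partial_derivs_lincomb[OF Ks[THEN schwartz_smooth] Ks[THEN schwartz_smooth] bs, of "-1" z 0 z] by simp
      then show "continuous_on UNIV (\<lambda>(z, y). partial_derivs bs (\<lambda>y. - K z y) y)"
        using schwartz_familyD(2)[OF K bs] by (simp add: case_prod_beta continuous_on_minus)
    next
      fix N :: nat and r :: real
      obtain C where C: "\<And>z. norm z \<le> r \<Longrightarrow> seminorm_bound N (K z) C" using schwartz_familyD(4)[OF K] by blast
      have "seminorm_bound N (\<lambda>y. (-1) * K z y) C" if "norm z \<le> r" for z
        by (rule seminorm_bound_cmult[OF C[OF that]]) (auto intro: schwartz_smooth Ks)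
      then show "\<exists>C. \<forall>z. norm z \<le> r \<longrightarrow> seminorm_bound N (\<lambda>y. - K z y) C"
        by (intro exI[of _ C] allI impI) simp
    qed
    have weq: "w n z = (if z \<in> A n then schwartz_norm N (?K2 (F n z, z)) else schwartz_norm N (\<lambda>y. - K z y))" for n z
      by (simp add: w_def)
    have wm: "w n \<in> borel_measurable lborel" for n
    proof -
      have [measurable]: "(\<lambda>z. schwartz_norm N (?K2 (F n z, z))) \<in> borel_measurable borel"
        by (rule borel_measurable_continuous_Pair[where H="\<lambda>a b. schwartz_norm N (?K2 (a, b))"]) (use P in auto)
      have [measurable]: "(\<lambda>z. schwartz_norm N (\<lambda>y. - K z y)) \<in> borel_measurable borel"
        using P0 by (rule borel_measurable_continuous_onI)
      show ?thesis unfolding weq by measurable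
    qed
    have wint: "integrable lborel (w n)" for n
    proof (rule Bochner_Integration.integrable_bound[OF Wint wm])
      show "AE z in lborel. norm (w n z) \<le> norm (W z)"
        using w0[of n] wW[of n] by (intro AE_I2) (metis abs_of_nonneg order_trans real_norm_def)
    qed
    have "(\<lambda>n. \<integral>z. w n z \<partial>lborel) \<longlonglongrightarrow> (\<integral>z. 0 \<partial>(lborel :: 'b measure))"
    proof (rule integral_dominated_convergence[OF _ wm Wint])
      show "AE z in lborel. (\<lambda>n. w n z) \<longlonglongrightarrow> 0"
      proof (intro AE_I2)
        fix z
        have "(\<lambda>n. (F n z, z)) \<longlonglongrightarrow> (z, z)" by (intro tendsto_intros F)
        from continuous_on_tendsto_compose[OF P this]
        have a: "(\<lambda>n. schwartz_norm N (?K2 (F n z, z))) \<longlonglongrightarrow> schwartz_norm N (\<lambda>y :: 'a. 0)" by simp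
        have b: "schwartz_norm N (\<lambda>y :: 'a. 0) = 0"
        proof -
          have "partial_derivs bs (\<lambda>y. 0) = (\<lambda>y :: 'a. 0)" for bs by (induction bs) auto
          then show ?thesis by (simp add: schwartz_norm_def)
        qed
        have c: "\<forall>\<^sub>F n in sequentially. schwartz_norm N (?K2 (F n z, z)) = w n z"
          using evA[of z] by eventually_elim (simp add: weq)
        show "(\<lambda>n. w n z) \<longlonglongrightarrow> 0" by (rule Lim_transform_eventually[OF a[unfolded b] c])
      qed
      show "AE z in lborel. norm (w n z) \<le> W z" for n using w0 wW by simp
    qed simp
    then have "(\<lambda>n. \<integral>z. w n z \<partial>lborel) \<longlonglongrightarrow> 0" by simp
    from tendsto_mult_right_zero[OF this, of cc]
    have lim: "(\<lambda>n. cc * (\<integral>z. w n z \<partial>lborel)) \<longlonglongrightarrow> 0" .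
    have bound: "seminorm_bound N (\<lambda>y. (\<Sum>c\<in>S n. of_real (m n c) * K c y) - (\<integral>z. K z y \<partial>lborel)) (\<integral>z. w n z \<partial>lborel)" for n
      unfolding seminorm_bound_def
    proof (intro allI impI)
      fix bs :: "'a list" and y assume bs: "set bs \<subseteq> Basis" "length bs \<le> N"
      have "partial_derivs bs (\<lambda>y. 1 * (\<Sum>c\<in>S n. of_real (m n c) * K c y) + (-1) * (\<integral>z. K z y \<partial>lborel)) y
        = 1 * partial_derivs bs (\<lambda>y. \<Sum>c\<in>S n. of_real (m n c) * K c y) y + (-1) * partial_derivs bs (\<lambda>y. \<integral>z. K z y \<partial>lborel) y"
        by (subst partial_derivs_lincomb[OF smooth_sum[OF S schwartz_smooth[OF Ks]] partial_derivs_integral_family(2)[OF K] bs(1)]) simp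
      also have "\<dots> = (\<Sum>c\<in>S n. of_real (m n c) * partial_derivs bs (K c) y) - (\<integral>z. partial_derivs bs (K z) y \<partial>lborel)"
        unfolding partial_derivs_integral_family(1)[OF K bs(1)]
        by (subst partial_derivs_sum[OF S schwartz_smooth[OF Ks] bs(1)]) simp
      also have "\<dots> = (\<integral>z. indicator (A n) z *\<^sub>R partial_derivs bs (K (F n z)) y - partial_derivs bs (K z) y \<partial>lborel)"
        unfolding sum_eq by (intro Bochner_Integration.integral_diff[symmetric] int schwartz_family_integrable[OF K bs(1)])
      finally have eq: "partial_derivs bs (\<lambda>y. (\<Sum>c\<in>S n. of_real (m n c) * K c y) - (\<integral>z. K z y \<partial>lborel)) y
        = (\<integral>z. indicator (A n) z *\<^sub>R partial_derivs bs (K (F n z)) y - partial_derivs bs (K z) y \<partial>lborel)" by simp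
      have pw: "(1 + norm y) ^ N * norm (indicator (A n) z *\<^sub>R partial_derivs bs (K (F n z)) y - partial_derivs bs (K z) y) \<le> w n z" for z
      proof -
        have "partial_derivs bs (?D n z) y = indicator (A n) z *\<^sub>R partial_derivs bs (K (F n z)) y - partial_derivs bs (K z) y"
          using partial_derivs_lincomb[OF Ks[THEN schwartz_smooth] Ks[THEN schwartz_smooth] bs(1), of "indicator (A n) z" "F n z" "-1" z]
          by (simp add: indicator_def)
        then show ?thesis
          using seminorm_boundD[OF seminorm_bound_schwartz_norm[OF Ds] bs, of y n z] by (simp add: w_def)
      qed
      have "(1 + norm y) ^ N * norm (\<integral>z. indicator (A n) z *\<^sub>R partial_derivs bs (K (F n z)) y - partial_derivs bs (K z) y \<partial>lborel)
        = norm (\<integral>z. (1 + norm y) ^ N *\<^sub>R (indicator (A n) z *\<^sub>R partial_derivs bs (K (F n z)) y - partial_derivs bs (K z) y) \<partial>lborel)"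
        by simp
      also have "\<dots> \<le> (\<integral>z. w n z \<partial>lborel)"
      proof (rule norm_integral_le[OF _ wint])
        show "norm ((1 + norm y) ^ N *\<^sub>R (indicator (A n) z *\<^sub>R partial_derivs bs (K (F n z)) y - partial_derivs bs (K z) y)) \<le> w n z" for z
          using pw[of z] by simp
      qed (intro integrable_scaleR_right Bochner_Integration.integrable_diff int schwartz_family_integrable[OF K bs(1)])
      finally show "(1 + norm y) ^ N * norm (partial_derivs bs (\<lambda>y. (\<Sum>c\<in>S n. of_real (m n c) * K c y) - (\<integral>z. K z y \<partial>lborel)) y)
        \<le> (\<integral>z. w n z \<partial>lborel)" unfolding eq .
    qed
    show "(\<lambda>n. schwartz_norm N (\<lambda>y. (\<Sum>c\<in>S n. of_real (m n c) * K c y) - (\<integral>z. K z y \<partial>lborel))) \<longlonglongrightarrow> 0"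
    proof (rule tendsto_sandwich[OF _ _ tendsto_const lim])
      show "\<forall>\<^sub>F n in sequentially. 0 \<le> schwartz_norm N (\<lambda>y. (\<Sum>c\<in>S n. of_real (m n c) * K c y) - (\<integral>z. K z y \<partial>lborel))"
        by (intro always_eventually allI schwartz_norm_nonneg schwartz_diff schwartz_sum S Ks schwartz_integral_family[OF K])
      show "\<forall>\<^sub>F n in sequentially. schwartz_norm N (\<lambda>y. (\<Sum>c\<in>S n. of_real (m n c) * K c y) - (\<integral>z. K z y \<partial>lborel)) \<le> cc * (\<integral>z. w n z \<partial>lborel)"
        using schwartz_norm_le[OF bound] by (intro always_eventually allI) (simp add: cc_def)
    qed
  qed
qed

text \<open>T is linear on the quadrature sums and continuous in one seminorm, so it sends them to T
  of the integral. The same nodes and weights applied to the scalar function z |-> T (K z) converge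
  to the integral on the right.\<close>

lemma tempered_integral_family:
  fixes K :: "'b::euclidean_space \<Rightarrow> 'a::euclidean_space \<Rightarrow> complex"
  assumes T: "tempered T" and K: "schwartz_family K"
  shows "T (\<lambda>y. \<integral>z. K z y \<partial>lborel) = (\<integral>z. T (K z) \<partial>lborel)"
    and "integrable lborel (\<lambda>z. T (K z))"
proof -
  obtain S :: "nat \<Rightarrow> 'b set" and m where S: "\<forall>n. finite (S n)"
    and q1: "\<forall>(K :: 'b \<Rightarrow> 'a \<Rightarrow> complex) N. schwartz_family K \<longrightarrow>
      (\<lambda>n. schwartz_norm N (\<lambda>y. (\<Sum>c\<in>S n. of_real (m n c) * K c y) - (\<integral>z. K z y \<partial>lborel))) \<longlonglongrightarrow> 0"
    and q2: "\<forall>(h :: 'b \<Rightarrow> complex) C. continuous_on UNIV h \<longrightarrow> (\<forall>z. norm (h z) \<le> C / (1 + norm z) ^ (2 * DIM('b))) \<longrightarrow>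
      (\<lambda>n. \<Sum>c\<in>S n. of_real (m n c) * h c) \<longlonglongrightarrow> (\<integral>z. h z \<partial>lborel)"
    using quadrature[where ?'a='a and ?'b='b] by (elim exE conjE) (rule that)
  note S = S[rule_format] and q1 = q1[rule_format] and q2 = q2[rule_format]
  note Ks = schwartz_familyD(1)[OF K]
  obtain C N where C: "0 \<le> C" "\<And>\<phi> B. \<phi> \<in> schwartz \<Longrightarrow> seminorm_bound N \<phi> B \<Longrightarrow> norm (T \<phi>) \<le> C * B"
    using tempered_bound[OF T] by metis
  obtain E where E: "\<And>z. seminorm_bound N (K z) (E / (1 + norm z) ^ (2 * DIM('b)))"
    using schwartz_familyD(3)[OF K] by blast
  have cont: "continuous_on UNIV (\<lambda>z. T (K z))"
    by (rule tempered_family_continuous[OF Ks _ _ T]) (auto intro: schwartz_familyD[OF K])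
  have dec: "norm (T (K z)) \<le> C * E / (1 + norm z) ^ (2 * DIM('b))" for z
    using C(2)[OF Ks E, of z] by simp
  show "integrable lborel (\<lambda>z. T (K z))"
    by (rule integrable_decay[OF _ dec]) (use cont in \<open>simp add: borel_measurable_continuous_onI\<close>)
  let ?Q = "\<lambda>n y. \<Sum>c\<in>S n. of_real (m n c) * K c y"
  let ?I = "\<lambda>y. \<integral>z. K z y \<partial>lborel"
  have Is: "?I \<in> schwartz" by (rule schwartz_integral_family[OF K])
  have Qs: "?Q n \<in> schwartz" for n by (intro schwartz_sum S Ks)
  have a: "(\<lambda>n. C * schwartz_norm N (\<lambda>y. ?Q n y - ?I y)) \<longlonglongrightarrow> 0"
    using tendsto_mult_right_zero[OF q1[OF K, of N]] by simp
  have b: "norm (T (?Q n) - T ?I) \<le> C * schwartz_norm N (\<lambda>y. ?Q n y - ?I y)" for n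
    using C(2)[OF schwartz_diff[OF Qs Is] seminorm_bound_schwartz_norm[OF schwartz_diff[OF Qs Is]], of n]
    by (simp add: tempered_diff[OF T Qs Is])
  have "(\<lambda>n. T (?Q n) - T ?I) \<longlonglongrightarrow> 0"
    by (rule Lim_null_comparison[OF always_eventually[OF allI[OF b]] a])
  then have lim: "(\<lambda>n. T (?Q n)) \<longlonglongrightarrow> T ?I" by (rule LIM_zero_cancel)
  have "T (?Q n) = (\<Sum>c\<in>S n. of_real (m n c) * T (K c))" for n
    by (rule tempered_sum[OF T S Ks])
  from LIMSEQ_unique[OF lim[unfolded this] q2[OF cont dec]]
  show "T ?I = (\<integral>z. T (K z) \<partial>lborel)" .
qed

text \<open>The source of all families in use: rapidly decaying coefficients and packets whose
  centres grow at most linearly, as translations, reflections and rotations of phase space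
  do.\<close>

lemma schwartz_family_wave_packet:
  fixes \<alpha> \<beta> :: "'b::euclidean_space \<Rightarrow> 'a::euclidean_space" and c :: "'b \<Rightarrow> complex"
  assumes f: "f \<in> schwartz" and cont: "continuous_on UNIV c" "continuous_on UNIV \<alpha>" "continuous_on UNIV \<beta>"
    and dec: "\<And>M. \<exists>C. \<forall>z. norm (c z) \<le> C / (1 + norm z) ^ M"
    and lin: "\<And>z. norm (\<alpha> z) \<le> L * (1 + norm z)" "\<And>z. norm (\<beta> z) \<le> L * (1 + norm z)"
  shows "schwartz_family (\<lambda>z y. c z * wave_packet f (\<alpha> z) (\<beta> z) y)"
  unfolding schwartz_family_def
proof (intro conjI allI impI)
  show "(\<lambda>y. c z * wave_packet f (\<alpha> z) (\<beta> z) y) \<in> schwartz" for z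
    by (intro schwartz_cmult schwartz_wave_packet f)
  have sw: "smooth (wave_packet f x \<xi>)" for x \<xi> by (intro smooth_wave_packet schwartz_smooth f)
  fix bs :: "'a list" assume bs: "set bs \<subseteq> Basis"
  have "partial_derivs bs (\<lambda>y. c z * wave_packet f (\<alpha> z) (\<beta> z) y) = (\<lambda>y. c z * partial_derivs bs (wave_packet f (\<alpha> z) (\<beta> z)) y)" for z
    using partial_derivs_lincomb[OF sw sw bs, of "c z" _ _ 0] by simp
  moreover have "continuous_on UNIV (\<lambda>q. c (fst q) * partial_derivs bs (wave_packet f (\<alpha> (fst q)) (\<beta> (fst q))) (snd q))"
    by (intro continuous_on_mult continuous_on_partial_derivs_wave_packet schwartz_smooth f bs continuous_on_snd continuous_on_id
        continuous_on_compose2[OF cont(1)] continuous_on_compose2[OF cont(2)] continuous_on_compose2[OF cont(3)] continuous_on_fst) auto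
  ultimately show "continuous_on UNIV (\<lambda>(z, y). partial_derivs bs (\<lambda>y. c z * wave_packet f (\<alpha> z) (\<beta> z) y) y)"
    by (simp add: case_prod_beta)
next
  fix N M :: nat
  obtain B where B: "seminorm_bound N f B" using schwartz_bound_ex[OF f] by blast
  have B0: "0 \<le> B" using seminorm_bound_nonneg[OF B] .
  \<comment> \<open>The 2 N additional powers pay for the growth of the packet seminorm, N for the
    position and N for the frequency.\<close>
  obtain C where C: "\<And>z. norm (c z) \<le> C / (1 + norm z) ^ (M + 2 * N)" using dec by blast
  have C0: "0 \<le> C" using C[of 0] order_trans[OF norm_ge_zero] by simp
  have L0: "0 \<le> L" using lin(1)[of 0] order_trans[OF norm_ge_zero] by simp
  define D where "D = C * ((4 * pi) ^ N * (1 + L) ^ (2 * N) * B)"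
  have "seminorm_bound N (\<lambda>y. c z * wave_packet f (\<alpha> z) (\<beta> z) y) (D / (1 + norm z) ^ M)" for z
  proof (rule seminorm_bound_cmult[OF seminorm_bound_wave_packet[OF schwartz_smooth[OF f] B]])
    have n: "0 < 1 + norm z" by (simp add: add_pos_nonneg)
    have a: "1 + norm (\<alpha> z) \<le> (1 + L) * (1 + norm z)" "1 + norm (\<beta> z) \<le> (1 + L) * (1 + norm z)"
      using lin[of z] L0 norm_ge_zero[of z] unfolding distrib_left distrib_right by linarith+
    have "((1 + norm (\<alpha> z)) * (1 + norm (\<beta> z))) ^ N \<le> (((1 + L) * (1 + norm z)) * ((1 + L) * (1 + norm z))) ^ N"
      using a L0 by (intro power_mono mult_mono) auto
    also have "\<dots> = (1 + L) ^ (2 * N) * (1 + norm z) ^ (2 * N)"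
      by (simp add: power_mult_distrib power_mult power2_eq_square)
    finally have b: "((1 + norm (\<alpha> z)) * (1 + norm (\<beta> z))) ^ N \<le> (1 + L) ^ (2 * N) * (1 + norm z) ^ (2 * N)" .
    have "norm (c z) * ((4 * pi) ^ N * ((1 + norm (\<alpha> z)) * (1 + norm (\<beta> z))) ^ N * B)
      \<le> C / (1 + norm z) ^ (M + 2 * N) * ((4 * pi) ^ N * ((1 + L) ^ (2 * N) * (1 + norm z) ^ (2 * N)) * B)"
      using B0 C0 L0 by (intro mult_mono C mult_left_mono mult_right_mono b) (auto intro!: mult_nonneg_nonneg zero_le_power)
    also have "\<dots> = D / (1 + norm z) ^ M"
      using n by (simp add: D_def power_add field_simps)
    finally show "norm (c z) * ((4 * pi) ^ N * ((1 + norm (\<alpha> z)) * (1 + norm (\<beta> z))) ^ N * B) \<le> D / (1 + norm z) ^ M" .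
  qed (intro smooth_wave_packet schwartz_smooth f)
  then show "\<exists>C. \<forall>z. seminorm_bound N (\<lambda>y. c z * wave_packet f (\<alpha> z) (\<beta> z) y) (C / (1 + norm z) ^ M)" by blast
qed

subsection \<open>Fourier inversion\<close>

lemma integral_lborel_affine:
  fixes f :: "'a::euclidean_space \<Rightarrow> 'b::{banach, second_countable_topology}"
  assumes [measurable]: "f \<in> borel_measurable borel" and c: "c \<noteq> 0"
  shows "(\<integral>x. f x \<partial>lborel) = \<bar>c\<bar> ^ DIM('a) *\<^sub>R (\<integral>x. f (t + c *\<^sub>R x) \<partial>lborel)"
  by (subst lborel_affine[OF c, of t]) (simp add: integral_density integral_distr)

lemma integrable_lborel_affine:
  fixes f :: "'a::euclidean_space \<Rightarrow> 'b::{banach, second_countable_topology}"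
  assumes "integrable lborel f" and c: "c \<noteq> 0"
  shows "integrable lborel (\<lambda>x. f (t + c *\<^sub>R x))"
proof -
  have [measurable]: "f \<in> borel_measurable borel" using borel_measurable_integrable[OF assms(1)] by simp
  show ?thesis
    using assms(1) unfolding integrable_iff_bounded
    by (simp add: nn_integral_lborel_affine[OF _ c, where f="\<lambda>x. ennreal (norm (f x))"] ennreal_mult_less_top)
qed

text \<open>Lebesgue measure is translation invariant, so all difference quotients have integral 0.
  They are dominated because Schwartz decay is stable under shifts of length at most 1.\<close>

lemma integral_partial_derivs_eq_0:
  fixes f :: "'a::euclidean_space \<Rightarrow> complex"
  assumes f: "f \<in> schwartz" and b: "b \<in> Basis"
  shows "(\<integral>y. partial_derivs [b] f y \<partial>lborel) = 0"
proof -
  define M where "M = 2 * DIM('a)"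
  have M: "1 \<le> M" by (simp add: M_def Suc_leI)
  define C where "C = schwartz_norm M f"
  have C: "seminorm_bound M f C" unfolding C_def by (rule seminorm_bound_schwartz_norm[OF f])
  have C0: "0 \<le> C" using seminorm_bound_nonneg[OF C] .
  define X where "X n = 1 / real (Suc n)" for n
  have X: "0 < X n" "X n \<le> 1" "X \<longlonglongrightarrow> 0" for n
    unfolding X_def using LIMSEQ_inverse_real_of_nat by (auto simp: inverse_eq_divide)
  define q where "q n y = (f (y + X n *\<^sub>R b) - f y) /\<^sub>R X n" for n y
  have [measurable]: "f \<in> borel_measurable borel" by (rule schwartz_borel_measurable[OF f])
  have der: "(f has_derivative frechet_derivative f (at y)) (at y)" for y
    using smooth_has_derivative[OF schwartz_smooth[OF f], of "[]"] by simp
  have fi: "integrable lborel f" by (rule integrable_schwartz[OF f])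
  have fi': "integrable lborel (\<lambda>y. f (y + X n *\<^sub>R b))" for n
    using integrable_lborel_affine[OF fi, of 1 "X n *\<^sub>R b"] by (simp add: add.commute)
  have "(\<integral>y. q n y \<partial>lborel) = 0" for n
    unfolding q_def using integral_lborel_affine[of f 1 "X n *\<^sub>R b"] fi fi'
    by (simp add: add.commute)
  moreover have "(\<lambda>n. \<integral>y. q n y \<partial>lborel) \<longlonglongrightarrow> (\<integral>y. partial_derivs [b] f y \<partial>lborel)"
  proof (rule integral_dominated_convergence[where w="\<lambda>y. real DIM('a) * C * 2 ^ M * (1 / (1 + norm y) ^ M)"])
    show "(\<lambda>y. partial_derivs [b] f y) \<in> borel_measurable lborel"
      using smooth_borel_measurable[OF schwartz_smooth[OF f], of "[b]"] b by simp
    show "q n \<in> borel_measurable lborel" for n unfolding q_def by measurable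
    show "integrable lborel (\<lambda>y :: 'a. real DIM('a) * C * 2 ^ M * (1 / (1 + norm y) ^ M))"
      unfolding M_def by (intro integrable_mult_right integrable_inverse_power_norm)
    show "AE y in lborel. (\<lambda>n. q n y) \<longlonglongrightarrow> partial_derivs [b] f y"
    proof (intro AE_I2)
      fix y
      have lim: "(\<lambda>h. norm (f (y + h) - f y - frechet_derivative f (at y) h) / norm h) \<midarrow>0\<rightarrow> 0"
        using der[of y] unfolding has_derivative_at by blast
      have conv: "(\<lambda>n. X n *\<^sub>R b) \<longlonglongrightarrow> 0" using tendsto_scaleR[OF X(3) tendsto_const[of b]] by simp
      have mem: "X n *\<^sub>R b \<in> UNIV - {0}" for n using X(1)[of n] b nonzero_Basis by auto
      have "(\<lambda>n. norm (f (y + X n *\<^sub>R b) - f y - frechet_derivative f (at y) (X n *\<^sub>R b)) / norm (X n *\<^sub>R b)) \<longlonglongrightarrow> 0"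
        using lim[unfolded tendsto_at_iff_sequentially, rule_format, OF mem conv] by (simp only: comp_def)
      moreover have "norm (f (y + X n *\<^sub>R b) - f y - frechet_derivative f (at y) (X n *\<^sub>R b)) / norm (X n *\<^sub>R b)
          = norm (q n y - partial_derivs [b] f y)" for n
      proof -
        have "q n y - partial_derivs [b] f y = (f (y + X n *\<^sub>R b) - f y - frechet_derivative f (at y) (X n *\<^sub>R b)) /\<^sub>R X n"
          using X(1)[of n] has_derivative_linear[OF der] unfolding q_def
          by (simp add: linear_scale scaleR_diff_right)
        then show ?thesis using X(1)[of n] b by (simp add: divide_inverse mult.commute)
      qed
      ultimately have "(\<lambda>n. norm (q n y - partial_derivs [b] f y)) \<longlonglongrightarrow> 0" by simp
      then show "(\<lambda>n. q n y) \<longlonglongrightarrow> partial_derivs [b] f y"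
        by (rule LIM_zero_cancel[OF tendsto_norm_zero_cancel])
    qed
    show "AE y in lborel. norm (q n y) \<le> real DIM('a) * C * 2 ^ M * (1 / (1 + norm y) ^ M)" for n
    proof (intro AE_I2)
      fix y
      have on: "onorm (frechet_derivative f (at u)) \<le> real DIM('a) * (C * (2 ^ M / (1 + norm y) ^ M))"
        if u: "u \<in> cball y 1" for u
      proof (rule onorm_le)
        fix h
        show "norm (frechet_derivative f (at u) h) \<le> real DIM('a) * (C * (2 ^ M / (1 + norm y) ^ M)) * norm h"
        proof (rule linear_norm_le[OF has_derivative_linear[OF der]])
          fix c :: 'a assume c: "c \<in> Basis"
          have "norm (partial_derivs [c] f u) \<le> C * (1 / (1 + norm u) ^ M)"
            using seminorm_bound_le[OF C, of "[c]" u] c M by simp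
          also have "\<dots> \<le> C * (2 ^ M / (1 + norm y) ^ M)"
            using u C0 by (intro mult_left_mono inverse_power_norm_shift) (auto simp: dist_norm norm_minus_commute)
          finally show "norm (frechet_derivative f (at u) c) \<le> C * (2 ^ M / (1 + norm y) ^ M)" by simp
        qed
      qed
      have "norm (f (y + X n *\<^sub>R b) - f y) \<le> real DIM('a) * (C * (2 ^ M / (1 + norm y) ^ M)) * norm (y + X n *\<^sub>R b - y)"
        by (rule differentiable_bound[where S="cball y 1" and f'="\<lambda>u. frechet_derivative f (at u)"])
          (use der X(1)[of n] X(2)[of n] b on in \<open>auto intro: has_derivative_at_withinI simp: dist_norm\<close>)
      also have "\<dots> = real DIM('a) * C * 2 ^ M * (1 / (1 + norm y) ^ M) * X n"
        using X(1)[of n] b by simp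
      finally have "norm (f (y + X n *\<^sub>R b) - f y) / X n \<le> real DIM('a) * C * 2 ^ M * (1 / (1 + norm y) ^ M)"
        using X(1)[of n] by (simp add: pos_divide_le_eq)
      then show "norm (q n y) \<le> real DIM('a) * C * 2 ^ M * (1 / (1 + norm y) ^ M)"
        using X(1)[of n] by (simp add: q_def divide_inverse mult.commute)
    qed
  qed
  ultimately show ?thesis by (simp add: LIMSEQ_const_iff)
qed

lemma fourier_eq: "fourier f \<zeta> = (\<integral>t. f t * modulation \<zeta> t \<partial>lborel)"
  by (simp add: fourier_def modulation_def)

lemma borel_measurable_modulation [measurable]:
  "f \<in> borel_measurable M \<Longrightarrow> g \<in> borel_measurable M \<Longrightarrow> (\<lambda>x. modulation (f x) (g x)) \<in> borel_measurable M"
  unfolding modulation_def cis_conv_exp by measurable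

lemma wave_packet_0: "wave_packet f 0 \<zeta> = (\<lambda>t. f t * modulation \<zeta> t)"
  by (simp add: wave_packet_def fun_eq_iff)

text \<open>Integration by parts without boundary terms: the derivative of f times the modulation
  has integral 0.\<close>

lemma fourier_partial_derivs:
  assumes f: "f \<in> schwartz" and b: "b \<in> Basis"
  shows "fourier (partial_derivs [b] f) \<zeta> = \<i> * of_real (2 * pi * (b \<bullet> \<zeta>)) * fourier f \<zeta>"
proof -
  have "partial_derivs [b] (wave_packet f 0 \<zeta>) = (\<lambda>y. partial_derivs [b] f y * modulation \<zeta> y + f y * (\<i> * of_real (- 2 * pi * (b \<bullet> \<zeta>)) * modulation \<zeta> y))"
    by (subst partial_derivs_wave_packet[OF schwartz_smooth[OF f]]) (use b in auto)
  moreover have "integrable lborel (\<lambda>t. partial_derivs [b] f t * modulation \<zeta> t)"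
    using integrable_schwartz[OF schwartz_wave_packet[OF schwartz_partial_derivs[OF f], of "[b]" 0 \<zeta>]] b
    by (simp add: wave_packet_0)
  moreover have "integrable lborel (\<lambda>t. f t * modulation \<zeta> t)"
    using integrable_schwartz[OF schwartz_wave_packet[OF f, of 0 \<zeta>]] by (simp add: wave_packet_0)
  then have "integrable lborel (\<lambda>t. (\<i> * of_real (- 2 * pi * (b \<bullet> \<zeta>))) * (f t * modulation \<zeta> t))"
    by (intro integrable_mult_right)
  moreover have "(\<integral>t. (\<i> * of_real (- 2 * pi * (b \<bullet> \<zeta>))) * (f t * modulation \<zeta> t) \<partial>lborel) = \<i> * of_real (- 2 * pi * (b \<bullet> \<zeta>)) * fourier f \<zeta>"
    unfolding fourier_eq by (rule integral_mult_right_zero)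
  ultimately have "0 = fourier (partial_derivs [b] f) \<zeta> + \<i> * of_real (- 2 * pi * (b \<bullet> \<zeta>)) * fourier f \<zeta>"
    using integral_partial_derivs_eq_0[OF schwartz_wave_packet[OF f, of 0 \<zeta>] b]
    by (simp add: fourier_eq[of "partial_derivs [b] f"] mult_ac del: partial_derivs.simps of_real_mult)
  then show ?thesis by (simp add: eq_neg_iff_add_eq_0 add.commute)
qed

lemma fourier_partial_derivs_replicate:
  assumes f: "f \<in> schwartz" and b: "b \<in> Basis"
  shows "fourier (partial_derivs (replicate k b) f) \<zeta> = (\<i> * of_real (2 * pi * (b \<bullet> \<zeta>))) ^ k * fourier f \<zeta>"
proof (induction k)
  case (Suc k)
  have "partial_derivs (replicate k b) f \<in> schwartz" using b by (intro schwartz_partial_derivs f) auto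
  from fourier_partial_derivs[OF this b, of \<zeta>] Suc show ?case by (simp add: mult_ac)
qed simp

lemma norm_fourier_le: "integrable lborel f \<Longrightarrow> norm (fourier f \<zeta>) \<le> (\<integral>t. norm (f t) \<partial>lborel)"
  unfolding fourier_eq using integral_norm_bound[of lborel "\<lambda>t. f t * modulation \<zeta> t"] by (simp add: norm_mult)

section \<open>Quantitative decay of Fourier transforms\<close>

definition decay_const :: "'a::euclidean_space itself \<Rightarrow> nat \<Rightarrow> real" where
  "decay_const _ M = (real DIM('a) + 1) ^ M * (1 + real DIM('a)) * (\<integral>x. 1 / (1 + norm (x :: 'a)) ^ (2 * DIM('a)) \<partial>lborel)"

lemma decay_const_nonneg: "0 \<le> decay_const TYPE('a::euclidean_space) M"
  unfolding decay_const_def by (intro mult_nonneg_nonneg integral_nonneg_AE) auto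

text \<open>The full weight is controlled by powers of single coordinates, so repeated derivatives
  in one direction at a time suffice for the decay of a Fourier transform.\<close>

lemma one_plus_norm_power_le:
  fixes \<zeta> :: "'a::euclidean_space"
  shows "(1 + norm \<zeta>) ^ M \<le> (real DIM('a) + 1) ^ M * (1 + (\<Sum>b\<in>Basis. \<bar>\<zeta> \<bullet> b\<bar> ^ M))"
proof -
  define m where "m = Max (insert 1 ((\<lambda>b. \<bar>\<zeta> \<bullet> b\<bar>) ` Basis))"
  have m: "1 \<le> m" "b \<in> Basis \<Longrightarrow> \<bar>\<zeta> \<bullet> b\<bar> \<le> m" for b
    unfolding m_def by (rule Max_ge; simp)+
  have mm: "m \<in> insert 1 ((\<lambda>b. \<bar>\<zeta> \<bullet> b\<bar>) ` Basis)" unfolding m_def by (intro Max_in) auto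
  have "norm \<zeta> \<le> (\<Sum>b\<in>Basis. \<bar>\<zeta> \<bullet> b\<bar>)" by (rule norm_le_l1)
  also have "\<dots> \<le> real DIM('a) * m" using m(2) by (intro sum_bounded_above) auto
  finally have "1 + norm \<zeta> \<le> (real DIM('a) + 1) * m" using m(1) by (simp add: algebra_simps)
  then have "(1 + norm \<zeta>) ^ M \<le> ((real DIM('a) + 1) * m) ^ M" by (intro power_mono) auto
  also have "\<dots> = (real DIM('a) + 1) ^ M * m ^ M" by (rule power_mult_distrib)
  also have "m ^ M \<le> 1 + (\<Sum>b\<in>Basis. \<bar>\<zeta> \<bullet> b\<bar> ^ M)"
  proof (cases "m = 1")
    case True
    then show ?thesis by (simp add: sum_nonneg)
  next
    case False
    with mm obtain b where b: "b \<in> Basis" "m = \<bar>\<zeta> \<bullet> b\<bar>" by auto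
    then have "m ^ M \<le> (\<Sum>b\<in>Basis. \<bar>\<zeta> \<bullet> b\<bar> ^ M)" using member_le_sum[of b Basis "\<lambda>b. \<bar>\<zeta> \<bullet> b\<bar> ^ M"] by auto
    then show ?thesis by simp
  qed
  finally show ?thesis by (simp add: mult_left_mono)
qed

text \<open>The function enters only through the number J. In the short-time transform J will itself
  carry the decay in the position of the window, while the constant depends on the dimension and M
  alone.\<close>

lemma fourier_decay:
  fixes f :: "'a::euclidean_space \<Rightarrow> complex"
  assumes f: "f \<in> schwartz"
    and J: "\<And>bs y. set bs \<subseteq> Basis \<Longrightarrow> length bs \<le> M \<Longrightarrow> norm (partial_derivs bs f y) \<le> J / (1 + norm y) ^ (2 * DIM('a))"
  shows "norm (fourier f \<zeta>) \<le> decay_const TYPE('a) M * J / (1 + norm \<zeta>) ^ M"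
proof -
  define I where "I = (\<integral>x. 1 / (1 + norm (x :: 'a)) ^ (2 * DIM('a)) \<partial>lborel)"
  have bnd: "norm (fourier (partial_derivs bs f) \<zeta>) \<le> J * I" if bs: "set bs \<subseteq> Basis" "length bs \<le> M" for bs
  proof -
    have i: "integrable lborel (partial_derivs bs f)" by (intro integrable_schwartz schwartz_partial_derivs f bs)
    have "norm (fourier (partial_derivs bs f) \<zeta>) \<le> (\<integral>t. norm (partial_derivs bs f t) \<partial>lborel)"
      by (rule norm_fourier_le[OF i])
    also have "\<dots> \<le> (\<integral>t. J * (1 / (1 + norm t) ^ (2 * DIM('a))) \<partial>(lborel :: 'a measure))"
      using J[OF bs] by (intro integral_mono integrable_norm i integrable_mult_right integrable_inverse_power_norm) auto
    also have "\<dots> = J * I" unfolding I_def by (rule integral_mult_right_zero)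
    finally show ?thesis .
  qed
  have 0: "norm (fourier f \<zeta>) \<le> J * I" using bnd[of "[]"] by simp
  have b: "\<bar>\<zeta> \<bullet> b\<bar> ^ M * norm (fourier f \<zeta>) \<le> J * I" if b: "b \<in> Basis" for b
  proof -
    have "\<bar>\<zeta> \<bullet> b\<bar> ^ M \<le> \<bar>2 * pi * (b \<bullet> \<zeta>)\<bar> ^ M"
    proof (intro power_mono)
      have "1 * \<bar>\<zeta> \<bullet> b\<bar> \<le> (2 * pi) * \<bar>\<zeta> \<bullet> b\<bar>" using pi_gt3 by (intro mult_right_mono) auto
      then show "\<bar>\<zeta> \<bullet> b\<bar> \<le> \<bar>2 * pi * (b \<bullet> \<zeta>)\<bar>" by (simp add: abs_mult inner_commute)
    qed simp
    then have "\<bar>\<zeta> \<bullet> b\<bar> ^ M * norm (fourier f \<zeta>) \<le> \<bar>2 * pi * (b \<bullet> \<zeta>)\<bar> ^ M * norm (fourier f \<zeta>)"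
      by (intro mult_right_mono) auto
    also have "\<dots> = norm (fourier (partial_derivs (replicate M b) f) \<zeta>)"
      unfolding fourier_partial_derivs_replicate[OF f b]
      by (simp add: norm_mult norm_power abs_mult power_mult_distrib)
    also have "\<dots> \<le> J * I" using b by (intro bnd) auto
    finally show ?thesis .
  qed
  have "(1 + norm \<zeta>) ^ M * norm (fourier f \<zeta>) \<le> ((real DIM('a) + 1) ^ M * (1 + (\<Sum>b\<in>Basis. \<bar>\<zeta> \<bullet> b\<bar> ^ M))) * norm (fourier f \<zeta>)"
    by (intro mult_right_mono one_plus_norm_power_le) auto
  also have "\<dots> = (real DIM('a) + 1) ^ M * (norm (fourier f \<zeta>) + (\<Sum>b\<in>Basis. \<bar>\<zeta> \<bullet> b\<bar> ^ M * norm (fourier f \<zeta>)))"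
    by (simp only: mult.assoc distrib_right sum_distrib_right mult_1)
  also have "\<dots> \<le> (real DIM('a) + 1) ^ M * (J * I + (\<Sum>b\<in>(Basis :: 'a set). J * I))"
    by (intro mult_left_mono add_mono 0 sum_mono b) auto
  also have "\<dots> = decay_const TYPE('a) M * J" by (simp add: decay_const_def I_def algebra_simps)
  finally show ?thesis by (simp add: pos_le_divide_eq add_pos_nonneg mult.commute)
qed

section \<open>The short-time Fourier transform of Schwartz functions\<close>

lemma schwartz_mult:
  assumes "f \<in> schwartz" "h \<in> schwartz"
  shows "(\<lambda>x. f x * h x) \<in> schwartz"
proof (rule schwartzI)
  show "smooth (\<lambda>x. f x * h x)" using assms by (intro smooth_mult schwartz_smooth)
  fix N
  obtain B where B: "seminorm_bound N f B" using schwartz_bound_ex[OF assms(1)] by blast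
  obtain C where C: "seminorm_bound N h C" using schwartz_bound_ex[OF assms(2)] by blast
  have B0: "0 \<le> B" and C0: "0 \<le> C" using seminorm_bound_nonneg B C by blast+
  have "seminorm_bound N (\<lambda>x. f x * h x) (2 ^ N * (B * C))"
    unfolding seminorm_bound_def
  proof (intro allI impI)
    fix bs :: "'a list" and y assume bs: "set bs \<subseteq> Basis" "length bs \<le> N"
    have "norm (partial_derivs as f y * partial_derivs cs h y) \<le> B / (1 + norm y) ^ N * C"
      if "(as, cs) \<in> set (splits bs)" for as cs
      using splits_subset[OF that] bs B0 unfolding norm_mult
      by (intro mult_mono seminorm_bound_le[OF B] seminorm_bound_le_const[OF C]) auto
    then have "norm (partial_derivs bs (\<lambda>x. f x * h x) y) \<le> real (length (splits bs)) * (B / (1 + norm y) ^ N * C)"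
      unfolding partial_derivs_mult[OF assms[THEN schwartz_smooth] bs(1)] by (intro norm_sum_list_le) auto
    also have "\<dots> \<le> 2 ^ N * (B / (1 + norm y) ^ N * C)"
      using bs B0 C0 by (intro mult_right_mono) (auto simp: length_splits intro!: power_increasing)
    finally show "(1 + norm y) ^ N * norm (partial_derivs bs (\<lambda>x. f x * h x) y) \<le> 2 ^ N * (B * C)"
      by (simp add: pos_le_divide_eq add_pos_nonneg field_simps)
  qed
  then show "\<exists>B. seminorm_bound N (\<lambda>x. f x * h x) B" by blast
qed

lemma schwartz_translate: "f \<in> schwartz \<Longrightarrow> (\<lambda>y. f (y - x)) \<in> schwartz"
  using schwartz_wave_packet[of f x 0] by (simp add: wave_packet_def[abs_def] modulation_def)

text \<open>The window is conjugated, so the value at (x, \<xi>) is the L^2 inner product of h with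
  \<open>wave_packet g x (- \<xi>)\<close>. This is the reason for the sign in
  \<open>- snd p\<close> in all superpositions.\<close>

definition stft :: "('a::euclidean_space \<Rightarrow> complex) \<Rightarrow> ('a \<Rightarrow> complex) \<Rightarrow> 'a \<times> 'a \<Rightarrow> complex" where
  "stft g h p = fourier (\<lambda>y. h y * cnj (g (y - fst p))) (snd p)"

lemma schwartz_stft_integrand: "g \<in> schwartz \<Longrightarrow> h \<in> schwartz \<Longrightarrow> (\<lambda>y. h y * cnj (g (y - x))) \<in> schwartz"
  by (intro schwartz_mult schwartz_cnj schwartz_translate)

text \<open>Decay in the position z comes from (1 + |y|)(1 + |y - z|) >= 1 + |z|, decay in frequency
  from derivatives of the integrand; the 2 d extra orders on h make the integral converge. The bound
  is linear in B, which later gives continuity of the evolution on Schwartz functions.\<close>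

lemma stft_decay:
  fixes g h :: "'a::euclidean_space \<Rightarrow> complex"
  assumes g: "g \<in> schwartz" "seminorm_bound M g C" and h: "h \<in> schwartz" "seminorm_bound (M + 2 * DIM('a)) h B"
  shows "norm (stft g h p) \<le> decay_const TYPE('a) M * 2 ^ M * C * B / (1 + norm p) ^ M"
proof -
  obtain z \<zeta> where p: "p = (z, \<zeta>)" by (cases p)
  have C0: "0 \<le> C" and B0: "0 \<le> B" using seminorm_bound_nonneg g h by blast+
  define J where "J = 2 ^ M * C * B / (1 + norm z) ^ M"
  have J: "norm (partial_derivs bs (\<lambda>y. h y * cnj (g (y - z))) y) \<le> J / (1 + norm y) ^ (2 * DIM('a))"
    if bs: "set bs \<subseteq> Basis" "length bs \<le> M" for bs y
  proof -
    define K where "K = B * C / ((1 + norm z) ^ M * (1 + norm y) ^ (2 * DIM('a)))"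
    have term_le: "norm (partial_derivs as h y * partial_derivs cs (\<lambda>y. cnj (g (y - z))) y) \<le> K"
      if "(as, cs) \<in> set (splits bs)" for as cs
    proof -
      have s: "set as \<subseteq> Basis" "set cs \<subseteq> Basis" "length as \<le> M" "length cs \<le> M"
        using splits_subset[OF that] bs by auto
      have "partial_derivs cs (\<lambda>y. cnj (g (y - z))) y = cnj (partial_derivs cs g (y - z))"
        using partial_derivs_cnj[OF smooth_translate[OF schwartz_smooth[OF g(1)]] s(2)]
          partial_derivs_translate[OF schwartz_smooth[OF g(1)] s(2)] by simp
      then have "norm (partial_derivs as h y * partial_derivs cs (\<lambda>y. cnj (g (y - z))) y)
        = norm (partial_derivs as h y) * norm (partial_derivs cs g (y - z))" by (simp add: norm_mult)
      also have "\<dots> \<le> B / (1 + norm y) ^ (M + 2 * DIM('a)) * (C / (1 + norm (y - z)) ^ M)"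
        using B0 s by (intro mult_mono seminorm_bound_le[OF h(2)] seminorm_bound_le[OF g(2)]) auto
      also have "\<dots> = B * C / (((1 + norm y) * (1 + norm (y - z))) ^ M * (1 + norm y) ^ (2 * DIM('a)))"
        by (simp add: power_add power_mult_distrib mult_ac)
      also have "\<dots> \<le> K"
        unfolding K_def
      proof (intro divide_left_mono mult_right_mono power_mono)
        have "1 + norm z \<le> (1 + norm (z - y)) * (1 + norm y)" by (rule one_plus_norm_le)
        then show "1 + norm z \<le> (1 + norm y) * (1 + norm (y - z))" by (simp add: norm_minus_commute mult.commute)
      qed (use B0 C0 in \<open>auto intro!: mult_pos_pos zero_less_power simp: add_pos_nonneg\<close>)
      finally show ?thesis .
    qed
    then have "norm (partial_derivs bs (\<lambda>y. h y * cnj (g (y - z))) y) \<le> real (length (splits bs)) * K"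
      unfolding partial_derivs_mult[OF schwartz_smooth[OF h(1)] schwartz_smooth[OF schwartz_cnj[OF schwartz_translate[OF g(1)]]] bs(1)]
      by (intro norm_sum_list_le) auto
    also have "\<dots> \<le> 2 ^ M * K"
      using bs B0 C0 by (intro mult_right_mono) (auto simp: length_splits K_def intro!: power_increasing)
    also have "\<dots> = J / (1 + norm y) ^ (2 * DIM('a))" by (simp add: J_def K_def)
    finally show ?thesis .
  qed
  have "norm (stft g h p) \<le> decay_const TYPE('a) M * J / (1 + norm \<zeta>) ^ M"
    unfolding stft_def p fst_conv snd_conv
    by (rule fourier_decay[OF schwartz_stft_integrand[OF g(1) h(1)] J])
  also have "\<dots> = decay_const TYPE('a) M * 2 ^ M * C * B / ((1 + norm z) * (1 + norm \<zeta>)) ^ M"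
    by (simp add: J_def power_mult_distrib)
  also have "\<dots> \<le> decay_const TYPE('a) M * 2 ^ M * C * B / (1 + norm p) ^ M"
  proof (intro divide_left_mono power_mono)
    have "norm p \<le> norm z + norm \<zeta>" unfolding p by (rule norm_Pair_le)
    also have "\<dots> \<le> norm z + norm \<zeta> + norm z * norm \<zeta>" by simp
    finally show "1 + norm p \<le> (1 + norm z) * (1 + norm \<zeta>)" by (simp add: algebra_simps)
  qed (use B0 C0 decay_const_nonneg[where ?'a='a] in \<open>auto intro!: mult_pos_pos zero_less_power mult_nonneg_nonneg simp: add_pos_nonneg\<close>)
  finally show ?thesis .
qed

lemma stft_rapid_decay:
  assumes "g \<in> schwartz" "h \<in> schwartz"
  shows "\<exists>C. \<forall>p. norm (stft g h p) \<le> C / (1 + norm p) ^ M"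
  using stft_decay[OF assms(1) seminorm_bound_schwartz_norm[OF assms(1)] assms(2) seminorm_bound_schwartz_norm[OF assms(2)]]
  by blast

lemma borel_measurable_cnj [measurable]:
  "f \<in> borel_measurable M \<Longrightarrow> (\<lambda>x. cnj (f x)) \<in> borel_measurable M"
  by (rule borel_measurable_continuous_on[of cnj]) (auto intro: continuous_intros)

lemma stft_continuous:
  fixes g h :: "'a::euclidean_space \<Rightarrow> complex"
  assumes g: "g \<in> schwartz" and h: "h \<in> schwartz"
  shows "continuous_on UNIV (stft g h)"
proof -
  have gm[measurable]: "g \<in> borel_measurable borel" and hm[measurable]: "h \<in> borel_measurable borel"
    using g h by (auto intro: schwartz_borel_measurable)
  obtain C where C: "seminorm_bound 0 g C" using schwartz_bound_ex[OF g] by blast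
  have gC: "norm (g y) \<le> C" for y using seminorm_bound_le_const[OF C, of "[]" y] by simp
  have gc: "continuous_on UNIV g" using smooth_continuous[OF schwartz_smooth[OF g], of "[]"] by simp
  have "isCont (stft g h) p" for p
    unfolding continuous_at_sequentially comp_def
  proof (intro allI impI)
    fix u assume u: "u \<longlonglongrightarrow> p"
    show "(\<lambda>n. stft g h (u n)) \<longlonglongrightarrow> stft g h p"
      unfolding stft_def fourier_eq
    proof (rule integral_dominated_convergence[where w="\<lambda>y. C * norm (h y)"])
      show "AE y in lborel. (\<lambda>n. h y * cnj (g (y - fst (u n))) * modulation (snd (u n)) y) \<longlonglongrightarrow> h y * cnj (g (y - fst p)) * modulation (snd p) y"
      proof (intro AE_I2)
        fix y
        have "(\<lambda>n. g (y - fst (u n))) \<longlonglongrightarrow> g (y - fst p)"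
          by (rule continuous_on_tendsto_compose[OF gc]) (auto intro!: tendsto_intros u)
        moreover have "(\<lambda>n. modulation (snd (u n)) y) \<longlonglongrightarrow> modulation (snd p) y"
          unfolding modulation_def by (intro tendsto_intros u)
        ultimately show "(\<lambda>n. h y * cnj (g (y - fst (u n))) * modulation (snd (u n)) y) \<longlonglongrightarrow> h y * cnj (g (y - fst p)) * modulation (snd p) y"
          by (intro tendsto_intros)
      qed
      show "AE y in lborel. norm (h y * cnj (g (y - fst (u n))) * modulation (snd (u n)) y) \<le> C * norm (h y)" for n
        using gC by (intro AE_I2) (auto simp: norm_mult mult.commute[of C] intro!: mult_left_mono)
      show "integrable lborel (\<lambda>y. C * norm (h y))"
        by (intro integrable_mult_right integrable_norm integrable_schwartz h)
    qed auto
  qed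
  then show ?thesis by (simp add: continuous_on_eq_continuous_at)
qed

section \<open>The Fourier transform of the Gaussian and inversion\<close>

lemma gaussian_fourier_real:
  fixes s :: real
  shows "integrable lborel (\<lambda>u :: real. complex_of_real (exp (- pi * u\<^sup>2)) * cis (- 2 * pi * (u * s)))"
    and "(\<integral>u. complex_of_real (exp (- pi * u\<^sup>2)) * cis (- 2 * pi * (u * s)) \<partial>lborel) = of_real (exp (- pi * s\<^sup>2))"
proof -
  have "integrable lborel (gaussian pi :: real \<Rightarrow> complex)" by (intro integrable_schwartz schwartz_gaussian) simp
  then have i: "integrable lborel (\<lambda>u :: real. exp (- pi * u\<^sup>2))"
    unfolding gaussian_def[abs_def] by (subst (asm) complex_of_real_integrable_eq) simp
  show int: "integrable lborel (\<lambda>u :: real. complex_of_real (exp (- pi * u\<^sup>2)) * cis (- 2 * pi * (u * s)))"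
    by (rule Bochner_Integration.integrable_bound[OF i]) (auto simp: norm_mult cis_conv_exp)
  \<comment> \<open>The characteristic function of the standard normal law is exp (-t^2 / 2). This t
    turns it into exp (-\<pi> s^2), and the substitution by sqrt (2 \<pi>) turns the density into
    exp (-\<pi> u^2).\<close>
  let ?t = "- sqrt (2 * pi) * s"
  have "char std_normal_distribution ?t = (\<integral>x. std_normal_density x *\<^sub>R iexp (?t * x) \<partial>lborel)"
    unfolding char_def by (subst integral_density) auto
  also have "\<dots> = \<bar>sqrt (2 * pi)\<bar> *\<^sub>R (\<integral>x. std_normal_density (0 + sqrt (2 * pi) * x) *\<^sub>R iexp (?t * (0 + sqrt (2 * pi) * x)) \<partial>lborel)"
    by (rule lborel_integral_real_affine) simp
  also have "\<dots> = (\<integral>x. sqrt (2 * pi) *\<^sub>R (std_normal_density (sqrt (2 * pi) * x) *\<^sub>R iexp (?t * (sqrt (2 * pi) * x))) \<partial>lborel)"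
    unfolding integral_scaleR_right by simp
  also have "\<dots> = (\<integral>u. complex_of_real (exp (- pi * u\<^sup>2)) * cis (- 2 * pi * (u * s)) \<partial>lborel)"
  proof (intro Bochner_Integration.integral_cong refl)
    fix x :: real
    have "sqrt (2 * pi) * std_normal_density (sqrt (2 * pi) * x) = exp (- pi * x\<^sup>2)"
      by (simp add: std_normal_density_def power_mult_distrib)
    moreover have "?t * (sqrt (2 * pi) * x) = - 2 * pi * (x * s)"
      by (simp add: mult_ac)
    ultimately show "sqrt (2 * pi) *\<^sub>R (std_normal_density (sqrt (2 * pi) * x) *\<^sub>R iexp (?t * (sqrt (2 * pi) * x)))
      = complex_of_real (exp (- pi * x\<^sup>2)) * cis (- 2 * pi * (x * s))"
      unfolding cis_conv_exp scaleR_scaleR by (simp only: scaleR_conv_of_real)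
  qed
  finally show "(\<integral>u. complex_of_real (exp (- pi * u\<^sup>2)) * cis (- 2 * pi * (u * s)) \<partial>lborel) = of_real (exp (- pi * s\<^sup>2))"
    unfolding char_std_normal_distribution by (simp add: power_mult_distrib)
qed

lemma integral_lborel_prod:
  fixes f :: "'a::euclidean_space \<Rightarrow> real \<Rightarrow> complex"
  assumes f: "\<And>b. b \<in> Basis \<Longrightarrow> integrable lborel (f b)"
  shows "(\<integral>y. (\<Prod>b\<in>Basis. f b (y \<bullet> b)) \<partial>lborel) = (\<Prod>b\<in>Basis. \<integral>u. f b u \<partial>lborel)"
proof -
  interpret product_sigma_finite "\<lambda>_ :: 'a. lborel :: real measure" ..
  have [measurable]: "f b \<in> borel_measurable borel" if "b \<in> Basis" for b
    using borel_measurable_integrable[OF f[OF that]] by simp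
  have "(\<integral>y. (\<Prod>b\<in>Basis. f b (y \<bullet> b)) \<partial>lborel)
     = (\<integral>y. (\<Prod>b\<in>Basis. f b (y \<bullet> b)) \<partial>distr (\<Pi>\<^sub>M b\<in>Basis. lborel) borel (\<lambda>f. \<Sum>b\<in>Basis. f b *\<^sub>R b))"
    by (subst lborel_eq) simp
  also have "\<dots> = (\<integral>x. (\<Prod>b\<in>Basis. f b ((\<Sum>c\<in>Basis. x c *\<^sub>R c) \<bullet> b)) \<partial>(\<Pi>\<^sub>M b\<in>(Basis :: 'a set). lborel))"
    by (subst integral_distr) auto
  also have "\<dots> = (\<integral>x. (\<Prod>b\<in>Basis. f b (x b)) \<partial>(\<Pi>\<^sub>M b\<in>(Basis :: 'a set). lborel))"
    by (intro Bochner_Integration.integral_cong refl prod.cong) (simp add: inner_sum_left inner_Basis if_distrib cong: if_cong)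
  also have "\<dots> = (\<Prod>b\<in>Basis. \<integral>u. f b u \<partial>lborel)"
    by (rule product_integral_prod) (auto intro: f)
  finally show ?thesis .
qed

lemma fourier_gaussian: "fourier (gaussian pi) \<xi> = gaussian pi (\<xi> :: 'a::euclidean_space)"
proof -
  have e: "exp (- pi * (norm y)\<^sup>2) = (\<Prod>b\<in>Basis. exp (- pi * (y \<bullet> b)\<^sup>2))" for y :: 'a
  proof -
    have "(norm y)\<^sup>2 = (\<Sum>b\<in>Basis. (y \<bullet> b)\<^sup>2)"
      unfolding power2_norm_eq_inner by (subst euclidean_inner) (simp add: power2_eq_square)
    then show ?thesis by (simp add: exp_sum[symmetric] sum_distrib_left[symmetric] sum_negf)
  qed
  have m: "modulation \<xi> y = (\<Prod>b\<in>Basis. cis (- 2 * pi * ((y \<bullet> b) * (\<xi> \<bullet> b))))" for y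
    unfolding modulation_def cis_conv_exp
    by (simp add: exp_sum[symmetric] sum_distrib_left[symmetric] euclidean_inner[of y \<xi>] sum_negf)
  have "fourier (gaussian pi) \<xi> = (\<integral>y. (\<Prod>b\<in>Basis. complex_of_real (exp (- pi * (y \<bullet> b)\<^sup>2)) * cis (- 2 * pi * ((y \<bullet> b) * (\<xi> \<bullet> b)))) \<partial>lborel)"
    unfolding fourier_eq gaussian_def e m by (simp add: prod.distrib)
  also have "\<dots> = (\<Prod>b\<in>Basis. \<integral>u. complex_of_real (exp (- pi * u\<^sup>2)) * cis (- 2 * pi * (u * (\<xi> \<bullet> b))) \<partial>lborel)"
    by (intro integral_lborel_prod[where f="\<lambda>b u. complex_of_real (exp (- pi * u\<^sup>2)) * cis (- 2 * pi * (u * (\<xi> \<bullet> b)))"] gaussian_fourier_real(1))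
  also have "\<dots> = gaussian pi \<xi>"
    unfolding gaussian_fourier_real(2) gaussian_def e by simp
  finally show ?thesis .
qed

lemma integral_gaussian: "(\<integral>y. gaussian pi (y :: 'a::euclidean_space) \<partial>lborel) = 1"
  using fourier_gaussian[of "0 :: 'a"] by (simp add: fourier_eq modulation_def gaussian_def)

lemma fourier_schwartz_integrable:
  fixes f :: "'a::euclidean_space \<Rightarrow> complex"
  assumes f: "f \<in> schwartz"
  shows "fourier f \<in> borel_measurable borel" "integrable lborel (fourier f)"
proof -
  have [measurable]: "f \<in> borel_measurable borel" by (rule schwartz_borel_measurable[OF f])
  show m: "fourier f \<in> borel_measurable borel"
    unfolding fourier_eq[abs_def] by measurable
  define M where "M = 2 * DIM('a)"
  define B where "B = schwartz_norm M f"
  have B: "seminorm_bound M f B" unfolding B_def by (rule seminorm_bound_schwartz_norm[OF f])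
  show "integrable lborel (fourier f)"
  proof (rule integrable_decay)
    show "norm (fourier f \<zeta>) \<le> decay_const TYPE('a) M * B / (1 + norm \<zeta>) ^ (2 * DIM('a))" for \<zeta>
      using fourier_decay[OF f, of M B \<zeta>] seminorm_bound_le[OF B] by (simp add: M_def)
  qed (use m in simp)
qed

text \<open>Gaussian regularisation of the inversion integral.\<close>

lemma fourier_inversion:
  fixes f :: "'a::euclidean_space \<Rightarrow> complex"
  assumes f: "f \<in> schwartz"
  shows "(\<integral>\<zeta>. fourier f \<zeta> * modulation (- \<zeta>) y \<partial>lborel) = f y"
proof -
  have fm[measurable]: "f \<in> borel_measurable borel" by (rule schwartz_borel_measurable[OF f])
  have Fm[measurable]: "fourier f \<in> borel_measurable borel" and Fi: "integrable lborel (fourier f)"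
    using fourier_schwartz_integrable[OF f] by auto
  have gm[measurable]: "gaussian c \<in> borel_measurable borel" for c unfolding gaussian_def[abs_def] by measurable
  have fi: "integrable lborel f" by (rule integrable_schwartz[OF f])
  have gi: "integrable lborel (gaussian c)" if "0 < c" for c using that by (intro integrable_schwartz schwartz_gaussian)
  define e where "e n = 1 / real (Suc n)" for n
  have e: "0 < e n" "e \<longlonglongrightarrow> 0" for n
    unfolding e_def using LIMSEQ_inverse_real_of_nat by (auto simp: inverse_eq_divide)
  \<comment> \<open>The regulariser tends to 1 and makes the double integral absolutely
    convergent.\<close>
  define G where "G n \<zeta> = gaussian (pi * (e n)\<^sup>2) (\<zeta> :: 'a)" for n \<zeta>
  have Gm[measurable]: "G n \<in> borel_measurable borel" for n unfolding G_def by measurable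
  have G1: "norm (G n \<zeta>) \<le> 1" for n \<zeta> by (simp add: G_def gaussian_def)
  have 1: "(\<lambda>n. \<integral>\<zeta>. fourier f \<zeta> * modulation (- \<zeta>) y * G n \<zeta> \<partial>lborel) \<longlonglongrightarrow> (\<integral>\<zeta>. fourier f \<zeta> * modulation (- \<zeta>) y \<partial>lborel)"
  proof (rule integral_dominated_convergence[where w="\<lambda>\<zeta>. norm (fourier f \<zeta>)"])
    show "AE \<zeta> in lborel. (\<lambda>n. fourier f \<zeta> * modulation (- \<zeta>) y * G n \<zeta>) \<longlonglongrightarrow> fourier f \<zeta> * modulation (- \<zeta>) y"
    proof (intro AE_I2)
      fix \<zeta>
      have "(\<lambda>n. G n \<zeta>) \<longlonglongrightarrow> of_real (exp (- (pi * 0\<^sup>2) * (norm \<zeta>)\<^sup>2))"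
        unfolding G_def gaussian_def by (intro tendsto_intros e)
      from tendsto_mult_left[OF this, of "fourier f \<zeta> * modulation (- \<zeta>) y"]
      show "(\<lambda>n. fourier f \<zeta> * modulation (- \<zeta>) y * G n \<zeta>) \<longlonglongrightarrow> fourier f \<zeta> * modulation (- \<zeta>) y" by simp
    qed
    show "AE \<zeta> in lborel. norm (fourier f \<zeta> * modulation (- \<zeta>) y * G n \<zeta>) \<le> norm (fourier f \<zeta>)" for n
      using G1 by (intro AE_I2) (auto simp: norm_mult intro: mult_left_le)
  qed (use Fi in auto)
  \<comment> \<open>Fubini puts the Fourier transform on the regulariser. The Gaussian is its own
    transform, so the substitution t = y + e u leaves an average of f near y at scale e.\<close>
  have 2: "(\<integral>\<zeta>. fourier f \<zeta> * modulation (- \<zeta>) y * G n \<zeta> \<partial>lborel) = (\<integral>u. f (y + e n *\<^sub>R u) * gaussian pi u \<partial>lborel)" for n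
  proof -
    have modadd: "modulation \<zeta> t * modulation (- \<zeta>) y = modulation (t - y) \<zeta>" for \<zeta> t
      unfolding modulation_def by (simp add: cis_mult inner_diff_left algebra_simps inner_commute)
    have Gi: "integrable lborel (G n)" unfolding G_def using e(1)[of n] by (intro gi) simp
    have prod_i: "integrable (lborel \<Otimes>\<^sub>M lborel) (\<lambda>(\<zeta>, t). f t * modulation \<zeta> t * (modulation (- \<zeta>) y * G n \<zeta>))"
    proof (rule lborel_pair.Fubini_integrable)
      show "integrable lborel (\<lambda>\<zeta>. \<integral>t. norm (case (\<zeta>, t) of (\<zeta>, t) \<Rightarrow> f t * modulation \<zeta> t * (modulation (- \<zeta>) y * G n \<zeta>)) \<partial>lborel)"
        using integrable_norm[OF Gi] by (simp add: norm_mult)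
      show "AE \<zeta> in lborel. integrable lborel (\<lambda>t. case (\<zeta>, t) of (\<zeta>, t) \<Rightarrow> f t * modulation \<zeta> t * (modulation (- \<zeta>) y * G n \<zeta>))"
      proof (intro AE_I2)
        fix \<zeta>
        have "integrable lborel (\<lambda>t. f t * modulation \<zeta> t)"
          using integrable_schwartz[OF schwartz_wave_packet[OF f, of 0 \<zeta>]] by (simp add: wave_packet_0)
        then show "integrable lborel (\<lambda>t. case (\<zeta>, t) of (\<zeta>, t) \<Rightarrow> f t * modulation \<zeta> t * (modulation (- \<zeta>) y * G n \<zeta>))"
          by simp
      qed
    qed measurable
    have "(\<integral>\<zeta>. fourier f \<zeta> * modulation (- \<zeta>) y * G n \<zeta> \<partial>lborel)
      = (\<integral>\<zeta>. (\<integral>t. f t * modulation \<zeta> t * (modulation (- \<zeta>) y * G n \<zeta>) \<partial>lborel) \<partial>lborel)"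
      unfolding fourier_eq integral_mult_left_zero by (simp only: mult.assoc)
    also have "\<dots> = (\<integral>t. (\<integral>\<zeta>. f t * modulation \<zeta> t * (modulation (- \<zeta>) y * G n \<zeta>) \<partial>lborel) \<partial>lborel)"
      by (rule lborel_pair.Fubini_integral[symmetric, OF prod_i])
    also have "\<dots> = (\<integral>t. f t * (\<integral>\<zeta>. G n \<zeta> * modulation (t - y) \<zeta> \<partial>lborel) \<partial>lborel)"
    proof (intro Bochner_Integration.integral_cong refl)
      fix t
      have "(\<integral>\<zeta>. f t * modulation \<zeta> t * (modulation (- \<zeta>) y * G n \<zeta>) \<partial>lborel) = (\<integral>\<zeta>. f t * (G n \<zeta> * modulation (t - y) \<zeta>) \<partial>lborel)"
        by (intro Bochner_Integration.integral_cong refl) (simp add: modadd[symmetric] mult_ac)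
      then show "(\<integral>\<zeta>. f t * modulation \<zeta> t * (modulation (- \<zeta>) y * G n \<zeta>) \<partial>lborel) = f t * (\<integral>\<zeta>. G n \<zeta> * modulation (t - y) \<zeta> \<partial>lborel)"
        by simp
    qed
    also have "\<dots> = \<bar>e n\<bar> ^ DIM('a) *\<^sub>R (\<integral>u. f (y + e n *\<^sub>R u) * (\<integral>\<zeta>. G n \<zeta> * modulation (y + e n *\<^sub>R u - y) \<zeta> \<partial>lborel) \<partial>lborel)"
      using e(1)[of n] by (intro integral_lborel_affine) auto
    also have "\<dots> = (\<integral>u. f (y + e n *\<^sub>R u) * (\<bar>e n\<bar> ^ DIM('a) *\<^sub>R (\<integral>\<zeta>. G n \<zeta> * modulation (e n *\<^sub>R u) \<zeta> \<partial>lborel)) \<partial>lborel)"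
      by simp
    also have "\<dots> = (\<integral>u. f (y + e n *\<^sub>R u) * gaussian pi u \<partial>lborel)"
    proof (intro Bochner_Integration.integral_cong refl arg_cong2[where f="(*)"])
      fix u :: 'a
      have "fourier (gaussian pi) u = \<bar>e n\<bar> ^ DIM('a) *\<^sub>R (\<integral>\<zeta>. gaussian pi (0 + e n *\<^sub>R \<zeta>) * modulation u (0 + e n *\<^sub>R \<zeta>) \<partial>lborel)"
        unfolding fourier_eq using e(1)[of n]
        by (intro integral_lborel_affine[where f="\<lambda>t. gaussian pi t * modulation u t"]) auto
      moreover have "gaussian pi (e n *\<^sub>R \<zeta>) = G n \<zeta>" for \<zeta>
        by (simp add: G_def gaussian_def power_mult_distrib mult_ac)
      moreover have "modulation u (e n *\<^sub>R \<zeta>) = modulation (e n *\<^sub>R u) \<zeta>" for \<zeta>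
        by (simp add: modulation_def)
      ultimately show "\<bar>e n\<bar> ^ DIM('a) *\<^sub>R (\<integral>\<zeta>. G n \<zeta> * modulation (e n *\<^sub>R u) \<zeta> \<partial>lborel) = gaussian pi u"
        by (simp add: fourier_gaussian)
    qed
    finally show ?thesis .
  qed
  obtain C where "seminorm_bound 0 f C" using schwartz_bound_ex[OF f] by blast
  then have C: "norm (f x) \<le> C" for x using seminorm_bound_le_const[of 0 f C "[]" x] by simp
  have fc: "continuous_on UNIV f" using smooth_continuous[OF schwartz_smooth[OF f], of "[]"] by simp
  have "(\<lambda>n. \<integral>u. f (y + e n *\<^sub>R u) * gaussian pi u \<partial>lborel) \<longlonglongrightarrow> (\<integral>u. f y * gaussian pi (u :: 'a) \<partial>lborel)"
  proof (rule integral_dominated_convergence[where w="\<lambda>u :: 'a. C * norm (gaussian pi u)"])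
    show "AE u in lborel. (\<lambda>n. f (y + e n *\<^sub>R u) * gaussian pi u) \<longlonglongrightarrow> f y * gaussian pi u"
    proof (intro AE_I2)
      fix u :: 'a
      have "(\<lambda>n. y + e n *\<^sub>R u) \<longlonglongrightarrow> y + 0 *\<^sub>R u" by (intro tendsto_intros e)
      then have "(\<lambda>n. f (y + e n *\<^sub>R u)) \<longlonglongrightarrow> f y" by (intro continuous_on_tendsto_compose[OF fc]) auto
      then show "(\<lambda>n. f (y + e n *\<^sub>R u) * gaussian pi u) \<longlonglongrightarrow> f y * gaussian pi u" by (intro tendsto_intros)
    qed
    show "AE u in lborel. norm (f (y + e n *\<^sub>R u) * gaussian pi u) \<le> C * norm (gaussian pi u)" for n
      using C by (intro AE_I2) (auto simp: norm_mult intro!: mult_right_mono)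
    show "integrable lborel (\<lambda>u :: 'a. C * norm (gaussian pi u))"
      by (intro integrable_mult_right integrable_norm gi) simp
  qed auto
  then have "(\<lambda>n. \<integral>\<zeta>. fourier f \<zeta> * modulation (- \<zeta>) y * G n \<zeta> \<partial>lborel) \<longlonglongrightarrow> f y"
    unfolding 2 by (simp add: integral_gaussian)
  from LIMSEQ_unique[OF 1 this] show ?thesis .
qed

lemma schwartz_family_stft:
  fixes g h k :: "'a::euclidean_space \<Rightarrow> complex"
  assumes "g \<in> schwartz" "h \<in> schwartz" "k \<in> schwartz"
  shows "schwartz_family (\<lambda>p y. stft g h p * wave_packet k (fst p) (- snd p) y)"
proof (rule schwartz_family_wave_packet[where L=1])
  show "norm (fst p) \<le> 1 * (1 + norm p)" "norm (- snd p) \<le> 1 * (1 + norm p)" for p :: "'a \<times> 'a"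
    using norm_fst_le[of "fst p" "snd p"] norm_snd_le[of "snd p" "fst p"] by auto
  show "\<exists>C. \<forall>p. norm (stft g h p) \<le> C / (1 + norm p) ^ M" for M by (intro stft_rapid_decay assms)
  show "continuous_on UNIV (stft g h)" by (intro stft_continuous assms)
qed (intro assms continuous_intros)+

text \<open>For fixed z the frequency integral is Fourier inversion for h times the conjugated
  shifted window, evaluated at y. It returns h(y) |g(y - z)|^2, and the normalisation of g removes
  the integral over z.\<close>

theorem stft_inversion:
  fixes g h :: "'a::euclidean_space \<Rightarrow> complex"
  assumes g: "g \<in> schwartz" and h: "h \<in> schwartz" and g1: "(\<integral>y. (norm (g y))\<^sup>2 \<partial>lborel) = 1"
  shows "(\<integral>p. stft g h p * wave_packet g (fst p) (- snd p) y \<partial>lborel) = h y"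
proof -
  have gm[measurable]: "g \<in> borel_measurable borel" by (rule schwartz_borel_measurable[OF g])
  have sm[measurable]: "stft g h \<in> borel_measurable borel"
    by (intro borel_measurable_continuous_onI stft_continuous g h)
  have "integrable lborel (\<lambda>p. stft g h p * wave_packet g (fst p) (- snd p) y)"
    using schwartz_family_integrable[OF schwartz_family_stft[OF g h g], of "[]" y] by simp
  then have i: "integrable (lborel \<Otimes>\<^sub>M lborel) (\<lambda>(z, \<zeta>). stft g h (z, \<zeta>) * wave_packet g z (- \<zeta>) y)"
    by (simp add: lborel_prod case_prod_unfold)
  have "(\<integral>p. stft g h p * wave_packet g (fst p) (- snd p) y \<partial>lborel)
    = (\<integral>z. (\<integral>\<zeta>. stft g h (z, \<zeta>) * wave_packet g z (- \<zeta>) y \<partial>lborel) \<partial>lborel)"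
    by (subst lborel_pair.integral_fst[OF i]) (simp add: lborel_prod case_prod_unfold)
  also have "\<dots> = (\<integral>z. h y * of_real ((norm (g (y - z)))\<^sup>2) \<partial>lborel)"
  proof (intro Bochner_Integration.integral_cong refl)
    fix z
    have "(\<integral>\<zeta>. stft g h (z, \<zeta>) * wave_packet g z (- \<zeta>) y \<partial>lborel)
      = (\<integral>\<zeta>. g (y - z) * (fourier (\<lambda>y. h y * cnj (g (y - z))) \<zeta> * modulation (- \<zeta>) y) \<partial>lborel)"
      by (intro Bochner_Integration.integral_cong refl) (simp add: stft_def wave_packet_def mult_ac)
    also have "\<dots> = g (y - z) * (h y * cnj (g (y - z)))"
      by (simp add: fourier_inversion[OF schwartz_stft_integrand[OF g h]])
    finally show "(\<integral>\<zeta>. stft g h (z, \<zeta>) * wave_packet g z (- \<zeta>) y \<partial>lborel) = h y * of_real ((norm (g (y - z)))\<^sup>2)"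
      unfolding complex_norm_square by (simp only: mult_ac)
  qed
  also have "\<dots> = h y * of_real (\<integral>z. (norm (g (y - z)))\<^sup>2 \<partial>lborel)"
    by (simp only: integral_mult_right_zero integral_complex_of_real)
  also have "(\<integral>z. (norm (g (y - z)))\<^sup>2 \<partial>lborel) = 1"
    using integral_lborel_affine[of "\<lambda>x. (norm (g x))\<^sup>2" "-1" y] g1 by simp
  finally show ?thesis by simp
qed

subsection \<open>Amalgam norms and change of window\<close>

lemma modulation_commute: "modulation x y = modulation y x"
  by (simp add: modulation_def inner_commute)

lemma continuous_on_tempered_wave_packet:
  fixes T :: "'a::euclidean_space distribution"
  assumes T: "tempered T" and g: "g \<in> schwartz"
  shows "continuous_on UNIV (\<lambda>p. T (wave_packet g (fst p) (snd p)))"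
proof (rule tempered_family_continuous[OF _ _ _ T])
  show "wave_packet g (fst p) (snd p) \<in> schwartz" for p by (rule schwartz_wave_packet[OF g])
  show "continuous_on UNIV (\<lambda>(p, y). partial_derivs bs (wave_packet g (fst p) (snd p)) y)" if "set bs \<subseteq> Basis" for bs
    unfolding case_prod_beta
    by (intro continuous_on_partial_derivs_wave_packet schwartz_smooth g that continuous_intros)
  show "\<exists>C. \<forall>p. norm p \<le> r \<longrightarrow> seminorm_bound N (wave_packet g (fst p) (snd p)) C" for N r
  proof -
    obtain B where B: "seminorm_bound N g B" using schwartz_bound_ex[OF g] by blast
    have "seminorm_bound N (wave_packet g (fst p) (snd p)) ((4 * pi) ^ N * ((1 + r) * (1 + r)) ^ N * B)"
      if "norm p \<le> r" for p
    proof (rule seminorm_bound_mono[OF seminorm_bound_wave_packet[OF schwartz_smooth[OF g] B] order_refl])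
      have "norm (fst p) \<le> r" "norm (snd p) \<le> r"
        using that norm_fst_le[of "fst p" "snd p"] norm_snd_le[of "snd p" "fst p"] by auto
      moreover have "0 \<le> r" using order_trans[OF norm_ge_zero that] .
      ultimately show "(4 * pi) ^ N * ((1 + norm (fst p)) * (1 + norm (snd p))) ^ N * B \<le> (4 * pi) ^ N * ((1 + r) * (1 + r)) ^ N * B"
        using seminorm_bound_nonneg[OF B] by (intro mult_right_mono mult_left_mono power_mono mult_mono) (auto simp: add_nonneg_nonneg)
    qed
    then show ?thesis by blast
  qed
qed

lemma borel_measurable_tempered_wave_packet:
  assumes "tempered T" "g \<in> schwartz" and [measurable]: "a \<in> borel_measurable M" "b \<in> borel_measurable M"
  shows "(\<lambda>w. T (wave_packet g (a w) (b w))) \<in> borel_measurable M"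
  using borel_measurable_continuous_Pair[OF assms(3,4), of "\<lambda>x \<xi>. T (wave_packet g x \<xi>)"]
    continuous_on_tempered_wave_packet[OF assms(1,2)] by simp

lemma tempered_wave_packet_growth:
  assumes T: "tempered T" and g: "g \<in> schwartz"
  shows "\<exists>C N. \<forall>\<xi>. norm (T (wave_packet g x \<xi>)) \<le> C * (1 + norm \<xi>) ^ N"
proof -
  obtain C N where C: "0 \<le> C" "\<And>\<phi> B. \<phi> \<in> schwartz \<Longrightarrow> seminorm_bound N \<phi> B \<Longrightarrow> norm (T \<phi>) \<le> C * B"
    using tempered_bound[OF T] by metis
  obtain B where B: "seminorm_bound N g B" using schwartz_bound_ex[OF g] by blast
  have "norm (T (wave_packet g x \<xi>)) \<le> (C * (4 * pi) ^ N * (1 + norm x) ^ N * B) * (1 + norm \<xi>) ^ N" for \<xi>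
    using C(2)[OF schwartz_wave_packet[OF g] seminorm_bound_wave_packet[OF schwartz_smooth[OF g] B], of x \<xi>]
    by (simp add: power_mult_distrib mult_ac)
  then show ?thesis by blast
qed

lemma schwartz_rapid_decay:
  assumes "f \<in> schwartz"
  shows "\<exists>C. \<forall>y. norm (f y) \<le> C / (1 + norm y) ^ M"
  using seminorm_bound_le[OF seminorm_bound_schwartz_norm[OF assms], of "[]" M] by auto

lemma schwartz_continuous_on: "f \<in> schwartz \<Longrightarrow> continuous_on A f"
  using smooth_continuous[OF schwartz_smooth, of f "[]"] by simp

text \<open>Writing out the Fourier integral of \<phi> displays its product with the shifted window
  as a superposition of packets with coefficients \<open>\<phi> \<xi>\<close>, and T may be taken
  under this integral.\<close>

lemma represents_wave_packet:
  fixes T :: "'a::euclidean_space distribution"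
  assumes T: "tempered T" and g: "g \<in> schwartz"
  shows "represents (\<lambda>\<xi>. T (wave_packet g x \<xi>)) (dist_fourier (dist_mult T (translate x g)))"
  unfolding represents_def
proof (intro conjI ballI)
  show "(\<lambda>\<xi>. T (wave_packet g x \<xi>)) \<in> borel_measurable lborel"
    by (intro borel_measurable_tempered_wave_packet T g) auto
  fix \<phi> :: "'a \<Rightarrow> complex" assume \<phi>: "\<phi> \<in> schwartz"
  have K: "schwartz_family (\<lambda>\<xi> y. \<phi> \<xi> * wave_packet g x \<xi> y)"
  proof (rule schwartz_family_wave_packet[where L="1 + norm x"])
    show "\<exists>C. \<forall>z. norm (\<phi> z) \<le> C / (1 + norm z) ^ M" for M by (rule schwartz_rapid_decay[OF \<phi>])
    show "norm x \<le> (1 + norm x) * (1 + norm z)" "norm z \<le> (1 + norm x) * (1 + norm z)" for z :: 'a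
      by (auto simp: algebra_simps)
  qed (intro g schwartz_continuous_on \<phi> continuous_intros)+
  have lin: "T (\<lambda>y. \<phi> \<xi> * wave_packet g x \<xi> y) = T (wave_packet g x \<xi>) * \<phi> \<xi>" for \<xi>
    using tempered_cmult[OF T schwartz_wave_packet[OF g]] by simp
  show "integrable lborel (\<lambda>\<xi>. T (wave_packet g x \<xi>) * \<phi> \<xi>)"
    using tempered_integral_family(2)[OF T K] unfolding lin .
  have "(\<lambda>y. translate x g y * fourier \<phi> y) = (\<lambda>y. \<integral>\<xi>. \<phi> \<xi> * wave_packet g x \<xi> y \<partial>lborel)"
  proof
    fix y
    have "translate x g y * fourier \<phi> y = (\<integral>\<xi>. translate x g y * (\<phi> \<xi> * modulation y \<xi>) \<partial>lborel)"
      unfolding fourier_eq by (rule integral_mult_right_zero[symmetric])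
    also have "\<dots> = (\<integral>\<xi>. \<phi> \<xi> * wave_packet g x \<xi> y \<partial>lborel)"
      by (intro Bochner_Integration.integral_cong refl)
        (simp add: translate_def wave_packet_def modulation_commute[of y] mult_ac)
    finally show "translate x g y * fourier \<phi> y = (\<integral>\<xi>. \<phi> \<xi> * wave_packet g x \<xi> y \<partial>lborel)" .
  qed
  then have "dist_fourier (dist_mult T (translate x g)) \<phi> = T (\<lambda>y. \<integral>\<xi>. \<phi> \<xi> * wave_packet g x \<xi> y \<partial>lborel)"
    by (simp add: dist_fourier_def dist_mult_def)
  also have "\<dots> = (\<integral>\<xi>. T (wave_packet g x \<xi>) * \<phi> \<xi> \<partial>lborel)"
    unfolding tempered_integral_family(1)[OF T K] lin ..
  finally show "dist_fourier (dist_mult T (translate x g)) \<phi> = (\<integral>\<xi>. T (wave_packet g x \<xi>) * \<phi> \<xi> \<partial>lborel)" .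
qed

text \<open>Fatou's lemma for finite p; for p = \<infinity> the countably many exceptional null sets
  are united.\<close>

lemma Lp_norm_limit_le:
  fixes F :: "nat \<Rightarrow> 'a::euclidean_space \<Rightarrow> complex"
  assumes [measurable]: "\<And>n. F n \<in> borel_measurable lborel" "G \<in> borel_measurable lborel"
    and lim: "\<And>x. (\<lambda>n. F n x) \<longlonglongrightarrow> G x" and le: "\<And>n. Lp_norm p (F n) \<le> C" and p: "1 \<le> p"
  shows "Lp_norm p G \<le> C"
proof (cases "p = \<infinity>")
  case True
  have "AE x in lborel. ennreal (norm (F n x)) \<le> C" for n
    using esssup_AE[of "\<lambda>x. ennreal (norm (F n x))" lborel] le[of n] True
    by (auto simp: Lp_norm_def eLp_norm_def elim!: eventually_mono intro: order_trans)
  then have "AE x in lborel. \<forall>n. ennreal (norm (F n x)) \<le> C" by (simp add: AE_all_countable)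
  then have "AE x in lborel. ennreal (norm (G x)) \<le> C"
  proof eventually_elim
    case (elim x)
    have "(\<lambda>n. ennreal (norm (F n x))) \<longlonglongrightarrow> ennreal (norm (G x))"
      by (intro tendsto_ennrealI tendsto_norm lim)
    then show ?case by (rule LIMSEQ_le_const2) (use elim in auto)
  qed
  then show ?thesis using True by (auto simp: Lp_norm_def eLp_norm_def intro!: esssup_I)
next
  case False
  then obtain r where r: "p = ennreal r" "1 \<le> r"
    using p by (cases p) (auto simp: ennreal_le_iff2 simp flip: ennreal_1)
  have Lp: "Lp_norm p H = ennreal_powr (\<integral>\<^sup>+x. ennreal (norm (H x) powr r) \<partial>lborel) (1 / r)" for H :: "'a \<Rightarrow> complex"
    using r by (simp add: Lp_norm_def eLp_norm_def ennreal_powr_ennreal)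
  have le': "(\<integral>\<^sup>+x. ennreal (norm (F n x) powr r) \<partial>lborel) \<le> ennreal_powr C r" for n
    using ennreal_powr_mono[OF le[of n], of r] r(2) unfolding Lp ennreal_powr_powr by simp
  have "(\<integral>\<^sup>+x. ennreal (norm (G x) powr r) \<partial>lborel) = (\<integral>\<^sup>+x. liminf (\<lambda>n. ennreal (norm (F n x) powr r)) \<partial>lborel)"
  proof (intro nn_integral_cong)
    fix x
    have "(\<lambda>n. ennreal (norm (F n x) powr r)) \<longlonglongrightarrow> ennreal (norm (G x) powr r)"
      using r by (intro tendsto_ennrealI tendsto_powr' tendsto_norm lim tendsto_const) auto
    then show "ennreal (norm (G x) powr r) = liminf (\<lambda>n. ennreal (norm (F n x) powr r))"
      by (rule lim_imp_Liminf[OF trivial_limit_sequentially, symmetric])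
  qed
  also have "\<dots> \<le> liminf (\<lambda>n. \<integral>\<^sup>+x. ennreal (norm (F n x) powr r) \<partial>lborel)"
    by (intro nn_integral_liminf) measurable
  also have "\<dots> \<le> ennreal_powr C r"
    using le' by (intro Liminf_le) auto
  finally have "Lp_norm p G \<le> ennreal_powr (ennreal_powr C r) (1 / r)"
    unfolding Lp using r by (intro ennreal_powr_mono) auto
  then show ?thesis using r by (simp add: ennreal_powr_powr)
qed

text \<open>Two functions representing one distribution have the same mollifications.\<close>

lemma represents_Lp_norm_le:
  fixes F V :: "'a::euclidean_space \<Rightarrow> complex"
  assumes F: "represents F S" and V: "represents V S"
    and cont: "continuous_on UNIV V" and growth: "\<And>\<xi>. norm (V \<xi>) \<le> C * (1 + norm \<xi>) ^ N" and p: "1 \<le> p"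
  shows "Lp_norm p V \<le> Lp_norm p F"
proof -
  have [measurable]: "F \<in> borel_measurable borel" "V \<in> borel_measurable borel"
    using F V by (auto simp: represents_def)
  have [measurable]: "gaussian c \<in> borel_measurable borel" for c unfolding gaussian_def[abs_def] by measurable
  have gs: "gaussian pi \<in> schwartz" by (intro schwartz_gaussian) simp
  have C0: "0 \<le> C" using order_trans[OF norm_ge_zero growth[of 0]] by simp
  define e where "e n = 1 / real (Suc n)" for n
  have e: "0 < e n" "e n \<le> 1" for n unfolding e_def by auto
  have e0: "e \<longlonglongrightarrow> 0" unfolding e_def using LIMSEQ_inverse_real_of_nat by (auto simp: inverse_eq_divide)
  \<comment> \<open>Gaussian averages of V at scale \<open>e n\<close>. Testing the common
    distribution on translated Gaussians shows that they are also the averages of F.\<close>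
  define A where "A n \<xi> = (\<integral>u. V (\<xi> + (- e n) *\<^sub>R u) * gaussian pi u \<partial>lborel)" for n \<xi>
  have mollify: "(\<integral>\<eta>. H \<eta> * gaussian (pi / (e n)\<^sup>2) (\<eta> - \<xi>) \<partial>lborel) = e n ^ DIM('a) *\<^sub>R (\<integral>u. H (\<xi> + (- e n) *\<^sub>R u) * gaussian pi u \<partial>lborel)"
    if [measurable]: "H \<in> borel_measurable borel" for H :: "'a \<Rightarrow> complex" and n \<xi>
  proof -
    have "(\<integral>\<eta>. H \<eta> * gaussian (pi / (e n)\<^sup>2) (\<eta> - \<xi>) \<partial>lborel)
      = \<bar>- e n\<bar> ^ DIM('a) *\<^sub>R (\<integral>u. H (\<xi> + (- e n) *\<^sub>R u) * gaussian (pi / (e n)\<^sup>2) (\<xi> + (- e n) *\<^sub>R u - \<xi>) \<partial>lborel)"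
      using e(1)[of n] by (intro integral_lborel_affine[where f="\<lambda>\<eta>. H \<eta> * gaussian (pi / (e n)\<^sup>2) (\<eta> - \<xi>)"]) auto
    moreover have "gaussian (pi / (e n)\<^sup>2) (\<xi> + (- e n) *\<^sub>R u - \<xi>) = gaussian pi u" for u
      using e(1)[of n] by (simp add: gaussian_def power_mult_distrib)
    ultimately show ?thesis using e(1)[of n] by simp
  qed
  have AF: "A n \<xi> = (\<integral>u. F (\<xi> + (- e n) *\<^sub>R u) * gaussian pi u \<partial>lborel)" for n \<xi>
  proof -
    have ks: "(\<lambda>\<eta>. gaussian (pi / (e n)\<^sup>2) (\<eta> - \<xi>)) \<in> schwartz"
      using e(1)[of n] by (intro schwartz_translate schwartz_gaussian) simp
    have "(\<integral>\<eta>. F \<eta> * gaussian (pi / (e n)\<^sup>2) (\<eta> - \<xi>) \<partial>lborel) = (\<integral>\<eta>. V \<eta> * gaussian (pi / (e n)\<^sup>2) (\<eta> - \<xi>) \<partial>lborel)"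
      using bspec[OF conjunct2[OF F[unfolded represents_def]] ks] bspec[OF conjunct2[OF V[unfolded represents_def]] ks] by simp
    then show ?thesis using e(1)[of n] by (simp add: A_def mollify)
  qed
  show ?thesis
  proof (rule Lp_norm_limit_le[where F=A, OF _ _ _ _ p])
    show "A n \<in> borel_measurable lborel" for n unfolding A_def by measurable
    show "V \<in> borel_measurable lborel" by simp
    show "(\<lambda>n. A n \<xi>) \<longlonglongrightarrow> V \<xi>" for \<xi>
    proof -
      have "(\<lambda>n. A n \<xi>) \<longlonglongrightarrow> (\<integral>u. V \<xi> * gaussian pi (u :: 'a) \<partial>lborel)"
        unfolding A_def
      proof (rule integral_dominated_convergence[where w="\<lambda>u :: 'a. C * (1 + norm \<xi>) ^ N * ((1 + norm u) ^ N * norm (gaussian pi u))"])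
        show "AE u in lborel. (\<lambda>n. V (\<xi> + (- e n) *\<^sub>R u) * gaussian pi u) \<longlonglongrightarrow> V \<xi> * gaussian pi u"
        proof (intro AE_I2)
          fix u :: 'a
          have "(\<lambda>n. \<xi> + (- e n) *\<^sub>R u) \<longlonglongrightarrow> \<xi> + (- 0) *\<^sub>R u" by (intro tendsto_intros e0)
          then have "(\<lambda>n. V (\<xi> + (- e n) *\<^sub>R u)) \<longlonglongrightarrow> V \<xi>" by (intro continuous_on_tendsto_compose[OF cont]) auto
          then show "(\<lambda>n. V (\<xi> + (- e n) *\<^sub>R u) * gaussian pi u) \<longlonglongrightarrow> V \<xi> * gaussian pi u" by (intro tendsto_intros)
        qed
        show "AE u in lborel. norm (V (\<xi> + (- e n) *\<^sub>R u) * gaussian pi u) \<le> C * (1 + norm \<xi>) ^ N * ((1 + norm u) ^ N * norm (gaussian pi u))" for n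
        proof (intro AE_I2)
          fix u :: 'a
          have "norm (\<xi> + (- e n) *\<^sub>R u) \<le> norm \<xi> + e n * norm u"
            using norm_triangle_ineq[of \<xi> "(- e n) *\<^sub>R u"] e(1)[of n] by simp
          also have "\<dots> \<le> norm \<xi> + 1 * norm u" by (intro add_left_mono mult_right_mono e) simp
          also have "\<dots> \<le> norm \<xi> + norm u + norm \<xi> * norm u" by simp
          finally have "1 + norm (\<xi> + (- e n) *\<^sub>R u) \<le> (1 + norm \<xi>) * (1 + norm u)" by (simp add: algebra_simps)
          then have "(1 + norm (\<xi> + (- e n) *\<^sub>R u)) ^ N \<le> ((1 + norm \<xi>) * (1 + norm u)) ^ N"
            by (intro power_mono) auto
          then have "C * (1 + norm (\<xi> + (- e n) *\<^sub>R u)) ^ N \<le> C * ((1 + norm \<xi>) * (1 + norm u)) ^ N"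
            using C0 by (rule mult_left_mono)
          then have "norm (V (\<xi> + (- e n) *\<^sub>R u)) \<le> C * ((1 + norm \<xi>) * (1 + norm u)) ^ N"
            using growth[of "\<xi> + (- e n) *\<^sub>R u"] by linarith
          then have "norm (V (\<xi> + (- e n) *\<^sub>R u)) * norm (gaussian pi u) \<le> C * ((1 + norm \<xi>) * (1 + norm u)) ^ N * norm (gaussian pi u)"
            by (rule mult_right_mono) simp
          then show "norm (V (\<xi> + (- e n) *\<^sub>R u) * gaussian pi u) \<le> C * (1 + norm \<xi>) ^ N * ((1 + norm u) ^ N * norm (gaussian pi u))"
            by (simp add: norm_mult power_mult_distrib mult_ac)
        qed
        show "integrable lborel (\<lambda>u :: 'a. C * (1 + norm \<xi>) ^ N * ((1 + norm u) ^ N * norm (gaussian pi u)))"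
        proof (rule integrable_mult_right)
          obtain D where D: "\<And>u. norm (gaussian pi u) \<le> D / (1 + norm (u :: 'a)) ^ (N + 2 * DIM('a))"
            using schwartz_rapid_decay[OF gs] by blast
          show "integrable lborel (\<lambda>u :: 'a. (1 + norm u) ^ N * norm (gaussian pi u))"
          proof (rule integrable_decay)
            fix u :: 'a
            have "(1 + norm u) ^ N * norm (gaussian pi u) \<le> (1 + norm u) ^ N * (D / (1 + norm u) ^ (N + 2 * DIM('a)))"
              by (intro mult_left_mono D) auto
            also have "\<dots> = D / (1 + norm u) ^ (2 * DIM('a))"
              using norm_ge_zero[of u] by (simp add: power_add)
            finally show "norm ((1 + norm u) ^ N * norm (gaussian pi u)) \<le> D / (1 + norm u) ^ (2 * DIM('a))" by simp
          qed simp
        qed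
      qed auto
      then show ?thesis by (simp add: integral_gaussian)
    qed
    \<comment> \<open>Averaging against a probability density does not increase the L^p norm:
      Minkowski's inequality and translation invariance.\<close>
    show "Lp_norm p (A n) \<le> Lp_norm p F" for n
    proof -
      let ?F = "\<lambda>x. ennreal (norm (F x))" and ?g = "\<lambda>u. ennreal (norm (gaussian pi (u :: 'a)))"
      have "ennreal (norm (A n \<xi>)) \<le> (\<integral>\<^sup>+u. ?g u * ?F (\<xi> + (- e n) *\<^sub>R u) \<partial>lborel)" for \<xi>
      proof (cases "integrable lborel (\<lambda>u. F (\<xi> + (- e n) *\<^sub>R u) * gaussian pi u)")
        case True
        then show ?thesis unfolding AF
          by (rule order_trans[OF integral_norm_bound_ennreal]) (simp add: norm_mult ennreal_mult mult.commute)
      next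
        \<comment> \<open>The Bochner integral of a function that is not integrable has the value 0,
          so the bound is trivial.\<close>
        case False
        then show ?thesis by (simp add: AF not_integrable_integral_eq)
      qed
      then have "Lp_norm p (A n) \<le> eLp_norm p (\<lambda>\<xi>. \<integral>\<^sup>+u. ?g u * ?F (\<xi> + (- e n) *\<^sub>R u) \<partial>lborel)"
        unfolding Lp_norm_def A_def by (intro eLp_norm_mono_AE AE_I2) (auto simp: A_def)
      also have "\<dots> \<le> (\<integral>\<^sup>+u. eLp_norm p (\<lambda>\<xi>. ?g u * ?F (\<xi> + (- e n) *\<^sub>R u)) \<partial>lborel)"
        by (intro eLp_norm_minkowski lborel.sigma_finite_measure_axioms p) measurable
      also have "\<dots> \<le> (\<integral>\<^sup>+u. ?g u * eLp_norm p ?F \<partial>lborel)"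
      proof (intro nn_integral_mono)
        fix u :: 'a
        have "eLp_norm p (\<lambda>\<xi>. ?g u * ?F (\<xi> + (- e n) *\<^sub>R u)) \<le> ?g u * eLp_norm p (\<lambda>\<xi>. ?F (\<xi> + (- e n) *\<^sub>R u))"
          by (intro eLp_norm_cmult_le p) measurable
        also have "\<dots> \<le> ?g u * eLp_norm p ?F"
          by (intro mult_left_mono eLp_norm_translate_le[where F="?F"] p) auto
        finally show "eLp_norm p (\<lambda>\<xi>. ?g u * ?F (\<xi> + (- e n) *\<^sub>R u)) \<le> ?g u * eLp_norm p ?F" .
      qed
      also have "\<dots> = (\<integral>\<^sup>+u. ?g u \<partial>lborel) * eLp_norm p ?F"
        by (rule nn_integral_multc) measurable
      also have "(\<integral>\<^sup>+u. ?g u \<partial>lborel) = 1"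
      proof -
        have gi: "integrable lborel (gaussian pi :: 'a \<Rightarrow> complex)" by (intro integrable_schwartz gs)
        have "complex_of_real (\<integral>u. norm (gaussian pi (u :: 'a)) \<partial>lborel) = (\<integral>u. gaussian pi (u :: 'a) \<partial>lborel)"
          unfolding integral_complex_of_real[symmetric] by (intro Bochner_Integration.integral_cong refl) (simp add: gaussian_def)
        then have "(\<integral>u. norm (gaussian pi (u :: 'a)) \<partial>lborel) = 1"
          unfolding integral_gaussian by (metis of_real_eq_1_iff)
        then show ?thesis using integrable_norm[OF gi] by (subst nn_integral_eq_integral) auto
      qed
      finally show ?thesis by (simp add: Lp_norm_def)
    qed
  qed
qed

text \<open>The packet function V is one competitor in the infimum. Against any other representing
  function it wins because it is continuous of polynomial growth, so its mollifications converge
  back to it pointwise.\<close>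

lemma FLp_norm_eq:
  assumes T: "tempered T" and g: "g \<in> schwartz" and p: "1 \<le> p"
  shows "FLp_norm p (dist_mult T (translate x g)) = Lp_norm p (\<lambda>\<xi>. T (wave_packet g x \<xi>))"
  unfolding FLp_norm_def
proof (intro antisym INF_greatest)
  note V = represents_wave_packet[OF T g, of x]
  show "(INF F\<in>{F. represents F (dist_fourier (dist_mult T (translate x g)))}. Lp_norm p F) \<le> Lp_norm p (\<lambda>\<xi>. T (wave_packet g x \<xi>))"
    using V by (intro INF_lower) simp
  fix F assume F: "F \<in> {F. represents F (dist_fourier (dist_mult T (translate x g)))}"
  obtain C N where "\<And>\<xi>. norm (T (wave_packet g x \<xi>)) \<le> C * (1 + norm \<xi>) ^ N"
    using tempered_wave_packet_growth[OF T g] by blast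
  moreover have "continuous_on UNIV (\<lambda>\<xi>. T (wave_packet g x \<xi>))"
    using continuous_on_compose2[OF continuous_on_tempered_wave_packet[OF T g], of UNIV "\<lambda>\<xi>. (x, \<xi>)"]
    by (simp add: continuous_on_Pair continuous_on_const continuous_on_id)
  ultimately show "Lp_norm p (\<lambda>\<xi>. T (wave_packet g x \<xi>)) \<le> Lp_norm p F"
    using F by (intro represents_Lp_norm_le[OF _ V _ _ p]) auto
qed

lemma amalgam_norm_eq:
  assumes "tempered T" "g \<in> schwartz" "1 \<le> p"
  shows "amalgam_norm g p q T = eLp_norm q (\<lambda>x. eLp_norm p (\<lambda>\<xi>. ennreal (norm (T (wave_packet g x \<xi>)))))"
  unfolding amalgam_norm_def FLp_norm_eq[OF assms] Lp_norm_def ..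

section \<open>Change of window\<close>

lemma modulation_add: "modulation (\<xi> + \<zeta>) y = modulation \<xi> y * modulation \<zeta> y"
  by (simp add: modulation_def cis_mult inner_add_right algebra_simps)

lemma modulation_add_right: "modulation \<xi> (x + y) = modulation \<xi> x * modulation \<xi> y"
  by (simp add: modulation_def cis_mult inner_add_left algebra_simps)

text \<open>The inversion formula expands h in packets of g. Shifting this expansion in phase space
  to (x, \<xi>) and applying T under the integral bounds one transform of T by a convolution-type
  average of the other.\<close>

lemma tempered_window_change:
  fixes T :: "'a::euclidean_space distribution"
  assumes T: "tempered T" and g: "g \<in> schwartz" and h: "h \<in> schwartz" and g1: "(\<integral>y. (norm (g y))\<^sup>2 \<partial>lborel) = 1"
  shows "ennreal (norm (T (wave_packet h x \<xi>)))
    \<le> (\<integral>\<^sup>+w. ennreal (norm (stft g h w)) * ennreal (norm (T (wave_packet g (x + fst w) (\<xi> - snd w)))) \<partial>lborel)"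
proof -
  \<comment> \<open>The expansion is centred at x, so its modulations act on y - x. The extra phase
    moves them to y and does not affect the modulus.\<close>
  define c where "c w = stft g h w * modulation (- snd w) (- x)" for w
  have cn: "norm (c w) = norm (stft g h w)" for w by (simp add: c_def norm_mult)
  have K: "schwartz_family (\<lambda>w y. c w * wave_packet g (x + fst w) (\<xi> - snd w) y)"
  proof (rule schwartz_family_wave_packet[where L="1 + norm x + norm \<xi>"])
    show "continuous_on UNIV c"
      unfolding c_def by (intro continuous_intros stft_continuous g h)
    show "\<exists>C. \<forall>z. norm (c z) \<le> C / (1 + norm z) ^ M" for M
      unfolding cn by (rule stft_rapid_decay[OF g h])
    fix w :: "'a \<times> 'a"
    have f: "norm (fst w) \<le> norm w" "norm (snd w) \<le> norm w"
      using norm_fst_le[of "fst w" "snd w"] norm_snd_le[of "snd w" "fst w"] by auto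
    have r: "norm x + norm w \<le> (1 + norm x + norm \<xi>) * (1 + norm w)" "norm \<xi> + norm w \<le> (1 + norm x + norm \<xi>) * (1 + norm w)"
      by (auto simp: algebra_simps)
    show "norm (x + fst w) \<le> (1 + norm x + norm \<xi>) * (1 + norm w)"
      using norm_triangle_ineq[of x "fst w"] f r by linarith
    show "norm (\<xi> - snd w) \<le> (1 + norm x + norm \<xi>) * (1 + norm w)"
      using norm_triangle_ineq4[of \<xi> "snd w"] f r by linarith
  qed (intro g continuous_intros)+
  have "wave_packet h x \<xi> y = (\<integral>w. c w * wave_packet g (x + fst w) (\<xi> - snd w) y \<partial>lborel)" for y
  proof -
    have "wave_packet h x \<xi> y = (\<integral>w. stft g h w * wave_packet g (fst w) (- snd w) (y - x) \<partial>lborel) * modulation \<xi> y"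
      unfolding stft_inversion[OF g h g1] by (simp add: wave_packet_def)
    also have "\<dots> = (\<integral>w. stft g h w * wave_packet g (fst w) (- snd w) (y - x) * modulation \<xi> y \<partial>lborel)"
      by (rule integral_mult_left_zero[symmetric])
    also have "\<dots> = (\<integral>w. c w * wave_packet g (x + fst w) (\<xi> - snd w) y \<partial>lborel)"
    proof (intro Bochner_Integration.integral_cong refl)
      fix w :: "'a \<times> 'a"
      have "modulation (- snd w) (y - x) = modulation (- snd w) y * modulation (- snd w) (- x)"
        using modulation_add_right[of "- snd w" y "- x"] by simp
      moreover have "modulation (\<xi> - snd w) y = modulation \<xi> y * modulation (- snd w) y"
        using modulation_add[of \<xi> "- snd w" y] by simp
      ultimately show "stft g h w * wave_packet g (fst w) (- snd w) (y - x) * modulation \<xi> y = c w * wave_packet g (x + fst w) (\<xi> - snd w) y"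
        by (simp add: c_def wave_packet_def diff_diff_eq mult_ac)
    qed
    finally show ?thesis .
  qed
  then have "wave_packet h x \<xi> = (\<lambda>y. \<integral>w. c w * wave_packet g (x + fst w) (\<xi> - snd w) y \<partial>lborel)" by blast
  then have "T (wave_packet h x \<xi>) = (\<integral>w. T (\<lambda>y. c w * wave_packet g (x + fst w) (\<xi> - snd w) y) \<partial>lborel)"
    by (simp only: tempered_integral_family(1)[OF T K])
  then have "ennreal (norm (T (wave_packet h x \<xi>))) \<le> (\<integral>\<^sup>+w. ennreal (norm (T (\<lambda>y. c w * wave_packet g (x + fst w) (\<xi> - snd w) y))) \<partial>lborel)"
    using integral_norm_bound_ennreal[OF tempered_integral_family(2)[OF T K]] by simp
  also have "\<dots> = (\<integral>\<^sup>+w. ennreal (norm (stft g h w)) * ennreal (norm (T (wave_packet g (x + fst w) (\<xi> - snd w)))) \<partial>lborel)"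
    by (intro nn_integral_cong) (simp add: tempered_cmult[OF T schwartz_wave_packet[OF g]] norm_mult cn ennreal_mult)
  finally show ?thesis .
qed

text \<open>The constant is the L^1 norm of \<open>stft g h\<close> over phase space. Minkowski is
  applied in the frequency and then in the position, and both norms are translation invariant, so
  each shift disappears.\<close>

lemma amalgam_norm_window_change:
  fixes g h :: "'a::euclidean_space \<Rightarrow> complex"
  assumes g: "g \<in> schwartz" and h: "h \<in> schwartz" and g1: "(\<integral>y. (norm (g y))\<^sup>2 \<partial>lborel) = 1"
    and p: "1 \<le> p" and q: "1 \<le> q"
  shows "\<exists>C\<ge>0. \<forall>T. tempered T \<longrightarrow> amalgam_norm h p q T \<le> ennreal C * amalgam_norm g p q T"
proof -
  define a where "a w = ennreal (norm (stft g h w))" for w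
  have borel_fst: "(fst :: 'a \<times> 'a \<Rightarrow> 'a) \<in> borel_measurable lborel"
    and borel_snd: "(snd :: 'a \<times> 'a \<Rightarrow> 'a) \<in> borel_measurable lborel"
    by (auto intro!: borel_measurable_continuous_onI continuous_intros)
  have [measurable]: "stft g h \<in> borel_measurable borel"
    by (intro borel_measurable_continuous_onI stft_continuous g h)
  have am[measurable]: "a \<in> borel_measurable borel" unfolding a_def by measurable
  have si: "integrable lborel (stft g h)"
  proof -
    obtain C where "\<And>w. norm (stft g h w) \<le> C / (1 + norm w) ^ (2 * DIM('a \<times> 'a))"
      using stft_rapid_decay[OF g h] by blast
    then show ?thesis by (intro integrable_decay) auto
  qed
  have aC: "(\<integral>\<^sup>+w. a w \<partial>lborel) = ennreal (\<integral>w. norm (stft g h w) \<partial>lborel)"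
    unfolding a_def by (intro nn_integral_eq_integral integrable_norm si) auto
  have "amalgam_norm h p q T \<le> ennreal (\<integral>w. norm (stft g h w) \<partial>lborel) * amalgam_norm g p q T" if T: "tempered T" for T
  proof -
    define F where "F x \<xi> = ennreal (norm (T (wave_packet g x \<xi>)))" for x \<xi>
    define N where "N x = eLp_norm p (F x)" for x
    have Fm[measurable]: "(\<lambda>w. F (\<alpha> w) (\<beta> w)) \<in> borel_measurable M" if "\<alpha> \<in> borel_measurable M" "\<beta> \<in> borel_measurable M" for \<alpha> \<beta> and M :: "'m measure"
      unfolding F_def using borel_measurable_tempered_wave_packet[OF T g that] by measurable
    have Hm: "(\<lambda>w. ennreal (norm (T (wave_packet h (\<alpha> w) (\<beta> w))))) \<in> borel_measurable M" if "\<alpha> \<in> borel_measurable M" "\<beta> \<in> borel_measurable M" for \<alpha> \<beta> and M :: "'m measure"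
      using borel_measurable_tempered_wave_packet[OF T h that] by measurable
    have Nm[measurable]: "N \<in> borel_measurable borel"
    proof -
      have "(\<lambda>(x, \<xi>). F x \<xi>) \<in> borel_measurable (borel \<Otimes>\<^sub>M lborel)"
        unfolding case_prod_beta by (rule Fm) auto
      from borel_measurable_eLp_norm[OF this] show ?thesis unfolding N_def .
    qed
    have inner: "eLp_norm p (\<lambda>\<xi>. ennreal (norm (T (wave_packet h x \<xi>)))) \<le> (\<integral>\<^sup>+w. a w * N (x + fst w) \<partial>lborel)" for x
    proof -
      have mm: "(\<lambda>(w, \<xi>). a w * F (x + fst w) (\<xi> - snd w)) \<in> borel_measurable ((lborel :: ('a \<times> 'a) measure) \<Otimes>\<^sub>M (lborel :: 'a measure))"
        unfolding case_prod_beta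
        by (intro borel_measurable_times_ennreal Fm borel_measurable_add borel_measurable_diff borel_measurable_const
            measurable_compose[OF measurable_fst borel_fst] measurable_compose[OF measurable_fst borel_snd]
            measurable_compose[OF measurable_fst, where g=a]) (use am in auto)
      have "eLp_norm p (\<lambda>\<xi>. ennreal (norm (T (wave_packet h x \<xi>)))) \<le> eLp_norm p (\<lambda>\<xi>. \<integral>\<^sup>+w. a w * F (x + fst w) (\<xi> - snd w) \<partial>lborel)"
        using tempered_window_change[OF T g h g1]
        by (intro eLp_norm_mono_AE AE_I2 Hm) (auto simp: a_def F_def)
      also have "\<dots> \<le> (\<integral>\<^sup>+w. eLp_norm p (\<lambda>\<xi>. a w * F (x + fst w) (\<xi> - snd w)) \<partial>lborel)"
        by (rule eLp_norm_minkowski[OF lborel.sigma_finite_measure_axioms mm p])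
      also have "\<dots> \<le> (\<integral>\<^sup>+w. a w * N (x + fst w) \<partial>lborel)"
      proof (intro nn_integral_mono)
        fix w :: "'a \<times> 'a"
        have "eLp_norm p (\<lambda>\<xi>. a w * F (x + fst w) (\<xi> - snd w)) \<le> a w * eLp_norm p (\<lambda>\<xi>. F (x + fst w) (\<xi> + (- snd w)))"
          unfolding diff_conv_add_uminus by (intro eLp_norm_cmult_le p Fm) auto
        also have "\<dots> \<le> a w * N (x + fst w)"
          unfolding N_def by (intro mult_left_mono eLp_norm_translate_le p Fm) auto
        finally show "eLp_norm p (\<lambda>\<xi>. a w * F (x + fst w) (\<xi> - snd w)) \<le> a w * N (x + fst w)" .
      qed
      finally show ?thesis .
    qed
    have m2: "(\<lambda>(w, x). a w * N (x + fst w)) \<in> borel_measurable ((lborel :: ('a \<times> 'a) measure) \<Otimes>\<^sub>M (lborel :: 'a measure))"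
      unfolding case_prod_beta
      by (intro borel_measurable_times_ennreal measurable_compose[OF _ Nm] borel_measurable_add
          measurable_compose[OF measurable_fst borel_fst] measurable_compose[OF measurable_fst, where g=a]) (use am in auto)
    have m3: "(\<lambda>x. eLp_norm p (\<lambda>\<xi>. ennreal (norm (T (wave_packet h x \<xi>))))) \<in> borel_measurable lborel"
    proof -
      have "(\<lambda>(x, \<xi>). ennreal (norm (T (wave_packet h x \<xi>)))) \<in> borel_measurable ((lborel :: 'a measure) \<Otimes>\<^sub>M lborel)"
        unfolding case_prod_beta by (rule Hm) auto
      from borel_measurable_eLp_norm[OF this] show ?thesis .
    qed
    have "amalgam_norm h p q T \<le> eLp_norm q (\<lambda>x. \<integral>\<^sup>+w. a w * N (x + fst w) \<partial>lborel)"
      unfolding amalgam_norm_eq[OF T h p] using inner by (intro eLp_norm_mono_AE AE_I2 m3)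
    also have "\<dots> \<le> (\<integral>\<^sup>+w. eLp_norm q (\<lambda>x. a w * N (x + fst w)) \<partial>lborel)"
      by (rule eLp_norm_minkowski[OF lborel.sigma_finite_measure_axioms m2 q])
    also have "\<dots> \<le> (\<integral>\<^sup>+w. a w * eLp_norm q N \<partial>lborel)"
    proof (intro nn_integral_mono)
      fix w :: "'a \<times> 'a"
      have "eLp_norm q (\<lambda>x. a w * N (x + fst w)) \<le> a w * eLp_norm q (\<lambda>x. N (x + fst w))"
        by (intro eLp_norm_cmult_le q) measurable
      also have "\<dots> \<le> a w * eLp_norm q N"
        by (intro mult_left_mono eLp_norm_translate_le q) auto
      finally show "eLp_norm q (\<lambda>x. a w * N (x + fst w)) \<le> a w * eLp_norm q N" .
    qed
    also have "\<dots> = (\<integral>\<^sup>+w. a w \<partial>lborel) * eLp_norm q N"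
      by (rule nn_integral_multc) measurable
    also have "eLp_norm q N = amalgam_norm g p q T"
      unfolding amalgam_norm_eq[OF T g p] N_def F_def ..
    finally show ?thesis unfolding aC .
  qed
  then show ?thesis by (intro exI[of _ "\<integral>w. norm (stft g h w) \<partial>lborel"]) (auto intro!: integral_nonneg_AE)
qed

subsection \<open>The space $L^2$\<close>

lemma L2_spaceD: "f \<in> L2_space \<Longrightarrow> f \<in> borel_measurable borel" "f \<in> L2_space \<Longrightarrow> Lp_norm 2 f < \<infinity>"
  by (auto simp: L2_space_def)

lemma Lp_norm_add_le:
  assumes [measurable]: "f \<in> borel_measurable lborel" "h \<in> borel_measurable lborel" and p: "1 \<le> p"
  shows "Lp_norm p (\<lambda>x. f x + h x) \<le> Lp_norm p f + Lp_norm p h"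
proof -
  have "Lp_norm p (\<lambda>x. f x + h x) \<le> eLp_norm p (\<lambda>x. ennreal (norm (f x)) + ennreal (norm (h x)))"
    unfolding Lp_norm_def
    by (intro eLp_norm_mono_AE AE_I2) (auto simp: ennreal_plus[symmetric] norm_triangle_ineq intro!: ennreal_leI simp del: ennreal_plus)
  also have "\<dots> \<le> Lp_norm p f + Lp_norm p h"
    unfolding Lp_norm_def by (intro eLp_norm_add_le p) measurable
  finally show ?thesis .
qed

lemma Lp_norm_cmult_le:
  assumes [measurable]: "f \<in> borel_measurable lborel" and p: "1 \<le> p"
  shows "Lp_norm p (\<lambda>x. c * f x) \<le> ennreal (norm c) * Lp_norm p f"
  using eLp_norm_cmult_le[of "\<lambda>x. ennreal (norm (f x))" p "ennreal (norm c)"] p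
  by (simp add: Lp_norm_def norm_mult ennreal_mult)

lemma one_le_two_ennreal: "1 \<le> (2 :: ennreal)"
  by simp

lemma L2_space_lincomb:
  assumes "f \<in> L2_space" "h \<in> L2_space"
  shows "(\<lambda>x. a * f x + b * h x) \<in> L2_space"
proof -
  have [measurable]: "f \<in> borel_measurable borel" "h \<in> borel_measurable borel"
    using assms L2_spaceD by auto
  have "Lp_norm 2 (\<lambda>x. a * f x + b * h x) \<le> Lp_norm 2 (\<lambda>x. a * f x) + Lp_norm 2 (\<lambda>x. b * h x)"
    by (intro Lp_norm_add_le) auto
  also have "\<dots> \<le> ennreal (norm a) * Lp_norm 2 f + ennreal (norm b) * Lp_norm 2 h"
    by (intro add_mono Lp_norm_cmult_le) auto
  also have "\<dots> < \<infinity>"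
    using L2_spaceD(2)[OF assms(1)] L2_spaceD(2)[OF assms(2)] by (simp add: ennreal_mult_less_top)
  finally show ?thesis unfolding L2_space_def by simp
qed

lemma L2_space_diff: "f \<in> L2_space \<Longrightarrow> h \<in> L2_space \<Longrightarrow> (\<lambda>x. f x - h x) \<in> L2_space"
  using L2_space_lincomb[of f h 1 "-1"] by simp

text \<open>A real value, so that the uniqueness argument can use ordinary derivatives. On
  \<open>L2_space\<close> the norm is finite and nothing is lost.\<close>

definition L2_dist :: "('a::euclidean_space \<Rightarrow> complex) \<Rightarrow> ('a \<Rightarrow> complex) \<Rightarrow> real" where
  "L2_dist f h = enn2real (Lp_norm 2 (\<lambda>x. f x - h x))"

lemma L2_dist_ennreal: "f \<in> L2_space \<Longrightarrow> h \<in> L2_space \<Longrightarrow> ennreal (L2_dist f h) = Lp_norm 2 (\<lambda>x. f x - h x)"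
  unfolding L2_dist_def using L2_spaceD(2)[OF L2_space_diff[of f h]] by (intro ennreal_enn2real) simp

lemma L2_dist_nonneg [simp]: "0 \<le> L2_dist f h"
  by (simp add: L2_dist_def)

lemma L2_dist_commute: "L2_dist f h = L2_dist h f"
  by (simp add: L2_dist_def Lp_norm_def norm_minus_commute)

lemma L2_dist_triangle:
  assumes "f \<in> L2_space" "h \<in> L2_space" "k \<in> L2_space"
  shows "L2_dist f k \<le> L2_dist f h + L2_dist h k"
proof -
  have "Lp_norm 2 (\<lambda>x. (f x - h x) + (h x - k x)) \<le> Lp_norm 2 (\<lambda>x. f x - h x) + Lp_norm 2 (\<lambda>x. h x - k x)"
    using assms[THEN L2_spaceD(1)] by (intro Lp_norm_add_le) auto
  then have "ennreal (L2_dist f k) \<le> ennreal (L2_dist f h) + ennreal (L2_dist h k)"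
    using assms by (simp add: L2_dist_ennreal)
  also have "\<dots> = ennreal (L2_dist f h + L2_dist h k)" by simp
  finally show ?thesis by (subst (asm) ennreal_le_iff) auto
qed

lemma Lp_norm_cong_AE:
  assumes "AE x in lborel. f x = h x" "f \<in> borel_measurable borel" "h \<in> borel_measurable borel"
  shows "Lp_norm p f = Lp_norm p h"
  unfolding Lp_norm_def using assms by (intro eLp_norm_cong_AE) (auto elim!: eventually_mono)

lemma L2_dist_cong_AE:
  assumes "AE x in lborel. f x = f' x" "AE x in lborel. h x = h' x"
    "f \<in> L2_space" "f' \<in> L2_space" "h \<in> L2_space" "h' \<in> L2_space"
  shows "L2_dist f h = L2_dist f' h'"
proof -
  have "AE x in lborel. f x - h x = f' x - h' x" using assms(1,2) by eventually_elim simp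
  then have "Lp_norm 2 (\<lambda>x. f x - h x) = Lp_norm 2 (\<lambda>x. f' x - h' x)"
    using assms(3-)[THEN L2_spaceD(1)] by (intro Lp_norm_cong_AE) auto
  then show ?thesis by (simp add: L2_dist_def)
qed

lemma Lp_norm_2: "Lp_norm 2 f = ennreal_powr (\<integral>\<^sup>+x. ennreal ((norm (f x))\<^sup>2) \<partial>lborel) (1 / 2)"
proof -
  have "2 = ennreal 2" by simp
  then show ?thesis by (simp add: Lp_norm_def eLp_norm_def ennreal_powr_ennreal)
qed

lemma L2_dist_eq_0:
  assumes "f \<in> L2_space" "h \<in> L2_space" "L2_dist f h = 0"
  shows "AE x in lborel. f x = h x"
proof -
  have [measurable]: "f \<in> borel_measurable borel" "h \<in> borel_measurable borel"
    using assms L2_spaceD by auto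
  have "Lp_norm 2 (\<lambda>x. f x - h x) = 0" using L2_dist_ennreal[OF assms(1,2)] assms(3) by simp
  then have "(\<integral>\<^sup>+x. ennreal ((norm (f x - h x))\<^sup>2) \<partial>lborel) = 0" by (simp add: Lp_norm_2)
  then have "AE x in lborel. ennreal ((norm (f x - h x))\<^sup>2) = 0" by (subst (asm) nn_integral_0_iff_AE) auto
  then show ?thesis by (auto simp: ennreal_eq_0_iff elim!: eventually_mono)
qed

lemma square_decay:
  fixes f :: "'a::euclidean_space \<Rightarrow> complex"
  assumes "\<And>x. norm (f x) \<le> B / (1 + norm x) ^ (2 * DIM('a))"
  shows "(norm (f x))\<^sup>2 \<le> B\<^sup>2 / (1 + norm x) ^ (2 * DIM('a))"
proof -
  have "(norm (f x))\<^sup>2 \<le> (B / (1 + norm x) ^ (2 * DIM('a)))\<^sup>2" by (intro power_mono assms) simp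
  also have "\<dots> = B\<^sup>2 / ((1 + norm x) ^ (2 * DIM('a)) * (1 + norm x) ^ (2 * DIM('a)))"
    by (simp add: power2_eq_square)
  also have "\<dots> \<le> B\<^sup>2 / ((1 + norm x) ^ (2 * DIM('a)) * 1)"
    by (intro divide_left_mono mult_left_mono one_le_power) (auto intro!: mult_pos_pos zero_less_power simp: add_pos_nonneg)
  finally show ?thesis by simp
qed

text \<open>Decay of order 2 d is also enough for square integrability. The third bound is linear in
  B and dominates the L^2 norm by a Schwartz seminorm, which transfers quadrature convergence to
  L^2.\<close>

lemma Lp_norm_2_decay:
  fixes f :: "'a::euclidean_space \<Rightarrow> complex"
  assumes [measurable]: "f \<in> borel_measurable borel" and B: "\<And>x. norm (f x) \<le> B / (1 + norm x) ^ (2 * DIM('a))"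
  shows "Lp_norm 2 f = ennreal (sqrt (\<integral>x. (norm (f x))\<^sup>2 \<partial>lborel))"
    and "f \<in> L2_space"
    and "Lp_norm 2 f \<le> ennreal (B * sqrt (\<integral>x. 1 / (1 + norm (x :: 'a)) ^ (2 * DIM('a)) \<partial>lborel))"
proof -
  have i: "integrable lborel (\<lambda>x. (norm (f x))\<^sup>2)"
    using square_decay[OF B] by (intro integrable_decay[where B="B\<^sup>2"]) auto
  show eq: "Lp_norm 2 f = ennreal (sqrt (\<integral>x. (norm (f x))\<^sup>2 \<partial>lborel))"
    unfolding Lp_norm_2 nn_integral_eq_integral[OF i AE_I2[OF zero_le_power2]]
    by (simp add: ennreal_powr_ennreal integral_nonneg_AE powr_half_sqrt)
  show "f \<in> L2_space" by (simp add: L2_space_def eq)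
  have B0: "0 \<le> B" using order_trans[OF norm_ge_zero B[of 0]] by simp
  have "(\<integral>x. (norm (f x))\<^sup>2 \<partial>lborel) \<le> (\<integral>x. B\<^sup>2 * (1 / (1 + norm (x :: 'a)) ^ (2 * DIM('a))) \<partial>lborel)"
    using square_decay[OF B] by (intro integral_mono i integrable_mult_right integrable_inverse_power_norm) auto
  also have "\<dots> = B\<^sup>2 * (\<integral>x. 1 / (1 + norm (x :: 'a)) ^ (2 * DIM('a)) \<partial>lborel)" by (rule integral_mult_right_zero)
  finally have "sqrt (\<integral>x. (norm (f x))\<^sup>2 \<partial>lborel) \<le> sqrt (B\<^sup>2 * (\<integral>x. 1 / (1 + norm (x :: 'a)) ^ (2 * DIM('a)) \<partial>lborel))"
    by (rule real_sqrt_le_mono)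
  then show "Lp_norm 2 f \<le> ennreal (B * sqrt (\<integral>x. 1 / (1 + norm (x :: 'a)) ^ (2 * DIM('a)) \<partial>lborel))"
    unfolding eq using B0 by (intro ennreal_leI) (simp add: real_sqrt_mult)
qed

lemma seminorm_bound_decay:
  "seminorm_bound (2 * DIM('a)) f B \<Longrightarrow> norm (f x) \<le> B / (1 + norm (x :: 'a::euclidean_space)) ^ (2 * DIM('a))"
  using seminorm_bound_le[of "2 * DIM('a)" f B "[]" x] by simp

lemma schwartz_L2:
  fixes f :: "'a::euclidean_space \<Rightarrow> complex"
  assumes "f \<in> schwartz"
  shows "f \<in> L2_space"
  by (rule Lp_norm_2_decay(2)[OF schwartz_borel_measurable[OF assms] seminorm_bound_decay[OF seminorm_bound_schwartz_norm[OF assms]]])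

lemma schwartz_Lp_norm_2_le:
  fixes f :: "'a::euclidean_space \<Rightarrow> complex"
  assumes "f \<in> schwartz"
  shows "Lp_norm 2 f \<le> ennreal (schwartz_norm (2 * DIM('a)) f * sqrt (\<integral>x. 1 / (1 + norm (x :: 'a)) ^ (2 * DIM('a)) \<partial>lborel))"
  by (rule Lp_norm_2_decay(3)[OF schwartz_borel_measurable[OF assms] seminorm_bound_decay[OF seminorm_bound_schwartz_norm[OF assms]]])

subsection \<open>Coherent states of the harmonic oscillator\<close>

text \<open>With the symmetric phase \<open>\<pi> x \<cdot> \<xi>\<close> the evolution of a coherent state is the classical
  rotation of \<open>(x, \<xi>)\<close> times the ground state phase, without any further cocycle.\<close>

definition coherent :: "'a::euclidean_space \<Rightarrow> 'a \<Rightarrow> 'a \<Rightarrow> complex" where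
  "coherent x \<xi> y = cis (pi * (x \<bullet> \<xi>)) * wave_packet (gaussian pi) x \<xi> y"

lemma schwartz_coherent: "coherent x \<xi> \<in> schwartz"
  unfolding coherent_def[abs_def] by (intro schwartz_cmult schwartz_wave_packet schwartz_gaussian) simp

lemma has_derivative_coherent:
  "(coherent x \<xi> has_derivative (\<lambda>h. (of_real (- 2 * pi * ((y - x) \<bullet> h)) - \<i> * of_real (2 * pi * (h \<bullet> \<xi>))) * coherent x \<xi> y)) (at y)"
proof -
  have t: "((\<lambda>y. y - x) has_derivative (\<lambda>h. h)) (at y)" by (auto intro!: derivative_eq_intros)
  have "((\<lambda>y. gaussian pi (y - x)) has_derivative (\<lambda>h. of_real (exp (- pi * (norm (y - x))\<^sup>2) * (- pi * (2 * ((y - x) \<bullet> h)))))) (at y)"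
    unfolding gaussian_def
    by (intro has_derivative_of_real has_derivative_compose[OF t has_derivative_gaussian_factor])
  then have "((\<lambda>y. cis (pi * (x \<bullet> \<xi>)) * (gaussian pi (y - x) * modulation \<xi> y)) has_derivative
    (\<lambda>h. cis (pi * (x \<bullet> \<xi>)) * (gaussian pi (y - x) * (\<i> * of_real (- 2 * pi * (h \<bullet> \<xi>)) * modulation \<xi> y)
      + of_real (exp (- pi * (norm (y - x))\<^sup>2) * (- pi * (2 * ((y - x) \<bullet> h)))) * modulation \<xi> y))) (at y)"
    by (intro has_derivative_mult_right has_derivative_mult has_derivative_modulation)
  then show ?thesis
    unfolding coherent_def[abs_def] wave_packet_def gaussian_def
    by (rule has_derivative_eq_rhs) (simp add: fun_eq_iff algebra_simps)
qed

text \<open>The factor by which iH acts on a coherent state; along the rotation it is the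
  logarithmic time derivative of the flow. The term d/2 is the ground state energy.\<close>

definition coherent_rate :: "'a::euclidean_space \<Rightarrow> 'a \<Rightarrow> 'a \<Rightarrow> complex" where
  "coherent_rate x \<xi> y = of_real (2 * pi * (y \<bullet> \<xi> - x \<bullet> \<xi>))
     + \<i> * of_real (2 * pi * (y \<bullet> x) - pi * ((norm x)\<^sup>2 - (norm \<xi>)\<^sup>2) + real DIM('a) / 2)"

text \<open>Each partial derivative multiplies by an affine factor \<open>L b\<close>, so second
  derivatives give \<open>(L b)^2 - 2 pi\<close>. The kinetic term then contains -\<pi> |y - x|^2,
  which cancels the quadratic part of the potential: the remaining factor is affine in y.\<close>

lemma harmonic_oscillator_coherent:
  fixes x \<xi> y :: "'a::euclidean_space"
  shows "\<i> * harmonic_oscillator (coherent x \<xi>) y = coherent_rate x \<xi> y * coherent x \<xi> y"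
proof -
  define L where "L b y = complex_of_real (- 2 * pi * ((y - x) \<bullet> b)) - \<i> * of_real (2 * pi * (b \<bullet> \<xi>))" for b y
  have 1: "partial_derivs [b] (coherent x \<xi>) = (\<lambda>y. L b y * coherent x \<xi> y)" for b
    by (rule partial_derivs_Cons_eqI) (simp only: partial_derivs.simps L_def has_derivative_coherent)
  have dL: "(L b has_derivative (\<lambda>h. of_real (- 2 * pi * (h \<bullet> b)))) (at y)" for b y
  proof -
    have "((\<lambda>y. - 2 * pi * ((y - x) \<bullet> b)) has_derivative (\<lambda>h. - 2 * pi * (h \<bullet> b))) (at y)"
      by (auto intro!: derivative_eq_intros)
    from has_derivative_diff[OF has_derivative_of_real[OF this] has_derivative_const] show ?thesis
      unfolding L_def by simp
  qed
  have 2: "partial_derivs [b, b] (coherent x \<xi>) y = ((L b y)\<^sup>2 - 2 * of_real pi) * coherent x \<xi> y" if b: "b \<in> Basis" for b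
  proof -
    have "partial_derivs [b, b] (coherent x \<xi>) = (\<lambda>y. L b y * (L b y * coherent x \<xi> y) + of_real (- 2 * pi * (b \<bullet> b)) * coherent x \<xi> y)"
      by (rule partial_derivs_Cons_eqI[where D="\<lambda>y h. L b y * (L h y * coherent x \<xi> y) + of_real (- 2 * pi * (h \<bullet> b)) * coherent x \<xi> y"])
        (unfold 1, intro has_derivative_mult dL has_derivative_coherent[of x \<xi>, folded L_def])
    then show ?thesis using b by (simp add: algebra_simps power2_eq_square)
  qed
  have "laplacian (coherent x \<xi>) y = (\<Sum>b\<in>(Basis :: 'a set). (L b y)\<^sup>2 - 2 * of_real pi) * coherent x \<xi> y"
    unfolding laplacian_def sum_distrib_right by (intro sum.cong refl 2)
  also have "(\<Sum>b\<in>(Basis :: 'a set). (L b y)\<^sup>2 - 2 * of_real pi)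
    = of_real (4 * pi\<^sup>2) * (of_real ((norm (y - x))\<^sup>2) + 2 * \<i> * of_real ((y - x) \<bullet> \<xi>) - of_real ((norm \<xi>)\<^sup>2)) - 2 * of_real pi * of_nat DIM('a)"
  proof -
    have "(L b y)\<^sup>2 = of_real (4 * pi\<^sup>2) * (of_real (((y - x) \<bullet> b) * ((y - x) \<bullet> b)) + 2 * \<i> * of_real (((y - x) \<bullet> b) * (\<xi> \<bullet> b)) - of_real ((\<xi> \<bullet> b) * (\<xi> \<bullet> b)))" for b
      by (simp add: L_def power2_eq_square algebra_simps inner_commute[of b \<xi>])
    moreover have "(norm (y - x))\<^sup>2 = (\<Sum>b\<in>Basis. ((y - x) \<bullet> b) * ((y - x) \<bullet> b))" "(norm \<xi>)\<^sup>2 = (\<Sum>b\<in>Basis. (\<xi> \<bullet> b) * (\<xi> \<bullet> b))"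
      unfolding power2_norm_eq_inner by (rule euclidean_inner)+
    moreover have "(y - x) \<bullet> \<xi> = (\<Sum>b\<in>Basis. ((y - x) \<bullet> b) * (\<xi> \<bullet> b))" by (rule euclidean_inner)
    ultimately show ?thesis
      by (simp only: sum_subtractf sum_distrib_left[symmetric] sum.distrib of_real_sum sum_constant) (simp add: mult_ac)
  qed
  finally have lap: "laplacian (coherent x \<xi>) y = \<dots> * coherent x \<xi> y" .
  have n: "(norm (y - x))\<^sup>2 = (norm y)\<^sup>2 - 2 * (y \<bullet> x) + (norm x)\<^sup>2"
    by (simp add: power2_norm_eq_inner inner_diff inner_commute)
  have "- complex_of_real (1 / (4 * pi)) * (of_real (4 * pi\<^sup>2) * (of_real ((norm (y - x))\<^sup>2) + 2 * \<i> * of_real ((y - x) \<bullet> \<xi>) - of_real ((norm \<xi>)\<^sup>2)) - 2 * of_real pi * of_nat DIM('a))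
     + of_real (pi * (norm y)\<^sup>2) = - \<i> * coherent_rate x \<xi> y"
    unfolding coherent_rate_def n inner_diff_left
    by (simp add: field_simps power2_eq_square)
  then have "harmonic_oscillator (coherent x \<xi>) y = - \<i> * coherent_rate x \<xi> y * coherent x \<xi> y"
    unfolding harmonic_oscillator_def lap by (simp only: mult.assoc[symmetric] distrib_right[symmetric])
  then show ?thesis by (simp add: mult.assoc[symmetric])
qed

lemma harmonic_oscillator_cmult:
  assumes "smooth f"
  shows "harmonic_oscillator (\<lambda>y. c * f y) = (\<lambda>y. c * harmonic_oscillator f y)"
proof -
  have "partial_derivs [b, b] (\<lambda>y. c * f y) = (\<lambda>y. c * partial_derivs [b, b] f y)" if "b \<in> Basis" for b
    using partial_derivs_lincomb[OF assms assms, of "[b, b]" c 0] that by (simp del: partial_derivs.simps)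
  then show ?thesis
    by (simp add: fun_eq_iff harmonic_oscillator_def laplacian_def sum_distrib_left algebra_simps del: partial_derivs.simps)
qed

section \<open>The classical rotation and the flow of coherent states\<close>

definition rotate_position :: "real \<Rightarrow> 'a::euclidean_space \<Rightarrow> 'a \<Rightarrow> 'a" where
  "rotate_position t x \<xi> = cos t *\<^sub>R x + sin t *\<^sub>R \<xi>"

definition rotate_frequency :: "real \<Rightarrow> 'a::euclidean_space \<Rightarrow> 'a \<Rightarrow> 'a" where
  "rotate_frequency t x \<xi> = cos t *\<^sub>R \<xi> - sin t *\<^sub>R x"

definition coherent_flow :: "'a::euclidean_space \<Rightarrow> 'a \<Rightarrow> real \<Rightarrow> 'a \<Rightarrow> complex" where
  "coherent_flow x \<xi> t y = cis (t * (real DIM('a) / 2)) * coherent (rotate_position t x \<xi>) (rotate_frequency t x \<xi>) y"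

definition coherent_flow_rate :: "'a::euclidean_space \<Rightarrow> 'a \<Rightarrow> real \<Rightarrow> 'a \<Rightarrow> complex" where
  "coherent_flow_rate x \<xi> t y = coherent_rate (rotate_position t x \<xi>) (rotate_frequency t x \<xi>) y * coherent_flow x \<xi> t y"

lemma schwartz_coherent_flow: "coherent_flow x \<xi> t \<in> schwartz"
  unfolding coherent_flow_def[abs_def] by (intro schwartz_cmult schwartz_coherent)

lemma harmonic_oscillator_coherent_flow:
  "\<i> * harmonic_oscillator (coherent_flow x \<xi> t) y = coherent_flow_rate x \<xi> t y"
  unfolding coherent_flow_def[abs_def] coherent_flow_rate_def harmonic_oscillator_cmult[OF schwartz_smooth[OF schwartz_coherent]]
  using harmonic_oscillator_coherent[of "rotate_position t x \<xi>" "rotate_frequency t x \<xi>" y]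
  by (simp add: mult.left_commute)

text \<open>The flow at a fixed y is exp (a + i b) with a and b real and explicit in cos t and sin
  t; b also has a term linear in t from the ground state. The Schroedinger equation reduces to a' +
  i b' being the rate at the rotated point.\<close>

lemma has_vector_derivative_coherent_flow:
  fixes x \<xi> y :: "'a::euclidean_space"
  shows "((\<lambda>t. coherent_flow x \<xi> t y) has_vector_derivative coherent_flow_rate x \<xi> t y) (at t)"
proof -
  define X Y p q r d where "X = y \<bullet> x" and "Y = y \<bullet> \<xi>" and "p = x \<bullet> x" and "q = x \<bullet> \<xi>" and "r = \<xi> \<bullet> \<xi>" and "d = real DIM('a)"
  define a where "a t = - pi * (y \<bullet> y - 2 * (cos t * X + sin t * Y) + ((cos t)\<^sup>2 * p + 2 * cos t * sin t * q + (sin t)\<^sup>2 * r))" for t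
  define b where "b t = t * (d / 2) + pi * (((cos t)\<^sup>2 - (sin t)\<^sup>2) * q + cos t * sin t * (r - p)) - 2 * pi * (cos t * Y - sin t * X)" for t
  define a' where "a' t = 2 * pi * ((cos t * Y - sin t * X) - (((cos t)\<^sup>2 - (sin t)\<^sup>2) * q + cos t * sin t * (r - p)))" for t
  define b' where "b' t = 2 * pi * (cos t * X + sin t * Y) - pi * (((cos t)\<^sup>2 * p + 2 * cos t * sin t * q + (sin t)\<^sup>2 * r) - ((cos t)\<^sup>2 * r - 2 * cos t * sin t * q + (sin t)\<^sup>2 * p)) + d / 2" for t
  have da: "(a has_real_derivative a' t) (at t)" for t
    unfolding a_def[abs_def] a'_def
    by (auto intro!: derivative_eq_intros simp: algebra_simps power2_eq_square)
  have db: "(b has_real_derivative b' t) (at t)" for t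
    unfolding b_def[abs_def] b'_def
    by (auto intro!: derivative_eq_intros simp: algebra_simps power2_eq_square)
  have xx: "rotate_position t x \<xi> \<bullet> rotate_position t x \<xi> = (cos t)\<^sup>2 * p + 2 * cos t * sin t * q + (sin t)\<^sup>2 * r" for t
    by (simp add: rotate_position_def p_def q_def r_def inner_add inner_commute power2_eq_square algebra_simps)
  have ff: "rotate_frequency t x \<xi> \<bullet> rotate_frequency t x \<xi> = (cos t)\<^sup>2 * r - 2 * cos t * sin t * q + (sin t)\<^sup>2 * p" for t
    by (simp add: rotate_frequency_def p_def q_def r_def inner_diff inner_commute power2_eq_square algebra_simps)
  have xf: "rotate_position t x \<xi> \<bullet> rotate_frequency t x \<xi> = ((cos t)\<^sup>2 - (sin t)\<^sup>2) * q + cos t * sin t * (r - p)" for t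
    by (simp add: rotate_position_def rotate_frequency_def p_def q_def r_def inner_diff inner_add inner_commute power2_eq_square algebra_simps)
  have yx: "y \<bullet> rotate_position t x \<xi> = cos t * X + sin t * Y" and yf: "y \<bullet> rotate_frequency t x \<xi> = cos t * Y - sin t * X" for t
    by (simp_all add: rotate_position_def rotate_frequency_def X_def Y_def inner_diff_right inner_add_right)
  have n: "(norm (y - rotate_position t x \<xi>))\<^sup>2 = y \<bullet> y - 2 * (y \<bullet> rotate_position t x \<xi>) + rotate_position t x \<xi> \<bullet> rotate_position t x \<xi>" for t
    unfolding power2_norm_eq_inner inner_diff_left inner_diff_right
    using inner_commute[of "rotate_position t x \<xi>" y] by simp
  have flow: "coherent_flow x \<xi> t y = exp (of_real (a t) + \<i> * of_real (b t))" for t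
    unfolding coherent_flow_def coherent_def wave_packet_def gaussian_def modulation_def cis_conv_exp exp_of_real[symmetric]
      n xx yx xf yf exp_add[symmetric] a_def b_def d_def
    by (rule arg_cong[where f=exp]) (simp add: algebra_simps)
  have rate: "coherent_rate (rotate_position t x \<xi>) (rotate_frequency t x \<xi>) y = of_real (a' t) + \<i> * of_real (b' t)"
    unfolding coherent_rate_def power2_norm_eq_inner xx ff xf yx yf a'_def b'_def d_def ..
  have "((\<lambda>t. complex_of_real (a t) + \<i> * of_real (b t)) has_vector_derivative (of_real (a' t) + \<i> * of_real (b' t))) (at t)"
    using da[of t] db[of t] by (intro has_vector_derivative_add has_vector_derivative_mult_right has_vector_derivative_of_real)
  from field_vector_diff_chain_at[OF this DERIV_exp]
  show ?thesis
    unfolding coherent_flow_rate_def rate flow comp_def .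
qed

lemma rotate_norm_le:
  "norm (rotate_position t x \<xi>) \<le> norm x + norm \<xi>" "norm (rotate_frequency t x \<xi>) \<le> norm x + norm \<xi>"
proof -
  have "norm (cos t *\<^sub>R x) \<le> norm x" "norm (sin t *\<^sub>R \<xi>) \<le> norm \<xi>" "norm (cos t *\<^sub>R \<xi>) \<le> norm \<xi>" "norm (sin t *\<^sub>R x) \<le> norm x"
    by (auto intro!: mult_left_le_one_le)
  then show "norm (rotate_position t x \<xi>) \<le> norm x + norm \<xi>" "norm (rotate_frequency t x \<xi>) \<le> norm x + norm \<xi>"
    unfolding rotate_position_def rotate_frequency_def
    using norm_triangle_ineq[of "cos t *\<^sub>R x" "sin t *\<^sub>R \<xi>"] norm_triangle_ineq4[of "cos t *\<^sub>R \<xi>" "sin t *\<^sub>R x"] by linarith+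
qed

lemma norm_coherent_flow:
  "norm (coherent_flow x \<xi> t y) = norm (wave_packet (gaussian pi) (rotate_position t x \<xi>) (rotate_frequency t x \<xi>) y)"
  by (simp add: coherent_flow_def coherent_def norm_mult)

text \<open>Uniform in t because the rotated position and frequency stay in a ball of radius |x| +
  |\<xi>|. The bound is the dominating function for differentiation in L^2.\<close>

lemma coherent_flow_rate_decay:
  fixes x \<xi> :: "'a::euclidean_space"
  shows "\<exists>K\<ge>0. \<forall>t y. norm (coherent_flow_rate x \<xi> t y) \<le> K / (1 + norm y) ^ (2 * DIM('a))"
proof -
  define R where "R = norm x + norm \<xi>"
  have R: "0 \<le> R" by (simp add: R_def)
  \<comment> \<open>One power beyond integrability absorbs the affine growth of
    \<open>coherent_rate\<close> in y.\<close>
  define N where "N = Suc (2 * DIM('a))"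
  have gs: "(gaussian pi :: 'a \<Rightarrow> complex) \<in> schwartz" by (intro schwartz_gaussian) simp
  obtain B where B: "seminorm_bound N (gaussian pi :: 'a \<Rightarrow> complex) B" using schwartz_bound_ex[OF gs] by blast
  have B0: "0 \<le> B" using seminorm_bound_nonneg[OF B] .
  define K1 where "K1 = (4 * pi) ^ N * ((1 + R) * (1 + R)) ^ N * B"
  have K10: "0 \<le> K1" using R B0 by (simp add: K1_def)
  have f: "norm (coherent_flow x \<xi> t y) \<le> K1 / (1 + norm y) ^ N" for t y
  proof -
    have "seminorm_bound N (wave_packet (gaussian pi) (rotate_position t x \<xi>) (rotate_frequency t x \<xi>)) K1"
    proof (rule seminorm_bound_mono[OF seminorm_bound_wave_packet[OF schwartz_smooth[OF gs] B] order_refl])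
      show "(4 * pi) ^ N * ((1 + norm (rotate_position t x \<xi>)) * (1 + norm (rotate_frequency t x \<xi>))) ^ N * B \<le> K1"
        unfolding K1_def R_def using B0
        by (intro mult_right_mono mult_left_mono power_mono mult_mono add_left_mono rotate_norm_le) auto
    qed
    from seminorm_bound_le[OF this, of "[]" y] show ?thesis unfolding norm_coherent_flow by simp
  qed
  define K2 where "K2 = 4 * pi * R + 4 * pi * R\<^sup>2 + real DIM('a)"
  have K20: "0 \<le> K2" using R by (simp add: K2_def)
  have r: "norm (coherent_rate (rotate_position t x \<xi>) (rotate_frequency t x \<xi>) y) \<le> K2 * (1 + norm y)" for t y
  proof -
    let ?x = "rotate_position t x \<xi>" and ?f = "rotate_frequency t x \<xi>"
    have nx: "norm ?x \<le> R" "norm ?f \<le> R" unfolding R_def by (rule rotate_norm_le)+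
    have i1: "\<bar>y \<bullet> ?f\<bar> \<le> norm y * R" "\<bar>y \<bullet> ?x\<bar> \<le> norm y * R" "\<bar>?x \<bullet> ?f\<bar> \<le> R * R"
      by (rule order_trans[OF Cauchy_Schwarz_ineq2], intro mult_mono nx, use R in auto)+
    have i2: "(norm ?x)\<^sup>2 \<le> R * R" "(norm ?f)\<^sup>2 \<le> R * R"
      unfolding power2_eq_square by (intro mult_mono nx, use R in auto)+
    have i3: "\<bar>(norm ?x)\<^sup>2 - (norm ?f)\<^sup>2\<bar> \<le> R * R"
      using i2 zero_le_power2[of "norm ?x"] zero_le_power2[of "norm ?f"] by linarith
    have p1: "\<bar>2 * pi * (y \<bullet> ?f - ?x \<bullet> ?f)\<bar> \<le> 2 * pi * (norm y * R + R * R)"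
      using i1 unfolding abs_mult by (intro mult_mono) auto
    have p2: "\<bar>2 * pi * (y \<bullet> ?x)\<bar> \<le> 2 * pi * (norm y * R)"
      using i1 unfolding abs_mult by (intro mult_mono) auto
    have p3: "\<bar>pi * ((norm ?x)\<^sup>2 - (norm ?f)\<^sup>2)\<bar> \<le> pi * (R * R)"
      using i3 unfolding abs_mult by (intro mult_mono) auto
    have "norm (coherent_rate ?x ?f y) \<le> \<bar>2 * pi * (y \<bullet> ?f - ?x \<bullet> ?f)\<bar> + \<bar>2 * pi * (y \<bullet> ?x) - pi * ((norm ?x)\<^sup>2 - (norm ?f)\<^sup>2) + real DIM('a) / 2\<bar>"
      unfolding coherent_rate_def by (rule order_trans[OF norm_triangle_ineq]) (simp add: norm_mult del: of_real_mult of_real_diff of_real_add of_real_divide)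
    also have "\<dots> \<le> 4 * pi * R * norm y + 3 * pi * (R * R) + real DIM('a) / 2"
      using p1 p2 p3 by (simp add: algebra_simps)
    also have "\<dots> \<le> K2 * (1 + norm y)"
    proof -
      have "K2 * (1 + norm y) = 4 * pi * R + 4 * pi * (R * R) + real DIM('a) + 4 * pi * R * norm y + 4 * pi * (R * R) * norm y + real DIM('a) * norm y"
        by (simp add: K2_def power2_eq_square algebra_simps)
      moreover have "0 \<le> 4 * pi * R" "0 \<le> pi * (R * R)" "0 \<le> 4 * pi * (R * R) * norm y" "0 \<le> real DIM('a) * norm y"
        using R by auto
      ultimately show ?thesis by linarith
    qed
    finally show ?thesis .
  qed
  have "norm (coherent_flow_rate x \<xi> t y) \<le> (K2 * K1) / (1 + norm y) ^ (2 * DIM('a))" for t y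
  proof -
    have "norm (coherent_flow_rate x \<xi> t y) \<le> (K2 * (1 + norm y)) * (K1 / (1 + norm y) ^ N)"
      unfolding coherent_flow_rate_def norm_mult using K20 by (intro mult_mono r f) auto
    also have "\<dots> = (K2 * K1) / (1 + norm y) ^ (2 * DIM('a))"
    proof -
      have "(K2 * v) * (K1 / (v * w)) = (K2 * K1) / w" if "0 < v" for v w using that by simp
      then show ?thesis unfolding N_def power_Suc by (simp add: add_pos_nonneg)
    qed
    finally show ?thesis .
  qed
  moreover have "0 \<le> K2 * K1" using K10 K20 by simp
  ultimately show ?thesis by blast
qed

lemma coherent_flow_rate_measurable: "coherent_flow_rate x \<xi> t \<in> borel_measurable borel"
proof -
  have [measurable]: "coherent_flow x \<xi> t \<in> borel_measurable borel" by (rule schwartz_borel_measurable[OF schwartz_coherent_flow])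
  show ?thesis unfolding coherent_flow_rate_def[abs_def] coherent_rate_def by measurable
qed

text \<open>The pointwise derivative is upgraded to L^2: the mean value inequality bounds the
  difference quotients by the uniform decay of the rate, and their squares converge in a dominated
  way.\<close>

lemma coherent_flow_L2_derivative:
  fixes x \<xi> :: "'a::euclidean_space"
  shows "((\<lambda>h. Lp_norm 2 (\<lambda>y. (coherent_flow x \<xi> (t + h) y - coherent_flow x \<xi> t y) / complex_of_real h - coherent_flow_rate x \<xi> t y)) \<longlongrightarrow> 0) (at 0)"
  unfolding tendsto_at_iff_sequentially comp_def
proof (intro allI impI)
  fix X :: "nat \<Rightarrow> real" assume X: "\<forall>i. X i \<in> UNIV - {0}" "X \<longlonglongrightarrow> 0"
  define q where "q n y = (coherent_flow x \<xi> (t + X n) y - coherent_flow x \<xi> t y) / complex_of_real (X n) - coherent_flow_rate x \<xi> t y" for n y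
  obtain K where K: "0 \<le> K" "\<And>t y. norm (coherent_flow_rate x \<xi> t y) \<le> K / (1 + norm y) ^ (2 * DIM('a))"
    using coherent_flow_rate_decay[of x \<xi>] by blast
  have [measurable]: "coherent_flow x \<xi> s \<in> borel_measurable borel" for s by (rule schwartz_borel_measurable[OF schwartz_coherent_flow])
  have [measurable]: "coherent_flow_rate x \<xi> s \<in> borel_measurable borel" for s by (rule coherent_flow_rate_measurable)
  have qm: "q n \<in> borel_measurable borel" for n unfolding q_def[abs_def] by measurable
  have lip: "norm (coherent_flow x \<xi> (t + h) y - coherent_flow x \<xi> t y) \<le> (K / (1 + norm y) ^ (2 * DIM('a))) * norm h" for h y
  proof -
    have "norm (coherent_flow x \<xi> (t + h) y - coherent_flow x \<xi> t y) \<le> (K / (1 + norm y) ^ (2 * DIM('a))) * norm (t + h - t)"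
    proof (rule differentiable_bound[where S=UNIV and f'="\<lambda>s k. k *\<^sub>R coherent_flow_rate x \<xi> s y"])
      show "((\<lambda>s. coherent_flow x \<xi> s y) has_derivative (\<lambda>k. k *\<^sub>R coherent_flow_rate x \<xi> s y)) (at s within UNIV)" for s
        using has_vector_derivative_coherent_flow[of x \<xi> y s] by (simp add: has_vector_derivative_def)
      show "onorm (\<lambda>k. k *\<^sub>R coherent_flow_rate x \<xi> s y) \<le> K / (1 + norm y) ^ (2 * DIM('a))" for s
      proof (rule onorm_le)
        fix k
        show "norm (k *\<^sub>R coherent_flow_rate x \<xi> s y) \<le> K / (1 + norm y) ^ (2 * DIM('a)) * norm k"
          using mult_left_mono[OF K(2)[of s y], of "norm k"] by (simp add: mult.commute)
      qed
    qed auto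
    then show ?thesis by simp
  qed
  have qb: "norm (q n y) \<le> 2 * K / (1 + norm y) ^ (2 * DIM('a))" for n y
  proof -
    have "0 < \<bar>X n\<bar>" using X by simp
    then have "norm ((coherent_flow x \<xi> (t + X n) y - coherent_flow x \<xi> t y) / complex_of_real (X n)) \<le> K / (1 + norm y) ^ (2 * DIM('a))"
      using lip[of "X n" y] by (simp add: norm_divide pos_divide_le_eq)
    then show ?thesis
      unfolding q_def using norm_triangle_ineq4[of "(coherent_flow x \<xi> (t + X n) y - coherent_flow x \<xi> t y) / complex_of_real (X n)" "coherent_flow_rate x \<xi> t y"] K(2)[of t y]
      by simp
  qed
  have qlim: "(\<lambda>n. q n y) \<longlonglongrightarrow> 0" for y
  proof -
    have lim: "(\<lambda>h. norm (coherent_flow x \<xi> (t + h) y - coherent_flow x \<xi> t y - h *\<^sub>R coherent_flow_rate x \<xi> t y) / norm h) \<midarrow>0\<rightarrow> 0"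
      using has_vector_derivative_coherent_flow[of x \<xi> y t] unfolding has_vector_derivative_def has_derivative_at by blast
    have "(\<lambda>n. norm (coherent_flow x \<xi> (t + X n) y - coherent_flow x \<xi> t y - X n *\<^sub>R coherent_flow_rate x \<xi> t y) / norm (X n)) \<longlonglongrightarrow> 0"
      using lim[unfolded tendsto_at_iff_sequentially, rule_format, OF X(1)[rule_format] X(2)] by (simp only: comp_def)
    moreover have "norm (coherent_flow x \<xi> (t + X n) y - coherent_flow x \<xi> t y - X n *\<^sub>R coherent_flow_rate x \<xi> t y) / norm (X n) = norm (q n y)" for n
    proof -
      have "X n \<noteq> 0" using X by simp
      then have "q n y = (coherent_flow x \<xi> (t + X n) y - coherent_flow x \<xi> t y - X n *\<^sub>R coherent_flow_rate x \<xi> t y) / complex_of_real (X n)"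
        by (simp add: q_def field_simps scaleR_conv_of_real)
      then show ?thesis by (simp add: norm_divide)
    qed
    ultimately have "(\<lambda>n. norm (q n y)) \<longlonglongrightarrow> 0" by simp
    then show ?thesis by (rule tendsto_norm_zero_cancel)
  qed
  have "(\<lambda>n. \<integral>y. (norm (q n y))\<^sup>2 \<partial>lborel) \<longlonglongrightarrow> (\<integral>y. 0 \<partial>(lborel :: 'a measure))"
  proof (rule integral_dominated_convergence[where w="\<lambda>y. (2 * K)\<^sup>2 * (1 / (1 + norm y) ^ (2 * DIM('a)))"])
    show "AE y in lborel. (\<lambda>n. (norm (q n y))\<^sup>2) \<longlonglongrightarrow> 0"
    proof (intro AE_I2)
      fix y
      from tendsto_power[OF tendsto_norm[OF qlim[of y]], of 2] show "(\<lambda>n. (norm (q n y))\<^sup>2) \<longlonglongrightarrow> 0" by simp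
    qed
    show "AE y in lborel. norm ((norm (q n y))\<^sup>2) \<le> (2 * K)\<^sup>2 * (1 / (1 + norm y) ^ (2 * DIM('a)))" for n
      using square_decay[OF qb] by (intro AE_I2) simp
    show "integrable lborel (\<lambda>y :: 'a. (2 * K)\<^sup>2 * (1 / (1 + norm y) ^ (2 * DIM('a))))"
      by (intro integrable_mult_right integrable_inverse_power_norm)
    show "(\<lambda>y. (norm (q n y))\<^sup>2) \<in> borel_measurable lborel" for n using qm[of n] by measurable
  qed simp
  then have "(\<lambda>n. ennreal (sqrt (\<integral>y. (norm (q n y))\<^sup>2 \<partial>lborel))) \<longlonglongrightarrow> ennreal (sqrt 0)"
    by (intro tendsto_ennrealI tendsto_real_sqrt) simp
  then show "(\<lambda>n. Lp_norm 2 (\<lambda>y. (coherent_flow x \<xi> (t + X n) y - coherent_flow x \<xi> t y) / complex_of_real (X n) - coherent_flow_rate x \<xi> t y)) \<longlonglongrightarrow> 0"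
    using Lp_norm_2_decay(1)[OF qm qb] unfolding q_def by simp
qed

text \<open>The constant sequence witnesses membership in the closure. That the image lies in L^2 is
  read off from the decay of the rate.\<close>

lemma coherent_flow_closure:
  fixes x \<xi> :: "'a::euclidean_space"
  shows "(coherent_flow x \<xi> t, harmonic_oscillator (coherent_flow x \<xi> t)) \<in> closure_from_schwartz harmonic_oscillator"
    and "harmonic_oscillator (coherent_flow x \<xi> t) \<in> L2_space"
proof -
  have eq: "harmonic_oscillator (coherent_flow x \<xi> t) = (\<lambda>y. (- \<i>) * coherent_flow_rate x \<xi> t y)"
    unfolding harmonic_oscillator_coherent_flow[symmetric] by (simp add: fun_eq_iff)
  obtain K where K: "0 \<le> K" "\<And>t y. norm (coherent_flow_rate x \<xi> t y) \<le> K / (1 + norm y) ^ (2 * DIM('a))"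
    using coherent_flow_rate_decay[of x \<xi>] by blast
  have [measurable]: "coherent_flow_rate x \<xi> t \<in> borel_measurable borel" by (rule coherent_flow_rate_measurable)
  show L2: "harmonic_oscillator (coherent_flow x \<xi> t) \<in> L2_space"
    unfolding eq by (rule Lp_norm_2_decay(2)[where B=K]) (use K(2) in \<open>auto simp: norm_mult\<close>)
  have "Lp_norm 2 (\<lambda>x :: 'a. 0) = 0" by (simp add: Lp_norm_2)
  then show "(coherent_flow x \<xi> t, harmonic_oscillator (coherent_flow x \<xi> t)) \<in> closure_from_schwartz harmonic_oscillator"
    unfolding closure_from_schwartz_def
    using schwartz_L2[OF schwartz_coherent_flow] L2 schwartz_coherent_flow
    by (auto intro!: exI[of _ "\<lambda>n. coherent_flow x \<xi> t"])
qed

section \<open>The abstract unitary group on coherent states\<close>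

context
  fixes U :: "real \<Rightarrow> ('a::euclidean_space \<Rightarrow> complex) \<Rightarrow> 'a \<Rightarrow> complex"
  assumes U: "unitary_group_generated_by U (closure_from_schwartz harmonic_oscillator)"
begin

lemma propagator_L2: "f \<in> L2_space \<Longrightarrow> U t f \<in> L2_space"
  and propagator_lincomb: "f \<in> L2_space \<Longrightarrow> h \<in> L2_space \<Longrightarrow>
    AE x in lborel. U t (\<lambda>y. a * f y + b * h y) x = a * U t f x + b * U t h x"
  and propagator_0: "f \<in> L2_space \<Longrightarrow> AE x in lborel. U 0 f x = f x"
  and propagator_add: "f \<in> L2_space \<Longrightarrow> AE x in lborel. U (s + t) f x = U s (U t f) x"
  and propagator_norm: "f \<in> L2_space \<Longrightarrow> Lp_norm 2 (U t f) = Lp_norm 2 f"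
  using U unfolding unitary_group_generated_by_def unitary_group_def by blast+

lemma propagator_generator:
  assumes "f \<in> L2_space" "h \<in> L2_space" "(f, h) \<in> closure_from_schwartz harmonic_oscillator"
  shows "((\<lambda>t. Lp_norm 2 (\<lambda>x. (U t f x - f x) / complex_of_real t - \<i> * h x)) \<longlongrightarrow> 0) (at 0)"
  using U assms unfolding unitary_group_generated_by_def by blast

lemma propagator_dist:
  assumes "f \<in> L2_space" "h \<in> L2_space"
  shows "L2_dist (U t f) (U t h) = L2_dist f h"
proof -
  have "AE x in lborel. U t (\<lambda>y. f y - h y) x = U t f x - U t h x"
    using propagator_lincomb[OF assms, of t 1 "-1"] by simp
  then have "Lp_norm 2 (U t (\<lambda>y. f y - h y)) = Lp_norm 2 (\<lambda>x. U t f x - U t h x)"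
    using assms by (intro Lp_norm_cong_AE L2_spaceD propagator_L2 L2_space_diff)
  then show ?thesis
    using propagator_norm[OF L2_space_diff[OF assms], of t] by (simp add: L2_dist_def)
qed

text \<open>The \<open>L\<^sup>2\<close> distance between \<open>U(s)\<psi>(0)\<close> and an \<open>L\<^sup>2\<close> solution \<open>\<psi>(s)\<close> has derivative zero.\<close>

theorem propagator_coherent:
  "AE y in lborel. U t (coherent x \<xi>) y = coherent_flow x \<xi> t y"
proof -
  let ?\<psi> = "coherent_flow x \<xi>"
  have \<psi>: "?\<psi> s \<in> L2_space" for s by (rule schwartz_L2[OF schwartz_coherent_flow])
  have \<psi>0: "?\<psi> 0 = coherent x \<xi>"
    by (simp add: coherent_flow_def[abs_def] rotate_position_def rotate_frequency_def)
  define e where "e s = L2_dist (U s (?\<psi> 0)) (?\<psi> s)" for s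
  define R where "R s h = L2_dist (U h (?\<psi> s)) (?\<psi> (s + h))" for s h
  have Us: "U s (?\<psi> 0) \<in> L2_space" for s by (rule propagator_L2[OF \<psi>])
  \<comment> \<open>By the group law and isometry of \<open>U h\<close>, the error e can change
    between s and s + h by at most the local defect \<open>R s h\<close>.\<close>
  have step: "\<bar>e (s + h) - e s\<bar> \<le> R s h" for s h
  proof -
    have a: "L2_dist (U (s + h) (?\<psi> 0)) k = L2_dist (U h (U s (?\<psi> 0))) k" if "k \<in> L2_space" for k
      using propagator_add[OF \<psi>[of 0], of h s]
      by (intro L2_dist_cong_AE propagator_L2 \<psi> that) (auto simp: add.commute)
    have i: "L2_dist (U h (U s (?\<psi> 0))) (U h (?\<psi> s)) = e s"
      unfolding e_def by (rule propagator_dist[OF Us \<psi>])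
    have "e (s + h) \<le> e s + R s h"
      unfolding e_def[of "s + h"] a[OF \<psi>] i[symmetric] R_def
      by (intro L2_dist_triangle propagator_L2 \<psi>)
    moreover have "e s \<le> e (s + h) + R s h"
      unfolding e_def[of "s + h"] a[OF \<psi>] i[symmetric] R_def
      by (subst (3) L2_dist_commute) (intro L2_dist_triangle propagator_L2 \<psi>)
    ultimately show ?thesis by linarith
  qed
  \<comment> \<open>Both \<open>U h (?\<psi> s)\<close> and \<open>?\<psi> (s + h)\<close> have the
    same L^2 derivative at h = 0, namely i times H applied to \<open>?\<psi> s\<close>, so the
    defect is o(h).\<close>
  have Rlim: "((\<lambda>h. R s h / \<bar>h\<bar>) \<longlongrightarrow> 0) (at 0)" for s
  proof -
    let ?H = "\<lambda>y. \<i> * harmonic_oscillator (?\<psi> s) y"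
    define A where "A h = Lp_norm 2 (\<lambda>y. (U h (?\<psi> s) y - ?\<psi> s y) / complex_of_real h - ?H y)" for h
    define B where "B h = Lp_norm 2 (\<lambda>y. (?\<psi> (s + h) y - ?\<psi> s y) / complex_of_real h - ?H y)" for h
    have A: "(A \<longlongrightarrow> 0) (at 0)"
      unfolding A_def by (rule propagator_generator[OF \<psi> coherent_flow_closure(2) coherent_flow_closure(1)])
    have B: "(B \<longlongrightarrow> 0) (at 0)"
      unfolding B_def harmonic_oscillator_coherent_flow by (rule coherent_flow_L2_derivative)
    have m[measurable]: "?\<psi> r \<in> borel_measurable borel" "U r (?\<psi> s) \<in> borel_measurable borel" "harmonic_oscillator (?\<psi> s) \<in> borel_measurable borel" for r
      using \<psi> propagator_L2[OF \<psi>] coherent_flow_closure(2) L2_spaceD(1) by blast+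
    have le: "ennreal (R s h / \<bar>h\<bar>) \<le> A h + B h" if h: "h \<noteq> 0" for h
    proof -
      have "ennreal (R s h) = Lp_norm 2 (\<lambda>y. U h (?\<psi> s) y - ?\<psi> (s + h) y)"
        unfolding R_def by (rule L2_dist_ennreal[OF propagator_L2[OF \<psi>] \<psi>])
      moreover have "Lp_norm 2 (\<lambda>y. U h (?\<psi> s) y - ?\<psi> (s + h) y) \<le> ennreal \<bar>h\<bar> * (A h + B h)"
      proof -
        define V where "V y = (U h (?\<psi> s) y - ?\<psi> s y) / complex_of_real h - ?H y" for y
        define W where "W y = (?\<psi> (s + h) y - ?\<psi> s y) / complex_of_real h - ?H y" for y
        have Vm: "V \<in> borel_measurable lborel" and Wm: "W \<in> borel_measurable lborel"
          unfolding V_def[abs_def] W_def[abs_def] by measurable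
        have "Lp_norm 2 (\<lambda>y. U h (?\<psi> s) y - ?\<psi> (s + h) y) = Lp_norm 2 (\<lambda>y. complex_of_real h * (V y + (- 1) * W y))"
          using h by (intro arg_cong[where f="Lp_norm 2"]) (auto simp: fun_eq_iff V_def W_def field_simps)
        also have "\<dots> \<le> ennreal (norm (complex_of_real h)) * Lp_norm 2 (\<lambda>y. V y + (- 1) * W y)"
          using Vm Wm by (intro Lp_norm_cmult_le borel_measurable_add borel_measurable_times borel_measurable_const one_le_two_ennreal)
        also have "\<dots> \<le> ennreal \<bar>h\<bar> * (Lp_norm 2 V + Lp_norm 2 (\<lambda>y. (- 1) * W y))"
          using Vm Wm unfolding norm_of_real
          by (intro mult_left_mono Lp_norm_add_le borel_measurable_times borel_measurable_const one_le_two_ennreal) auto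
        also have "Lp_norm 2 (\<lambda>y. (- 1) * W y) = Lp_norm 2 W" by (simp add: Lp_norm_def)
        finally show ?thesis unfolding A_def B_def V_def W_def .
      qed
      ultimately have "ennreal (R s h) \<le> ennreal \<bar>h\<bar> * (A h + B h)" by (simp only:)
      then have "ennreal (1 / \<bar>h\<bar>) * ennreal (R s h) \<le> ennreal (1 / \<bar>h\<bar>) * (ennreal \<bar>h\<bar> * (A h + B h))"
        by (rule mult_left_mono) simp
      also have "\<dots> = ennreal (1 / \<bar>h\<bar> * \<bar>h\<bar>) * (A h + B h)"
        by (subst ennreal_mult) (auto simp: mult.assoc)
      also have "1 / \<bar>h\<bar> * \<bar>h\<bar> = 1" using h by simp
      also have "ennreal (1 / \<bar>h\<bar>) * ennreal (R s h) = ennreal (1 / \<bar>h\<bar> * R s h)"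
        by (subst ennreal_mult) (auto simp: R_def)
      finally show ?thesis by (simp del: times_divide_eq_left add: field_simps)
    qed
    have "((\<lambda>h. A h + B h) \<longlongrightarrow> 0 + 0) (at 0)" by (intro tendsto_add A B)
    then have AB: "((\<lambda>h. A h + B h) \<longlongrightarrow> 0) (at 0)" by simp
    have "((\<lambda>h. ennreal (R s h / \<bar>h\<bar>)) \<longlongrightarrow> 0) (at 0)"
    proof (rule tendsto_sandwich[OF _ _ tendsto_const AB])
      show "\<forall>\<^sub>F h in at 0. ennreal (R s h / \<bar>h\<bar>) \<le> A h + B h"
        using le by (auto simp: eventually_at_filter)
    qed auto
    then have "((\<lambda>h. enn2real (ennreal (R s h / \<bar>h\<bar>))) \<longlongrightarrow> enn2real 0) (at 0)"
      by (intro tendsto_enn2real) auto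
    then show ?thesis by (simp add: R_def)
  qed
  have "(e has_real_derivative 0) (at s)" for s
    unfolding DERIV_def
  proof (rule Lim_null_comparison[OF _ Rlim[of s]])
    show "\<forall>\<^sub>F h in at 0. norm ((e (s + h) - e s) / h) \<le> R s h / \<bar>h\<bar>"
      using step[of s] by (intro always_eventually allI) (auto simp: abs_divide intro!: divide_right_mono)
  qed
  then have "e t = e 0" using DERIV_isconst_all by blast
  also have "e 0 = 0"
  proof -
    have "e 0 = L2_dist (?\<psi> 0) (?\<psi> 0)"
      unfolding e_def using propagator_0[OF \<psi>[of 0]] by (intro L2_dist_cong_AE propagator_L2 \<psi>) auto
    then show ?thesis by (simp add: L2_dist_def Lp_norm_2)
  qed
  finally show ?thesis
    using L2_dist_eq_0[OF Us \<psi>] unfolding e_def \<psi>0 by simp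
qed

end

subsection \<open>The propagator on Schwartz functions\<close>

text \<open>The set where two continuous functions differ is open, and an open null set is
  empty.\<close>

lemma schwartz_eq_if_AE_eq:
  fixes f h :: "'a::euclidean_space \<Rightarrow> complex"
  assumes f: "f \<in> schwartz" and h: "h \<in> schwartz" and eq: "AE x in lborel. f x = h x"
  shows "f = h"
proof -
  let ?S = "{x. f x \<noteq> h x}"
  have op: "open ?S"
    by (intro open_Collect_neq schwartz_continuous_on f h)
  have "AE x in lborel. x \<notin> ?S" using eq by simp
  then have "?S \<in> null_sets lborel"
    using op by (subst AE_iff_null_sets) (simp_all add: borel_open)
  then have "negligible ?S"
    by (simp add: negligible_iff_null_sets null_sets_completionI)
  then have "?S = {}" using op open_not_negligible by blast
  then show ?thesis by auto
qed

lemma schwartz_representative_eq: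
  assumes "\<psi> \<in> schwartz" "AE x in lborel. f x = \<psi> x"
  shows "schwartz_representative f = \<psi>"
  unfolding schwartz_representative_def
proof (rule the_equality)
  show "\<psi> \<in> schwartz \<and> (AE x in lborel. \<psi> x = f x)" using assms by auto
  fix \<phi> assume "\<phi> \<in> schwartz \<and> (AE x in lborel. \<phi> x = f x)"
  then have "\<phi> \<in> schwartz" "AE x in lborel. \<phi> x = \<psi> x" using assms(2) by auto
  then show "\<phi> = \<psi>" using assms(1) by (intro schwartz_eq_if_AE_eq)
qed

section \<open>Superpositions of evolved Gaussian packets\<close>

definition gaussian_window :: "'a::euclidean_space \<Rightarrow> complex" where
  "gaussian_window y = of_real (1 / sqrt (\<integral>z. (norm (gaussian pi (z :: 'a)))\<^sup>2 \<partial>lborel)) * gaussian pi y"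

lemma schwartz_gaussian_window: "gaussian_window \<in> schwartz"
  unfolding gaussian_window_def[abs_def] by (intro schwartz_cmult schwartz_gaussian) simp

lemma cnj_gaussian_window [simp]: "cnj (gaussian_window y) = gaussian_window y"
  by (simp add: gaussian_window_def gaussian_def)

lemma gaussian_window_norm: "(\<integral>y. (norm (gaussian_window (y :: 'a::euclidean_space)))\<^sup>2 \<partial>lborel) = 1"
proof -
  define I where "I = (\<integral>z. (norm (gaussian pi (z :: 'a)))\<^sup>2 \<partial>lborel)"
  have gs: "(gaussian pi :: 'a \<Rightarrow> complex) \<in> schwartz" by (intro schwartz_gaussian) simp
  have [measurable]: "(gaussian pi :: 'a \<Rightarrow> complex) \<in> borel_measurable borel" by (rule schwartz_borel_measurable[OF gs])
  have i: "integrable lborel (\<lambda>z :: 'a. (norm (gaussian pi z))\<^sup>2)"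
    using square_decay[OF seminorm_bound_decay[OF seminorm_bound_schwartz_norm[OF gs]]]
    by (intro integrable_decay[where B="(schwartz_norm (2 * DIM('a)) (gaussian pi :: 'a \<Rightarrow> complex))\<^sup>2"]) auto
  have "I \<noteq> 0"
  proof
    assume "I = 0"
    then have "AE z in lborel. (norm (gaussian pi (z :: 'a)))\<^sup>2 = 0"
      unfolding I_def using integral_nonneg_eq_0_iff_AE[OF i] by simp
    then have "AE z in (lborel :: 'a measure). False" by (simp add: gaussian_def)
    then have "emeasure lborel (UNIV :: 'a set) = 0" by (simp add: AE_iff_measurable[OF _ refl])
    then show False by (simp add: emeasure_lborel_UNIV)
  qed
  moreover have "0 \<le> I" unfolding I_def by (intro integral_nonneg_AE) simp
  ultimately have I: "0 < I" by simp
  have "(norm (gaussian_window y))\<^sup>2 = (1 / I) * (norm (gaussian pi y))\<^sup>2" for y :: 'a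
    using I by (simp add: gaussian_window_def I_def[symmetric] norm_mult power_mult_distrib norm_divide power_divide)
  then have "(\<integral>y. (norm (gaussian_window (y :: 'a)))\<^sup>2 \<partial>lborel) = (1 / I) * I"
    unfolding I_def[symmetric] by (simp only: integral_mult_right_zero I_def)
  then show ?thesis using I by simp
qed

text \<open>Converts the evolution of coherent states to packets without the symmetric phase: the
  phase \<pi> x \<cdot> \<xi> is removed at the initial point and restored at the rotated point,
  next to the ground state phase.\<close>

definition evolution_phase :: "real \<Rightarrow> 'a::euclidean_space \<Rightarrow> 'a \<Rightarrow> complex" where
  "evolution_phase t x \<xi> = cis (t * (real DIM('a) / 2) - pi * (x \<bullet> \<xi>) + pi * (rotate_position t x \<xi> \<bullet> rotate_frequency t x \<xi>))"

lemma norm_evolution_phase [simp]: "norm (evolution_phase t x \<xi>) = 1"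
  by (simp add: evolution_phase_def)

definition evolved_packet :: "real \<Rightarrow> 'a::euclidean_space \<Rightarrow> 'a \<Rightarrow> 'a \<Rightarrow> complex" where
  "evolved_packet t x \<xi> y = evolution_phase t x \<xi> *
     wave_packet gaussian_window (rotate_position t x \<xi>) (rotate_frequency t x \<xi>) y"

text \<open>The candidate for the Schwartz representative of \<open>U t \<phi>\<close>: the
  inversion formula with every packet replaced by its evolution. It is defined at every point and
  without reference to \<open>U\<close>.\<close>

definition evolved_superposition :: "real \<Rightarrow> ('a::euclidean_space \<Rightarrow> complex) \<Rightarrow> 'a \<Rightarrow> complex" where
  "evolved_superposition t \<phi> y =
     (\<integral>p. stft gaussian_window \<phi> p * evolved_packet t (fst p) (- snd p) y \<partial>lborel)"

lemma continuous_on_evolution_phase: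
  "continuous_on A f \<Longrightarrow> continuous_on A g \<Longrightarrow> continuous_on A (\<lambda>p. evolution_phase t (f p) (g p))"
  unfolding evolution_phase_def rotate_position_def rotate_frequency_def by (intro continuous_intros)

lemma rotate_pair_norm_le:
  fixes p :: "'a::euclidean_space \<times> 'a"
  shows "norm (rotate_position t (fst p) (- snd p)) \<le> 2 * (1 + norm p)"
    "norm (rotate_frequency t (fst p) (- snd p)) \<le> 2 * (1 + norm p)"
  using rotate_norm_le[of t "fst p" "- snd p"] norm_fst_le[of "fst p" "snd p"] norm_snd_le[of "snd p" "fst p"]
  by auto

lemma schwartz_family_evolved:
  fixes \<phi> :: "'a::euclidean_space \<Rightarrow> complex"
  assumes \<phi>: "\<phi> \<in> schwartz"
  shows "schwartz_family (\<lambda>p y. stft gaussian_window \<phi> p * evolved_packet t (fst p) (- snd p) y)"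
proof -
  have "schwartz_family (\<lambda>(p :: 'a \<times> 'a) y. (stft gaussian_window \<phi> p * evolution_phase t (fst p) (- snd p)) *
     wave_packet gaussian_window (rotate_position t (fst p) (- snd p)) (rotate_frequency t (fst p) (- snd p)) y)"
  proof (rule schwartz_family_wave_packet[where L=2])
    show "continuous_on UNIV (\<lambda>p :: 'a \<times> 'a. stft gaussian_window \<phi> p * evolution_phase t (fst p) (- snd p))"
      by (intro continuous_on_mult stft_continuous schwartz_gaussian_window \<phi> continuous_on_evolution_phase continuous_intros)
    show "continuous_on UNIV (\<lambda>p :: 'a \<times> 'a. rotate_position t (fst p) (- snd p))"
      "continuous_on UNIV (\<lambda>p :: 'a \<times> 'a. rotate_frequency t (fst p) (- snd p))"
      unfolding rotate_position_def rotate_frequency_def by (intro continuous_intros)+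
    show "\<exists>C. \<forall>p. norm (stft gaussian_window \<phi> p * evolution_phase t (fst p) (- snd p)) \<le> C / (1 + norm p) ^ M" for M
      using stft_rapid_decay[OF schwartz_gaussian_window \<phi>, of M] by (simp add: norm_mult)
  qed (rule schwartz_gaussian_window rotate_pair_norm_le)+
  then show ?thesis by (simp only: evolved_packet_def mult.assoc)
qed

lemma evolved_superposition_schwartz:
  assumes "\<phi> \<in> schwartz"
  shows "evolved_superposition t \<phi> \<in> schwartz"
  unfolding evolved_superposition_def[abs_def]
  by (rule schwartz_integral_family[OF schwartz_family_evolved[OF assms]])

text \<open>Continuity of the evolution on the Schwartz space, with a loss of derivatives. It is
  what makes the transposed evolution of a tempered distribution tempered.\<close>

lemma evolved_superposition_bound:
  "\<exists>C\<ge>0. \<exists>M. \<forall>\<phi> B. \<phi> \<in> schwartz \<longrightarrow> seminorm_bound M \<phi> B \<longrightarrow>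
     seminorm_bound N (evolved_superposition t (\<phi> :: 'a::euclidean_space \<Rightarrow> complex)) (C * B)"
proof -
  define g where "g = (gaussian_window :: 'a \<Rightarrow> complex)"
  have g: "g \<in> schwartz" unfolding g_def by (rule schwartz_gaussian_window)
  define D where "D = 2 * DIM('a \<times> 'a)"
  \<comment> \<open>The coefficients spend 2 N powers on the seminorms of the rotated packets and D,
    twice the dimension of phase space, on integrability.\<close>
  define M where "M = 2 * N + D"
  obtain A where A: "seminorm_bound N g A" using schwartz_bound_ex[OF g] by blast
  obtain A' where A': "seminorm_bound M g A'" using schwartz_bound_ex[OF g] by blast
  have A0: "0 \<le> A" and A'0: "0 \<le> A'" using seminorm_bound_nonneg A A' by blast+
  define c where "c = decay_const TYPE('a) M * 2 ^ M * A'"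
  have c0: "0 \<le> c" using A'0 decay_const_nonneg[where ?'a='a] by (simp add: c_def)
  define I where "I = (\<integral>p. 1 / (1 + norm (p :: 'a \<times> 'a)) ^ D \<partial>lborel)"
  have I0: "0 \<le> I" unfolding I_def by (intro integral_nonneg_AE) auto
  define C where "C = c * ((4 * pi) ^ N * 9 ^ N * A) * I"
  have "seminorm_bound N (evolved_superposition t \<phi>) (C * B)"
    if \<phi>: "\<phi> \<in> schwartz" and B: "seminorm_bound (M + 2 * DIM('a)) \<phi> B" for \<phi> :: "'a \<Rightarrow> complex" and B
  proof -
    have B0: "0 \<le> B" using seminorm_bound_nonneg[OF B] .
    have "seminorm_bound N (evolved_superposition t \<phi>) (\<integral>p. c * ((4 * pi) ^ N * 9 ^ N * A) * B * (1 / (1 + norm (p :: 'a \<times> 'a)) ^ D) \<partial>lborel)"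
      unfolding evolved_superposition_def[abs_def]
    proof (rule seminorm_bound_integral_family[OF schwartz_family_evolved[OF \<phi>]])
      fix p :: "'a \<times> 'a"
      let ?x = "rotate_position t (fst p) (- snd p)" and ?f = "rotate_frequency t (fst p) (- snd p)"
      have st: "norm (stft g \<phi> p) \<le> c * B / (1 + norm p) ^ M"
        using stft_decay[OF g A' \<phi> B, of p] by (simp add: c_def mult.assoc)
      have "u \<le> 2 * (1 + v) \<Longrightarrow> 0 \<le> v \<Longrightarrow> 1 + u \<le> 3 * (1 + v)" for u v :: real by simp
      note a = this[OF rotate_pair_norm_le(1)[of t p] norm_ge_zero] this[OF rotate_pair_norm_le(2)[of t p] norm_ge_zero]
      have "((1 + norm ?x) * (1 + norm ?f)) ^ N \<le> ((3 * (1 + norm p)) * (3 * (1 + norm p))) ^ N"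
        using a by (intro power_mono mult_mono) auto
      also have "\<dots> = 9 ^ N * (1 + norm p) ^ (2 * N)"
      proof -
        have "(3 * v) * (3 * v) = 9 * v\<^sup>2" for v :: real by (simp add: power2_eq_square)
        then show ?thesis by (simp only: power_mult_distrib power_mult)
      qed
      finally have b: "((1 + norm ?x) * (1 + norm ?f)) ^ N \<le> 9 ^ N * (1 + norm p) ^ (2 * N)" .
      have "seminorm_bound N (\<lambda>y. (stft g \<phi> p * evolution_phase t (fst p) (- snd p)) * wave_packet g ?x ?f y)
        (c * ((4 * pi) ^ N * 9 ^ N * A) * B * (1 / (1 + norm p) ^ D))"
      proof (rule seminorm_bound_cmult[OF seminorm_bound_wave_packet[OF schwartz_smooth[OF g] A] smooth_wave_packet[OF schwartz_smooth[OF g]]])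
        have "norm (stft g \<phi> p * evolution_phase t (fst p) (- snd p)) * ((4 * pi) ^ N * ((1 + norm ?x) * (1 + norm ?f)) ^ N * A)
          \<le> c * B / (1 + norm p) ^ M * ((4 * pi) ^ N * (9 ^ N * (1 + norm p) ^ (2 * N)) * A)"
          using A0 B0 c0 st by (intro mult_mono mult_left_mono mult_right_mono b) (auto simp: norm_mult)
        also have "\<dots> = c * ((4 * pi) ^ N * 9 ^ N * A) * B * (1 / (1 + norm p) ^ D)"
        proof -
          have "c * B / (v * w) * ((4 * pi) ^ N * (9 ^ N * v) * A) = c * ((4 * pi) ^ N * 9 ^ N * A) * B * (1 / w)" if "0 < v" for v w
            using that by simp
          moreover have "0 < (1 + norm p) ^ (2 * N)" by (intro zero_less_power) (simp add: add_pos_nonneg)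
          ultimately show ?thesis unfolding M_def power_add by blast
        qed
        finally show "norm (stft g \<phi> p * evolution_phase t (fst p) (- snd p)) * ((4 * pi) ^ N * ((1 + norm ?x) * (1 + norm ?f)) ^ N * A)
          \<le> c * ((4 * pi) ^ N * 9 ^ N * A) * B * (1 / (1 + norm p) ^ D)" .
      qed
      then show "seminorm_bound N (\<lambda>y. stft gaussian_window \<phi> p * evolved_packet t (fst p) (- snd p) y)
        (c * ((4 * pi) ^ N * 9 ^ N * A) * B * (1 / (1 + norm p) ^ D))"
        by (simp only: evolved_packet_def g_def mult.assoc)
    qed (unfold D_def, intro integrable_mult_right integrable_inverse_power_norm)
    moreover have "(\<integral>p. c * ((4 * pi) ^ N * 9 ^ N * A) * B * (1 / (1 + norm (p :: 'a \<times> 'a)) ^ D) \<partial>lborel) = C * B"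
      unfolding integral_mult_right_zero I_def[symmetric] C_def by (simp only: mult_ac)
    ultimately show ?thesis by simp
  qed
  moreover have "0 \<le> C" unfolding C_def using c0 A0 I0 by simp
  ultimately show ?thesis by blast
qed

section \<open>The propagator on Schwartz functions\<close>

context
  fixes U :: "real \<Rightarrow> ('a::euclidean_space \<Rightarrow> complex) \<Rightarrow> 'a \<Rightarrow> complex"
  assumes U: "unitary_group_generated_by U (closure_from_schwartz harmonic_oscillator)"
begin

lemma propagator_gaussian_packet:
  "AE y in lborel. U t (wave_packet gaussian_window x \<xi>) y = evolved_packet t x \<xi> y"
proof -
  define \<kappa> where "\<kappa> = complex_of_real (1 / sqrt (\<integral>z. (norm (gaussian pi (z :: 'a)))\<^sup>2 \<partial>lborel))"
  have gw: "gaussian_window y = \<kappa> * gaussian pi y" for y :: 'a by (simp only: gaussian_window_def \<kappa>_def)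
  \<comment> \<open>The scalar undoes the symmetric phase of the coherent state and inserts the
    normalising constant.\<close>
  let ?a = "\<kappa> * cis (- (pi * (x \<bullet> \<xi>)))"
  have c: "coherent x \<xi> \<in> L2_space" by (rule schwartz_L2[OF schwartz_coherent])
  have "wave_packet gaussian_window x \<xi> = (\<lambda>y. ?a * coherent x \<xi> y + 0 * coherent x \<xi> y)"
    by (simp add: fun_eq_iff wave_packet_def coherent_def gw mult.assoc[symmetric] cis_mult)
  then have "AE y in lborel. U t (wave_packet gaussian_window x \<xi>) y = ?a * U t (coherent x \<xi>) y + 0 * U t (coherent x \<xi>) y"
    using propagator_lincomb[OF U c c, of t ?a 0] by simp
  then show ?thesis
    using propagator_coherent[OF U, of t x \<xi>]
  proof eventually_elim
    case (elim y)
    have "cis (- (pi * (x \<bullet> \<xi>))) * (cis (t * (real DIM('a) / 2)) * cis (pi * (rotate_position t x \<xi> \<bullet> rotate_frequency t x \<xi>))) = evolution_phase t x \<xi>"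
      by (simp add: evolution_phase_def cis_mult add_diff_eq diff_add_eq)
    moreover have "?a * coherent_flow x \<xi> t y = cis (- (pi * (x \<bullet> \<xi>))) * (cis (t * (real DIM('a) / 2)) * cis (pi * (rotate_position t x \<xi> \<bullet> rotate_frequency t x \<xi>)))
      * (\<kappa> * wave_packet (gaussian pi) (rotate_position t x \<xi>) (rotate_frequency t x \<xi>) y)"
      by (simp only: coherent_flow_def coherent_def mult_ac)
    ultimately have "?a * coherent_flow x \<xi> t y = evolved_packet t x \<xi> y"
      by (simp add: evolved_packet_def wave_packet_def gw mult_ac)
    with elim show ?case by simp
  qed
qed

lemma propagator_sum:
  assumes "finite S" "\<And>c. c \<in> S \<Longrightarrow> f c \<in> schwartz"
  shows "AE y in lborel. U t (\<lambda>y. \<Sum>c\<in>S. m c * f c y) y = (\<Sum>c\<in>S. m c * U t (f c) y)"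
  using assms
proof (induction S rule: finite_induct)
  case empty
  have z: "(\<lambda>y :: 'a. 0) \<in> L2_space" by (rule schwartz_L2[OF schwartz_zero])
  from propagator_lincomb[OF U z z, of t 0 0] show ?case by simp
next
  case (insert c S)
  have 1: "f c \<in> L2_space" using insert by (intro schwartz_L2) auto
  have 2: "(\<lambda>y. \<Sum>c\<in>S. m c * f c y) \<in> L2_space" using insert by (intro schwartz_L2 schwartz_sum) auto
  have "AE y in lborel. U t (\<lambda>y. \<Sum>c\<in>S. m c * f c y) y = (\<Sum>c\<in>S. m c * U t (f c) y)"
    using insert by auto
  with propagator_lincomb[OF U 1 2, of t "m c" 1] show ?case
    using insert.hyps by (auto elim: eventually_elim2)
qed

text \<open>The propagator is applied to the quadrature sums of the Gaussian wave packet expansion.\<close>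

theorem propagator_schwartz:
  assumes \<phi>: "\<phi> \<in> schwartz"
  shows "AE y in lborel. U t \<phi> y = evolved_superposition t \<phi> y"
proof -
  obtain S :: "nat \<Rightarrow> ('a \<times> 'a) set" and m where S: "\<forall>n. finite (S n)"
    and q: "\<forall>(K :: 'a \<times> 'a \<Rightarrow> 'a \<Rightarrow> complex) N. schwartz_family K \<longrightarrow>
      (\<lambda>n. schwartz_norm N (\<lambda>y. (\<Sum>c\<in>S n. of_real (m n c) * K c y) - (\<integral>z. K z y \<partial>lborel))) \<longlonglongrightarrow> 0"
    using quadrature[where ?'a='a and ?'b="'a \<times> 'a"] by (elim exE conjE) (rule that)
  note S = S[rule_format] and q = q[rule_format]
  let ?b = "stft gaussian_window \<phi>"
  define K1 where "K1 p y = ?b p * wave_packet gaussian_window (fst p) (- snd p) y" for p y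
  define K2 where "K2 p y = ?b p * evolved_packet t (fst p) (- snd p) y" for p y
  have K1: "schwartz_family K1" unfolding K1_def[abs_def]
    by (intro schwartz_family_stft schwartz_gaussian_window \<phi>)
  have K2: "schwartz_family K2" unfolding K2_def[abs_def] by (rule schwartz_family_evolved[OF \<phi>])
  have I1: "(\<lambda>y. \<integral>p. K1 p y \<partial>lborel) = \<phi>"
    unfolding K1_def using stft_inversion[OF schwartz_gaussian_window \<phi> gaussian_window_norm] by blast
  have I2: "(\<lambda>y. \<integral>p. K2 p y \<partial>lborel) = evolved_superposition t \<phi>"
    by (simp add: K2_def evolved_superposition_def fun_eq_iff)
  \<comment> \<open>\<open>Q1 n\<close> approximates \<phi> by finitely many packets.
    \<open>Q2 n\<close> takes the same nodes, weights and coefficients with the evolved packets, so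
    the propagator maps one to the other.\<close>
  define Q1 where "Q1 n y = (\<Sum>c\<in>S n. of_real (m n c) * K1 c y)" for n y
  define Q2 where "Q2 n y = (\<Sum>c\<in>S n. of_real (m n c) * K2 c y)" for n y
  have Q1s: "Q1 n \<in> schwartz" and Q2s: "Q2 n \<in> schwartz" for n
    unfolding Q1_def[abs_def] Q2_def[abs_def] using schwartz_familyD(1)[OF K1] schwartz_familyD(1)[OF K2]
    by (auto intro!: schwartz_sum S)
  note es = evolved_superposition_schwartz[OF \<phi>, of t]
  define c where "c = sqrt (\<integral>x. 1 / (1 + norm (x :: 'a)) ^ (2 * DIM('a)) \<partial>lborel)"
  have c0: "0 \<le> c" unfolding c_def by (intro real_sqrt_ge_zero integral_nonneg_AE) auto
  have dist_le: "L2_dist f h \<le> schwartz_norm (2 * DIM('a)) (\<lambda>y. f y - h y) * c" if "f \<in> schwartz" "h \<in> schwartz" for f h :: "'a \<Rightarrow> complex"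
    using schwartz_Lp_norm_2_le[OF schwartz_diff[OF that]] schwartz_norm_nonneg[OF schwartz_diff[OF that]] c0
    unfolding L2_dist_def c_def by (intro enn2real_leI) auto
  have "AE y in lborel. U t (Q1 n) y = Q2 n y" for n
  proof -
    have wp: "wave_packet gaussian_window x \<xi> \<in> schwartz" for x \<xi> :: 'a by (rule schwartz_wave_packet[OF schwartz_gaussian_window])
    have "Q1 n = (\<lambda>y. \<Sum>c\<in>S n. (of_real (m n c) * ?b c) * wave_packet gaussian_window (fst c) (- snd c) y)"
      by (simp add: Q1_def K1_def fun_eq_iff mult.assoc)
    then have "AE y in lborel. U t (Q1 n) y = (\<Sum>c\<in>S n. (of_real (m n c) * ?b c) * U t (wave_packet gaussian_window (fst c) (- snd c)) y)"
      using propagator_sum[OF S wp] by simp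
    moreover have "AE y in lborel. \<forall>c\<in>S n. U t (wave_packet gaussian_window (fst c) (- snd c)) y = evolved_packet t (fst c) (- snd c) y"
      by (intro AE_finite_allI S propagator_gaussian_packet)
    ultimately show ?thesis
      by eventually_elim (simp add: Q2_def K2_def mult.assoc)
  qed
  \<comment> \<open>Unitarity carries the approximation error of \<phi> to time t without
    loss.\<close>
  then have d: "L2_dist (U t \<phi>) (evolved_superposition t \<phi>) \<le> L2_dist \<phi> (Q1 n) + L2_dist (Q2 n) (evolved_superposition t \<phi>)" for n
  proof -
    note L = propagator_L2[OF U] schwartz_L2[OF \<phi>] schwartz_L2[OF Q1s] schwartz_L2[OF Q2s] schwartz_L2[OF es]
    have "L2_dist (U t \<phi>) (evolved_superposition t \<phi>) \<le> L2_dist (U t \<phi>) (U t (Q1 n)) + L2_dist (U t (Q1 n)) (evolved_superposition t \<phi>)"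
      by (intro L2_dist_triangle L)
    also have "L2_dist (U t \<phi>) (U t (Q1 n)) = L2_dist \<phi> (Q1 n)" by (intro propagator_dist[OF U] L)
    also have "L2_dist (U t (Q1 n)) (evolved_superposition t \<phi>) = L2_dist (Q2 n) (evolved_superposition t \<phi>)"
      using \<open>AE y in lborel. U t (Q1 n) y = Q2 n y\<close> by (intro L2_dist_cong_AE L) auto
    finally show ?thesis .
  qed
  have l1: "(\<lambda>n. schwartz_norm (2 * DIM('a)) (\<lambda>y. Q1 n y - \<phi> y) * c) \<longlonglongrightarrow> 0"
    using tendsto_mult_left_zero[OF q[OF K1, of "2 * DIM('a)"], of c] unfolding Q1_def I1[symmetric] .
  have l2: "(\<lambda>n. schwartz_norm (2 * DIM('a)) (\<lambda>y. Q2 n y - evolved_superposition t \<phi> y) * c) \<longlonglongrightarrow> 0"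
    using tendsto_mult_left_zero[OF q[OF K2, of "2 * DIM('a)"], of c] unfolding Q2_def I2[symmetric] .
  have "L2_dist (U t \<phi>) (evolved_superposition t \<phi>) \<le> 0"
  proof (rule LIMSEQ_le_const)
    show "(\<lambda>n. schwartz_norm (2 * DIM('a)) (\<lambda>y. Q1 n y - \<phi> y) * c + schwartz_norm (2 * DIM('a)) (\<lambda>y. Q2 n y - evolved_superposition t \<phi> y) * c) \<longlonglongrightarrow> 0"
      using tendsto_add[OF l1 l2] by simp
    have "L2_dist (U t \<phi>) (evolved_superposition t \<phi>)
      \<le> schwartz_norm (2 * DIM('a)) (\<lambda>y. Q1 n y - \<phi> y) * c + schwartz_norm (2 * DIM('a)) (\<lambda>y. Q2 n y - evolved_superposition t \<phi> y) * c" for n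
      using d[of n] dist_le[OF Q1s \<phi>, of n] dist_le[OF Q2s es, of n] L2_dist_commute[of \<phi> "Q1 n"] by linarith
    then show "\<exists>N. \<forall>n\<ge>N. L2_dist (U t \<phi>) (evolved_superposition t \<phi>)
      \<le> schwartz_norm (2 * DIM('a)) (\<lambda>y. Q1 n y - \<phi> y) * c + schwartz_norm (2 * DIM('a)) (\<lambda>y. Q2 n y - evolved_superposition t \<phi> y) * c"
      by blast
  qed
  then have "L2_dist (U t \<phi>) (evolved_superposition t \<phi>) = 0" using L2_dist_nonneg[of "U t \<phi>" "evolved_superposition t \<phi>"] by linarith
  then show ?thesis by (intro L2_dist_eq_0 propagator_L2[OF U] schwartz_L2 \<phi> es)
qed

lemma schwartz_representative_propagator:
  assumes "\<phi> \<in> schwartz"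
  shows "schwartz_representative (U t \<phi>) = evolved_superposition t \<phi>"
  by (rule schwartz_representative_eq[OF evolved_superposition_schwartz[OF assms] propagator_schwartz[OF assms]])

text \<open>Linearity is inherited from \<open>U\<close>: it holds almost everywhere there, and both
  sides are Schwartz functions.\<close>

lemma evolved_superposition_lincomb:
  fixes f h :: "'a \<Rightarrow> complex"
  assumes f: "f \<in> schwartz" and h: "h \<in> schwartz"
  shows "evolved_superposition t (\<lambda>y. a * f y + b * h y) = (\<lambda>y. a * evolved_superposition t f y + b * evolved_superposition t h y)"
proof (rule schwartz_eq_if_AE_eq)
  have s: "(\<lambda>y. a * f y + b * h y) \<in> schwartz" by (intro schwartz_add schwartz_cmult f h)
  show "evolved_superposition t (\<lambda>y. a * f y + b * h y) \<in> schwartz" by (rule evolved_superposition_schwartz[OF s])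
  show "(\<lambda>y. a * evolved_superposition t f y + b * evolved_superposition t h y) \<in> schwartz"
    by (intro schwartz_add schwartz_cmult evolved_superposition_schwartz f h)
  show "AE y in lborel. evolved_superposition t (\<lambda>y. a * f y + b * h y) y = a * evolved_superposition t f y + b * evolved_superposition t h y"
    using propagator_schwartz[OF s, of t] propagator_schwartz[OF f, of t] propagator_schwartz[OF h, of t]
      propagator_lincomb[OF U schwartz_L2[OF f] schwartz_L2[OF h], of t a b]
    by eventually_elim simp
qed

section \<open>Evolution of tempered distributions\<close>

lemma dist_evolution_eq:
  assumes "\<phi> \<in> schwartz"
  shows "dist_evolution U t T \<phi> = T (\<lambda>x. cnj (evolved_superposition (- t) (\<lambda>y. cnj (\<phi> y)) x))"
  unfolding dist_evolution_def schwartz_representative_propagator[OF schwartz_cnj[OF assms]] ..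

text \<open>The two conjugations around the evolution make the transpose linear rather than
  antilinear, and they preserve seminorm bounds; the rest is continuity on Schwartz
  functions.\<close>

lemma tempered_dist_evolution:
  assumes T: "tempered T"
  shows "tempered (dist_evolution U t T)"
  unfolding tempered_def
proof (intro conjI ballI allI)
  let ?E = "\<lambda>\<phi> x. cnj (evolved_superposition (- t) (\<lambda>y. cnj (\<phi> y)) x)"
  have Es: "?E \<phi> \<in> schwartz" if "\<phi> \<in> schwartz" for \<phi> :: "'a \<Rightarrow> complex"
    by (intro schwartz_cnj evolved_superposition_schwartz that)
  fix \<phi> \<psi> :: "'a \<Rightarrow> complex" and a b assume s: "\<phi> \<in> schwartz" "\<psi> \<in> schwartz"
  have "?E (\<lambda>x. a * \<phi> x + b * \<psi> x) = (\<lambda>x. a * ?E \<phi> x + b * ?E \<psi> x)"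
    using evolved_superposition_lincomb[OF schwartz_cnj[OF s(1)] schwartz_cnj[OF s(2)], of "- t" "cnj a" "cnj b"]
    by (simp add: fun_eq_iff)
  then show "dist_evolution U t T (\<lambda>x. a * \<phi> x + b * \<psi> x) = a * dist_evolution U t T \<phi> + b * dist_evolution U t T \<psi>"
    using s by (simp add: dist_evolution_eq schwartz_add schwartz_cmult tempered_lincomb[OF T] Es)
next
  obtain C N where C: "0 \<le> C" "\<And>\<phi> B. \<phi> \<in> schwartz \<Longrightarrow> seminorm_bound N \<phi> B \<Longrightarrow> norm (T \<phi>) \<le> C * B"
    using tempered_bound[OF T] by metis
  obtain D M where D: "\<And>\<phi> B. \<phi> \<in> schwartz \<Longrightarrow> seminorm_bound M \<phi> B \<Longrightarrow>
     seminorm_bound N (evolved_superposition (- t) (\<phi> :: 'a \<Rightarrow> complex)) (D * B)"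
    using evolved_superposition_bound[of N "- t", where ?'a='a] by blast
  have "norm (dist_evolution U t T \<phi>) \<le> (C * D) * schwartz_norm M \<phi>" if \<phi>: "\<phi> \<in> schwartz" for \<phi> :: "'a \<Rightarrow> complex"
  proof -
    have "seminorm_bound M (\<lambda>y. cnj (\<phi> y)) (schwartz_norm M \<phi>)"
      by (rule seminorm_bound_cnj[OF schwartz_smooth[OF \<phi>] seminorm_bound_schwartz_norm[OF \<phi>]])
    note 1 = D[OF schwartz_cnj[OF \<phi>] this]
    note es = evolved_superposition_schwartz[OF schwartz_cnj[OF \<phi>], of "- t"]
    show ?thesis
      using C(2)[OF schwartz_cnj[OF es] seminorm_bound_cnj[OF schwartz_smooth[OF es] 1]]
      by (simp add: dist_evolution_eq[OF \<phi>] mult.assoc)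
  qed
  then show "\<exists>C N. \<forall>\<phi>\<in>schwartz. norm (dist_evolution U t T \<phi>) \<le> C * schwartz_norm N \<phi>" by blast
qed

text \<open>Time reversal: conjugation sends the frequency \<xi> to -\<xi>, and rotating (x, -\<xi>)
  by -t gives the rotation of (x, \<xi>) by t with its frequency negated. The outer conjugation
  negates it once more, so only a unimodular phase remains. The Gaussian is real, hence
  unaffected.\<close>

lemma dist_evolution_gaussian_packet:
  assumes T: "tempered T"
  shows "norm (dist_evolution U t T (wave_packet gaussian_window x \<xi>))
    = norm (T (wave_packet gaussian_window (rotate_position t x \<xi>) (rotate_frequency t x \<xi>)))"
proof -
  have wp: "wave_packet gaussian_window x \<xi> \<in> schwartz" for x \<xi> :: 'a by (rule schwartz_wave_packet[OF schwartz_gaussian_window])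
  have cnj_wp: "(\<lambda>y. cnj (wave_packet gaussian_window x \<xi> y)) = wave_packet gaussian_window x (- \<xi>)" for x \<xi> :: 'a
    by (simp add: fun_eq_iff wave_packet_def modulation_def cis_cnj)
  have "evolved_superposition (- t) (wave_packet gaussian_window x (- \<xi>)) = evolved_packet (- t) x (- \<xi>)"
  proof (rule schwartz_eq_if_AE_eq)
    show "evolved_packet (- t) x (- \<xi>) \<in> schwartz"
      unfolding evolved_packet_def[abs_def] by (intro schwartz_cmult wp)
    show "AE y in lborel. evolved_superposition (- t) (wave_packet gaussian_window x (- \<xi>)) y = evolved_packet (- t) x (- \<xi>) y"
      using propagator_schwartz[OF wp, of "- t" x "- \<xi>"] propagator_gaussian_packet[of "- t" x "- \<xi>"]
      by eventually_elim simp
  qed (rule evolved_superposition_schwartz[OF wp])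
  moreover have "(\<lambda>y. cnj (evolved_packet (- t) x (- \<xi>) y))
    = (\<lambda>y. cnj (evolution_phase (- t) x (- \<xi>)) * wave_packet gaussian_window (rotate_position t x \<xi>) (rotate_frequency t x \<xi>) y)"
  proof -
    have "rotate_position (- t) x (- \<xi>) = rotate_position t x \<xi>" "- rotate_frequency (- t) x (- \<xi>) = rotate_frequency t x \<xi>"
      by (simp_all add: rotate_position_def rotate_frequency_def)
    then show ?thesis
      using fun_cong[OF cnj_wp[of "rotate_position (- t) x (- \<xi>)" "rotate_frequency (- t) x (- \<xi>)"]]
      by (simp add: evolved_packet_def fun_eq_iff)
  qed
  ultimately have "dist_evolution U t T (wave_packet gaussian_window x \<xi>)
    = T (\<lambda>y. cnj (evolution_phase (- t) x (- \<xi>)) * wave_packet gaussian_window (rotate_position t x \<xi>) (rotate_frequency t x \<xi>) y)"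
    by (simp add: dist_evolution_eq[OF wp] cnj_wp)
  then show ?thesis by (simp add: tempered_cmult[OF T wp] norm_mult)
qed

end

section \<open>The estimate for the given window\<close>

lemma Lp_norm_2_eq_1_imp:
  assumes g: "g \<in> schwartz" and 1: "Lp_norm 2 g = 1"
  shows "(\<integral>y. (norm (g y))\<^sup>2 \<partial>lborel) = 1"
  using Lp_norm_2_decay(1)[OF schwartz_borel_measurable[OF g] seminorm_bound_decay[OF seminorm_bound_schwartz_norm[OF g]]] 1
  by (simp add: ennreal_eq_1)

theorem proposition5p1:
  fixes g :: "'a::euclidean_space \<Rightarrow> complex"
    and U :: "real \<Rightarrow> ('a \<Rightarrow> complex) \<Rightarrow> 'a \<Rightarrow> complex"
    and r r' :: ennreal
  assumes window: "test_function g" "Lp_norm 2 g = 1"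
    and propagator: "unitary_group_generated_by U (closure_from_schwartz harmonic_oscillator)"
    and exponents: "2 \<le> r" "1 / r + 1 / r' = 1"
  shows "\<exists>C::real. \<forall>t. sin t \<noteq> 0 \<longrightarrow> (\<forall>u\<^sub>0 \<in> amalgam g r r'.
           dist_evolution U t u\<^sub>0 \<in> amalgam g r' r \<and>
           amalgam_norm g r' r (dist_evolution U t u\<^sub>0)
             \<le> ennreal (C * \<bar>sin t\<bar> powr (- 2 * real DIM('a) * (1 / 2 - enn2real (1 / r))))
                * amalgam_norm g r r' u\<^sub>0)"
proof -
  let ?G = "gaussian_window :: 'a \<Rightarrow> complex"
  have g: "g \<in> schwartz" by (rule test_function_schwartz[OF window(1)])
  have g1: "(\<integral>y. (norm (g y))\<^sup>2 \<partial>lborel) = 1" by (rule Lp_norm_2_eq_1_imp[OF g window(2)])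
  have r': "1 \<le> r'" and r1: "1 \<le> r" using conjugate_exponents(1,2)[OF exponents] by auto
  \<comment> \<open>The evolved distribution is measured in the target norm and passes from g to the
    Gaussian; the initial datum passes from the Gaussian back to g in the source norm, with
    exponents interchanged. Both constants are fixed before t.\<close>
  obtain C1 where C1: "0 \<le> C1" "\<And>T. tempered T \<Longrightarrow> amalgam_norm g r' r T \<le> ennreal C1 * amalgam_norm ?G r' r T"
    using amalgam_norm_window_change[OF schwartz_gaussian_window g gaussian_window_norm r' r1] by blast
  obtain C2 where C2: "0 \<le> C2" "\<And>T. tempered T \<Longrightarrow> amalgam_norm ?G r r' T \<le> ennreal C2 * amalgam_norm g r r' T"
    using amalgam_norm_window_change[OF g schwartz_gaussian_window g1 r1 r'] by blast
  show ?thesis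
  proof (intro exI[of _ "C1 * C2"] allI impI ballI)
    fix t :: real and u\<^sub>0 :: "'a distribution" assume t: "sin t \<noteq> 0" and "u\<^sub>0 \<in> amalgam g r r'"
    then have u: "tempered u\<^sub>0" and fin: "amalgam_norm g r r' u\<^sub>0 < \<infinity>" by (auto simp: amalgam_def)
    let ?s = "\<bar>sin t\<bar> powr (- 2 * real DIM('a) * (1 / 2 - enn2real (1 / r)))"
    have tu: "tempered (dist_evolution U t u\<^sub>0)" by (rule tempered_dist_evolution[OF propagator u])
    define F where "F x \<xi> = ennreal (norm (u\<^sub>0 (wave_packet ?G x \<xi>)))" for x \<xi>
    have F: "(\<lambda>(x, \<xi>). F x \<xi>) \<in> borel_measurable (lborel \<Otimes>\<^sub>M lborel)"
      unfolding F_def case_prod_beta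
      using borel_measurable_tempered_wave_packet[OF u schwartz_gaussian_window, of fst "lborel \<Otimes>\<^sub>M lborel" snd] by measurable
    have "amalgam_norm ?G r' r (dist_evolution U t u\<^sub>0)
      = eLp_norm r (\<lambda>x. eLp_norm r' (\<lambda>\<xi>. F (cos t *\<^sub>R x + sin t *\<^sub>R \<xi>) (cos t *\<^sub>R \<xi> - sin t *\<^sub>R x)))"
      unfolding amalgam_norm_eq[OF tu schwartz_gaussian_window r'] dist_evolution_gaussian_packet[OF propagator u] F_def
        rotate_position_def rotate_frequency_def ..
    also have "\<dots> \<le> ennreal ?s * eLp_norm r' (\<lambda>y. eLp_norm r (F y))"
      by (rule eLp_norm_rotation_le[OF F _ t exponents]) simp
    also have "eLp_norm r' (\<lambda>y. eLp_norm r (F y)) = amalgam_norm ?G r r' u\<^sub>0"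
      unfolding amalgam_norm_eq[OF u schwartz_gaussian_window r1] F_def ..
    finally have "amalgam_norm g r' r (dist_evolution U t u\<^sub>0) \<le> ennreal C1 * (ennreal ?s * (ennreal C2 * amalgam_norm g r r' u\<^sub>0))"
      by (intro order_trans[OF C1(2)[OF tu]] mult_left_mono order_trans[OF _ mult_left_mono[OF C2(2)[OF u]]]) auto
    also have "\<dots> = ennreal (C1 * C2 * ?s) * amalgam_norm g r r' u\<^sub>0"
      using C1(1) C2(1) by (simp add: ennreal_mult mult_ac)
    finally have le: "amalgam_norm g r' r (dist_evolution U t u\<^sub>0) \<le> ennreal (C1 * C2 * ?s) * amalgam_norm g r r' u\<^sub>0" .
    also have "\<dots> < \<infinity>" using fin by (simp add: ennreal_mult_less_top)
    finally show "dist_evolution U t u\<^sub>0 \<in> amalgam g r' r \<and>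
      amalgam_norm g r' r (dist_evolution U t u\<^sub>0) \<le> ennreal (C1 * C2 * ?s) * amalgam_norm g r r' u\<^sub>0"
      using tu le by (simp add: amalgam_def)
  qed
qed

end
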